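(* The complete point symmetry pseudogroup $G$ of the equation $u_t+xu_y=u_{xx}$ consists of the transformations of the form $$\tilde t=\frac{\alpha t+\beta}{\gamma t+\delta},\qquad \tilde x=\frac{\hat x}{\gamma t+\delta}-\frac{3\gamma\hat y}{(\gamma t+\delta)^2},\qquad \tilde y=\frac{\hat y}{(\gamma t+\delta)^3},$$ $$\tilde u=\sigma(\gamma t+\delta)^2\exp\left(\frac{\gamma\hat x^2}{\gamma t+\delta}-\frac{3\gamma^2\hat x\hat y}{(\gamma t+\delta)^2}+\frac{3\gamma^3\hat y^2}{(\gamma t+\delta)^3}\right)\exp\bigl(3\lambda_3(y-tx)-\lambda_2x-(3\lambda_3^2t^3+3\lambda_3\lambda_2t^2+\lambda_2^2t)\bigr)\bigl(u+f(t,x,y)\bigr),$$ where $\hat x:=x+3\lambda_3t^2+2\lambda_2t+\lambda_1$ and $\hat y:=y+\lambda_3t^3+\lambda_2t^2+\lambda_1t+\lambda_0$; $\alpha,\beta,\gamma,\delta$ are arbitrary real constants with $\alpha\delta-\beta\gamma=1$; $\lambda_0,\lambda_1,\lambda_2,\lambda_3$ and $\sigma$ are arbitrary real constants with $\sigma\neq0$; and $f$ is an arbitrary solution of the equation $f_t+xf_y=f_{xx}$.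
   Context: The equation $u_t+xu_y=u_{xx}$ is a partial differential equation for a real function $u=u(t,x,y)$ of three real independent variables. A point transformation is a (local) diffeomorphism of the space $\mathbb R^4$ with coordinates $(t,x,y,u)$, written $(t,x,y,u)\mapsto(\tilde t,\tilde x,\tilde y,\tilde u)$. The complete point symmetry pseudogroup of the equation is the set of all point transformations that map the equation to itself, i.e., to the same equation written in the variables with tildes (equivalently, that map solutions to solutions). All functions are smooth and considered locally. *)

theory Defs
  imports "HOL-Analysis.Analysis"
begin

text \<open>The definitions of \<open>Ck_on\<close>, and hence of \<open>smooth_on\<close>, are intended for open sets only.\<close>

fun Ck_on :: "nat \<Rightarrow> 'a::real_normed_vector set \<Rightarrow> ('a \<Rightarrow> 'b::real_normed_vector) \<Rightarrow> bool" where
  "Ck_on 0 S f \<longleftrightarrow> continuous_on S f"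
| "Ck_on (Suc k) S f \<longleftrightarrow>
     (\<forall>p\<in>S. f differentiable (at p)) \<and>
     (\<forall>v. Ck_on k S (\<lambda>p. frechet_derivative f (at p) v))"

definition smooth_on :: "'a::real_normed_vector set \<Rightarrow> ('a \<Rightarrow> 'b::real_normed_vector) \<Rightarrow> bool" where
  "smooth_on S f \<longleftrightarrow> (\<forall>k. Ck_on k S f)"

text \<open>Coordinates are \<open>(t, x, y)\<close> on the base and \<open>(t, x, y, u)\<close> on the total space.\<close>

type_synonym base = "real \<times> real \<times> real"
type_synonym total = "real \<times> real \<times> real \<times> real"

text \<open>The equation is \<open>u_t + x u_y = u_xx\<close>.\<close>

definition solution :: "base set \<Rightarrow> (base \<Rightarrow> real) \<Rightarrow> bool" where
  "solution D v \<longleftrightarrow> open D \<and> smooth_on D v \<and>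
     (\<forall>(t, x, y)\<in>D.
        deriv (\<lambda>s. v (s, x, y)) t + x * deriv (\<lambda>s. v (t, x, s)) y
          = (deriv ^^ 2) (\<lambda>s. v (t, s, y)) x)"

definition graph_on :: "base set \<Rightarrow> (base \<Rightarrow> real) \<Rightarrow> total set" where
  "graph_on D v = {(t, x, y, v (t, x, y)) | t x y. (t, x, y) \<in> D}"

definition base_projection :: "total set \<Rightarrow> base set" where
  "base_projection U = (\<lambda>(t, x, y, u). (t, x, y)) ` U"

text \<open>
  A local diffeomorphism is given by its open domain \<open>U\<close> and a map \<open>\<Phi>\<close> whose values
  outside \<open>U\<close> are irrelevant.
\<close>

definition point_transformation :: "total set \<Rightarrow> (total \<Rightarrow> total) \<Rightarrow> bool" where
  "point_transformation U \<Phi> \<longleftrightarrow>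
     open U \<and> smooth_on U \<Phi> \<and> inj_on \<Phi> U \<and>
     open (\<Phi> ` U) \<and> smooth_on (\<Phi> ` U) (inv_into U \<Phi>)"

text \<open>
  A point transformation need not preserve the projection to the base, so it acts on functions
  through their graphs: \<open>v\<close> is transformed to \<open>w\<close> if the graph of \<open>v\<close> is mapped onto the graph
  of \<open>w\<close>.  The smoothness of \<open>w\<close> has to be required, since the image of the graph of a smooth
  function may have vertical tangents.
\<close>

definition maps_equation_to_itself :: "total set \<Rightarrow> (total \<Rightarrow> total) \<Rightarrow> bool" where
  "maps_equation_to_itself U \<Phi> \<longleftrightarrow>
     (\<forall>D v D' w. open D \<and> smooth_on D v \<and> open D' \<and> smooth_on D' w \<and>
        graph_on D v \<subseteq> U \<and> \<Phi> ` graph_on D v = graph_on D' w \<longrightarrow>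
        (solution D v \<longleftrightarrow> solution D' w))"

definition point_symmetry_pseudogroup :: "(total set \<times> (total \<Rightarrow> total)) set" where
  "point_symmetry_pseudogroup =
     {(U, \<Phi>). point_transformation U \<Phi> \<and> maps_equation_to_itself U \<Phi>}"

definition x_hat :: "real \<Rightarrow> real \<Rightarrow> real \<Rightarrow> real \<Rightarrow> real \<Rightarrow> real" where
  "x_hat l1 l2 l3 t x = x + 3 * l3 * t^2 + 2 * l2 * t + l1"

definition y_hat :: "real \<Rightarrow> real \<Rightarrow> real \<Rightarrow> real \<Rightarrow> real \<Rightarrow> real \<Rightarrow> real" where
  "y_hat l0 l1 l2 l3 t y = y + l3 * t^3 + l2 * t^2 + l1 * t + l0"

text \<open>
  The transformation formulas; the parameters \<open>a b c d l0 l1 l2 l3 s\<close> stand for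
  \<open>\<alpha>, \<beta>, \<gamma>, \<delta>, \<lambda>\<^sub>0, \<lambda>\<^sub>1, \<lambda>\<^sub>2, \<lambda>\<^sub>3, \<sigma>\<close>.
\<close>

definition symmetry_formula ::
  "real \<Rightarrow> real \<Rightarrow> real \<Rightarrow> real \<Rightarrow> real \<Rightarrow> real \<Rightarrow> real \<Rightarrow> real \<Rightarrow> real \<Rightarrow> (base \<Rightarrow> real) \<Rightarrow> total \<Rightarrow> total"
where
  "symmetry_formula a b c d l0 l1 l2 l3 s f = (\<lambda>(t, x, y, u).
     let X = x_hat l1 l2 l3 t x; Y = y_hat l0 l1 l2 l3 t y; q = c * t + d in
      ((a * t + b) / q,
       X / q - 3 * c * Y / q^2,
       Y / q^3,
       s * q^2
         * exp (c * X^2 / q - 3 * c^2 * X * Y / q^2 + 3 * c^3 * Y^2 / q^3)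
         * exp (3 * l3 * (y - t * x) - l2 * x
                - (3 * l3^2 * t^3 + 3 * l3 * l2 * t^2 + l2^2 * t))
         * (u + f (t, x, y))))"

definition has_symmetry_form :: "total set \<Rightarrow> (total \<Rightarrow> total) \<Rightarrow> bool" where
  "has_symmetry_form U \<Phi> \<longleftrightarrow>
     (\<exists>a b c d l0 l1 l2 l3 s f.
        a * d - b * c = 1 \<and> s \<noteq> 0 \<and> solution (base_projection U) f \<and>
        (\<forall>(t, x, y, u)\<in>U. c * t + d \<noteq> 0 \<and>
           \<Phi> (t, x, y, u) = symmetry_formula a b c d l0 l1 l2 l3 s f (t, x, y, u)))"

end

theory Submission
  imports Defs
begin

text \<open>
  Test a symmetry on polynomial solutions with prescribed jets: the image of the graph of such a
  solution is locally the graph of a solution, by the inverse function theorem, and expressing its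
  second derivative in the new \<open>x\<close>-direction through the jet of the original solution gives algebraic
  relations between the first and second derivatives of the transformation.  Varying the jet shows
  that the new \<open>t\<close> and \<open>y\<close> do not depend on \<open>x\<close> and \<open>u\<close>, that the new \<open>x\<close> does not depend on \<open>u\<close>, and
  that the new \<open>u\<close> is affine in \<open>u\<close> with a factor \<open>A(t, x, y)\<close> subject to a linear overdetermined
  system.  Its compatibility conditions say that \<open>1 / m\<close> is affine in \<open>t\<close>, where \<open>m(t)\<close> is the
  \<open>x\<close>-derivative of the new \<open>x\<close>, and that the shift of \<open>y\<close> is a cubic polynomial in \<open>t\<close>; integrating the
  system then gives the exponential factor.  Conversely, for a transformation of the given form
  the operator of the equation at the image point is a nonzero multiple of the original one,
  so that being a symmetry is a local property.  As the constants are determined by the transformation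
  on any open set, they are locally constant, and \<open>f\<close> is locally constant along the fibres.
\<close>

section \<open>Smooth functions and directional derivatives\<close>

text \<open>The new independent variables may a priori involve \<open>u\<close>, so a function can
  be moved only if the tangent plane of its graph stays transversal to the fibres under the map.
  Relations are therefore obtained for transversal jets alone, which suffice because the others form
  a proper affine subset. At a point the first-order jet of a solution is free, and so are the
  second derivatives transversal to the \<open>x\<close>-direction; only
  \<open>u_xx = u_t + x u_y\<close> is forced. Changing the free second derivatives keeps the
  differential of the image function but alters its second \<open>x\<close>-derivative, unless the
  direction sent to the new \<open>x\<close>-axis has neither a \<open>t\<close>- nor a
  \<open>y\<close>-component. This is the source of projectability. Eliminating the differential of
  the image function leaves an equation with the drift \<open>(X_t + x X_y) / X_x\<close>, where
  \<open>X\<close> is the new \<open>x\<close>; the multiplier \<open>A\<close> is a gauge factor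
  that removes this drift, and the converse rests on the same drift. The function \<open>f\<close>
  has to live on the base, so a single formula on the whole domain calls for connected fibres, and
  not only for a connected domain.\<close>

definition dd :: "'a::real_normed_vector \<Rightarrow> ('a \<Rightarrow> 'b::real_normed_vector) \<Rightarrow> 'a \<Rightarrow> 'b" where
  "dd v f = (\<lambda>p. frechet_derivative f (at p) v)"

lemma dd_eqI: "(f has_derivative f') (at p) \<Longrightarrow> dd v f p = f' v"
  unfolding dd_def using frechet_derivative_at by metis

lemma Ck_on_Suc: "Ck_on (Suc k) S f \<longleftrightarrow> (\<forall>p\<in>S. f differentiable (at p)) \<and> (\<forall>v. Ck_on k S (dd v f))"
  by (simp add: dd_def)

declare Ck_on.simps(2) [simp del]

lemma Ck_on_dd: "Ck_on (Suc k) S f \<Longrightarrow> Ck_on k S (\<lambda>p. dd v f p)"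
  by (simp add: Ck_on_Suc)

lemma dd_cong:
  assumes "open S" "\<And>p. p \<in> S \<Longrightarrow> f p = g p" "p \<in> S" "f differentiable (at p)"
  shows "dd v f p = dd v g p"
  unfolding dd_def using frechet_derivative_transform_within_open[OF assms(4,1,3,2)] by auto

text \<open>A Frechet derivative at \<open>p\<close> sees only values near \<open>p\<close>. On an
  open set, formulas for \<open>dd v f\<close> that hold on the set alone may therefore be inserted
  into the recursion.\<close>

lemma Ck_on_cong_imp:
  assumes "open S"
  shows "(\<And>p. p \<in> S \<Longrightarrow> f p = g p) \<Longrightarrow> Ck_on k S f \<Longrightarrow> Ck_on k S g"
proof (induction k arbitrary: f g)
  case 0 then show ?case using continuous_on_cong by (metis Ck_on.simps(1))
next
  case (Suc k)
  have d: "\<forall>p\<in>S. f differentiable (at p)" and c: "\<And>v. Ck_on k S (dd v f)"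
    using Suc.prems(2) by (auto simp: Ck_on_Suc)
  have "\<forall>p\<in>S. g differentiable (at p)"
    using d Suc.prems(1) assms unfolding differentiable_def by (meson has_derivative_transform_within_open)
  moreover have "Ck_on k S (dd v g)" for v
    by (rule Suc.IH[OF _ c]) (use dd_cong[OF assms, of f g] Suc.prems(1) d in blast)
  ultimately show ?case by (simp add: Ck_on_Suc)
qed

lemma Ck_on_SucI:
  assumes "open S" and d: "\<And>p. p \<in> S \<Longrightarrow> (f has_derivative f' p) (at p)"
    and c: "\<And>v. Ck_on k S (\<lambda>p. f' p v)"
  shows "Ck_on (Suc k) S f"
proof -
  have "Ck_on k S (dd v f)" for v
    by (rule Ck_on_cong_imp[OF assms(1) _ c[of v]]) (simp add: dd_eqI[OF d])
  moreover have "f differentiable (at p)" if "p \<in> S" for p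
    by (rule Derivative.differentiableI[OF d[OF that]])
  ultimately show ?thesis by (auto simp: Ck_on_Suc)
qed

lemma Ck_on_SucD:
  assumes "Ck_on (Suc k) S f" "p \<in> S"
  shows "(f has_derivative (\<lambda>v. dd v f p)) (at p)"
  using assms frechet_derivative_works unfolding Ck_on_Suc dd_def by auto

lemma Ck_on_Suc_imp: "Ck_on (Suc k) S f \<Longrightarrow> Ck_on k S f"
proof (induction k arbitrary: f)
  case 0
  then show ?case
    by (auto simp: Ck_on_Suc intro!: continuous_at_imp_continuous_on differentiable_imp_continuous_within)
next
  case (Suc k)
  have "Ck_on k S (dd v f)" for v
    by (rule Suc.IH) (use Suc.prems Ck_on_dd in blast)
  then show ?case using Suc.prems by (auto simp: Ck_on_Suc[of k] Ck_on_Suc[of "Suc k"])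
qed

lemma Ck_on_subset: "Ck_on k S f \<Longrightarrow> T \<subseteq> S \<Longrightarrow> Ck_on k T f"
proof (induction k arbitrary: f)
  case 0 then show ?case using continuous_on_subset by auto
next
  case (Suc k) then show ?case unfolding Ck_on_Suc by blast
qed

lemma Ck_on_local:
  assumes "\<And>p. p \<in> S \<Longrightarrow> \<exists>N. open N \<and> p \<in> N \<and> Ck_on k N f"
  shows "Ck_on k S f"
  using assms
proof (induction k arbitrary: f)
  case 0
  then show ?case
    unfolding Ck_on.simps continuous_on_eq_continuous_within
    by (meson at_within_open continuous_on_eq_continuous_at continuous_on_eq_continuous_within continuous_at_imp_continuous_at_within)
next
  case (Suc k)
  then have "f differentiable (at p)" if "p \<in> S" for p
    using that by (meson Ck_on_Suc)
  moreover have "Ck_on k S (dd v f)" for v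
    by (rule Suc.IH) (meson Ck_on_Suc Suc.prems)
  ultimately show ?case by (simp add: Ck_on_Suc)
qed

lemma Ck_on_const: "open S \<Longrightarrow> Ck_on k S (\<lambda>p. c)"
proof (induction k arbitrary: c)
  case 0 then show ?case by simp
next
  case (Suc k) then show ?case by (intro Ck_on_SucI[where f'="\<lambda>p v. 0"]) auto
qed

lemma Ck_on_bounded_linear:
  assumes "bounded_linear L" "open S" shows "Ck_on k S f \<Longrightarrow> Ck_on k S (\<lambda>p. L (f p))"
proof (induction k arbitrary: f)
  case 0 then show ?case using bounded_linear.continuous_on[OF assms(1)] by auto
next
  case (Suc k)
  show ?case
    by (rule Ck_on_SucI[OF assms(2) bounded_linear.has_derivative[OF assms(1) Ck_on_SucD[OF Suc.prems]]])
       (use Suc in \<open>auto intro: Ck_on_dd\<close>)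
qed

lemma Ck_on_add: "open S \<Longrightarrow> Ck_on k S f \<Longrightarrow> Ck_on k S g \<Longrightarrow> Ck_on k S (\<lambda>p. f p + g p)"
proof (induction k arbitrary: f g)
  case 0 then show ?case by (auto intro: continuous_on_add)
next
  case (Suc k)
  show ?case
    by (rule Ck_on_SucI[OF Suc.prems(1) has_derivative_add[OF Ck_on_SucD[OF Suc.prems(2)] Ck_on_SucD[OF Suc.prems(3)]]])
       (use Suc in \<open>auto intro: Ck_on_dd\<close>)
qed

lemma Ck_on_Pair: "open S \<Longrightarrow> Ck_on k S f \<Longrightarrow> Ck_on k S g \<Longrightarrow> Ck_on k S (\<lambda>p. (f p, g p))"
proof (induction k arbitrary: f g)
  case 0 then show ?case by (auto intro: continuous_on_Pair)
next
  case (Suc k)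
  show ?case
    by (rule Ck_on_SucI[OF Suc.prems(1) has_derivative_Pair[OF Ck_on_SucD[OF Suc.prems(2)] Ck_on_SucD[OF Suc.prems(3)]]])
       (use Suc in \<open>auto intro: Ck_on_dd\<close>)
qed

lemma Ck_on_bilinear:
  assumes "bounded_bilinear b" "open S"
  shows "Ck_on k S f \<Longrightarrow> Ck_on k S g \<Longrightarrow> Ck_on k S (\<lambda>p. b (f p) (g p))"
proof (induction k arbitrary: f g)
  case 0 then show ?case using bounded_bilinear.continuous_on[OF assms(1)] by auto
next
  case (Suc k)
  show ?case
    by (rule Ck_on_SucI[OF assms(2) bounded_bilinear.FDERIV[OF assms(1) Ck_on_SucD[OF Suc.prems(1)] Ck_on_SucD[OF Suc.prems(2)]]])
       (use Suc in \<open>auto intro!: Ck_on_add assms(2) intro: Ck_on_dd Ck_on_Suc_imp\<close>)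
qed

lemma Ck_on_sum:
  assumes "open S" "finite I"
  shows "(\<And>i. i \<in> I \<Longrightarrow> Ck_on k S (f i)) \<Longrightarrow> Ck_on k S (\<lambda>p. \<Sum>i\<in>I. f i p)"
  using assms(2) by (induction I rule: finite_induct) (auto intro: Ck_on_const Ck_on_add assms(1))

lemma linear_dd: "f differentiable (at p) \<Longrightarrow> linear (\<lambda>v. dd v f p)"
  unfolding dd_def by (rule linear_frechet_derivative)

lemma dd_basis:
  fixes f :: "'a::euclidean_space \<Rightarrow> 'b::real_normed_vector"
  assumes "f differentiable (at p)"
  shows "dd v f p = (\<Sum>i\<in>Basis. (v \<bullet> i) *\<^sub>R dd i f p)"
proof -
  interpret linear "\<lambda>v. dd v f p" by (rule linear_dd[OF assms])
  have "dd v f p = dd (\<Sum>i\<in>Basis. (v \<bullet> i) *\<^sub>R i) f p" by (simp add: euclidean_representation)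
  then show ?thesis by (simp only: sum scale)
qed

text \<open>The chain rule differentiates \<open>f\<close> in the direction \<open>dd v g p\<close>,
  which moves with \<open>p\<close>, whereas the recursion controls fixed directions only. Expansion
  in a basis turns the derivative into a finite sum of products that the induction covers; hence the
  Euclidean space between \<open>g\<close> and \<open>f\<close>.\<close>

lemma Ck_on_compose:
  fixes f :: "'b::euclidean_space \<Rightarrow> 'c::real_normed_vector"
  assumes "open S" "open T" "\<And>p. p \<in> S \<Longrightarrow> g p \<in> T"
  shows "Ck_on k T f \<Longrightarrow> Ck_on k S g \<Longrightarrow> Ck_on k S (\<lambda>p. f (g p))"
proof (induction k arbitrary: f)
  case 0 then show ?case
    using assms(3) continuous_on_compose2[of T f S g] by auto
next
  case (Suc k)
  have df: "f differentiable (at (g p))" if "p \<in> S" for p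
    using Suc.prems(1) assms(3) that Ck_on_Suc by blast
  have *: "((\<lambda>p. f (g p)) has_derivative (\<lambda>v. \<Sum>i\<in>Basis. (dd v g p \<bullet> i) *\<^sub>R dd i f (g p))) (at p)" if "p \<in> S" for p
  proof -
    have "(f \<circ> g has_derivative (\<lambda>v. dd v f (g p)) \<circ> (\<lambda>v. dd v g p)) (at p)"
      by (rule diff_chain_at[OF Ck_on_SucD[OF Suc.prems(2) that] Ck_on_SucD[OF Suc.prems(1) assms(3)[OF that]]])
    moreover have "(\<lambda>v. dd v f (g p)) \<circ> (\<lambda>v. dd v g p) = (\<lambda>v. \<Sum>i\<in>Basis. (dd v g p \<bullet> i) *\<^sub>R dd i f (g p))"
      unfolding o_def by (rule ext, rule dd_basis[OF df[OF that]])
    ultimately show ?thesis by (simp only: o_def)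
  qed
  show ?case
  proof (rule Ck_on_SucI[OF assms(1) *])
    fix v
    have "Ck_on k S (\<lambda>p. dd v g p)" by (rule Ck_on_dd[OF Suc.prems(2)])
    moreover have "Ck_on k S (\<lambda>p. dd i f (g p))" for i
      by (rule Suc.IH[OF Ck_on_dd[OF Suc.prems(1)] Ck_on_Suc_imp[OF Suc.prems(2)]])
    ultimately show "Ck_on k S (\<lambda>p. \<Sum>i\<in>Basis. (dd v g p \<bullet> i) *\<^sub>R dd i f (g p))"
      by (intro Ck_on_sum Ck_on_bilinear[OF bounded_bilinear_scaleR]
          Ck_on_bounded_linear[OF bounded_linear_inner_left] assms(1) finite_Basis)
  qed auto
qed

lemma smooth_on_cong:
  assumes "open S" "\<And>p. p \<in> S \<Longrightarrow> f p = g p" shows "smooth_on S f \<longleftrightarrow> smooth_on S g"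
  unfolding smooth_on_def using Ck_on_cong_imp[OF assms(1), of f g] Ck_on_cong_imp[OF assms(1), of g f] assms(2) by auto

lemma smooth_on_dd: "smooth_on S f \<Longrightarrow> smooth_on S (dd v f)"
  unfolding smooth_on_def using Ck_on_Suc by blast

lemma smooth_onD: "smooth_on S f \<Longrightarrow> p \<in> S \<Longrightarrow> (f has_derivative (\<lambda>v. dd v f p)) (at p)"
  unfolding smooth_on_def using Ck_on_SucD by blast

lemma smooth_on_differentiable: "smooth_on S f \<Longrightarrow> p \<in> S \<Longrightarrow> f differentiable (at p)"
  using smooth_onD Derivative.differentiableI by blast

lemma smooth_on_continuous_on: "smooth_on S f \<Longrightarrow> continuous_on S f"
  unfolding smooth_on_def by (metis Ck_on.simps(1))

lemma smooth_on_subset: "smooth_on S f \<Longrightarrow> T \<subseteq> S \<Longrightarrow> smooth_on T f"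
  unfolding smooth_on_def using Ck_on_subset by blast

lemma smooth_on_local:
  "(\<And>p. p \<in> S \<Longrightarrow> \<exists>N. open N \<and> p \<in> N \<and> smooth_on N f) \<Longrightarrow> smooth_on S f"
  unfolding smooth_on_def using Ck_on_local[of S _ f] by meson

lemma smooth_on_const: "open S \<Longrightarrow> smooth_on S (\<lambda>p. c)"
  by (simp add: smooth_on_def Ck_on_const)

lemma smooth_on_bounded_linear:
  "bounded_linear L \<Longrightarrow> open S \<Longrightarrow> smooth_on S f \<Longrightarrow> smooth_on S (\<lambda>p. L (f p))"
  by (simp add: smooth_on_def Ck_on_bounded_linear)

lemma smooth_on_add: "open S \<Longrightarrow> smooth_on S f \<Longrightarrow> smooth_on S g \<Longrightarrow> smooth_on S (\<lambda>p. f p + g p)"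
  by (simp add: smooth_on_def Ck_on_add)

lemma smooth_on_minus: "open S \<Longrightarrow> smooth_on S f \<Longrightarrow> smooth_on S (\<lambda>p. - f p)"
  by (rule smooth_on_bounded_linear[OF bounded_linear_minus[OF bounded_linear_ident]])

lemma smooth_on_diff: "open S \<Longrightarrow> smooth_on S f \<Longrightarrow> smooth_on S g \<Longrightarrow> smooth_on S (\<lambda>p. f p - g p)"
  using smooth_on_add[of S f "\<lambda>p. - g p"] smooth_on_minus[of S g] by simp

lemma smooth_on_Pair: "open S \<Longrightarrow> smooth_on S f \<Longrightarrow> smooth_on S g \<Longrightarrow> smooth_on S (\<lambda>p. (f p, g p))"
  by (simp add: smooth_on_def Ck_on_Pair)

lemma smooth_on_mult:
  fixes f g :: "'a::real_normed_vector \<Rightarrow> real"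
  shows "open S \<Longrightarrow> smooth_on S f \<Longrightarrow> smooth_on S g \<Longrightarrow> smooth_on S (\<lambda>p. f p * g p)"
  by (simp add: smooth_on_def Ck_on_bilinear[OF bounded_bilinear_mult])

lemma smooth_on_power:
  fixes f :: "'a::real_normed_vector \<Rightarrow> real"
  shows "open S \<Longrightarrow> smooth_on S f \<Longrightarrow> smooth_on S (\<lambda>p. f p ^ n)"
  by (induction n) (auto intro: smooth_on_const smooth_on_mult)

lemma smooth_on_ident: "open S \<Longrightarrow> smooth_on S (\<lambda>p. p)"
proof -
  assume S: "open S"
  have "Ck_on k S (\<lambda>p. p)" for k
    using S by (cases k) (auto intro!: Ck_on_SucI[where f'="\<lambda>p v. v"] Ck_on_const)
  then show ?thesis by (simp add: smooth_on_def)
qed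

lemma smooth_on_fst: "open S \<Longrightarrow> smooth_on S f \<Longrightarrow> smooth_on S (\<lambda>p. fst (f p))"
  by (rule smooth_on_bounded_linear[OF bounded_linear_fst])

lemma smooth_on_snd: "open S \<Longrightarrow> smooth_on S f \<Longrightarrow> smooth_on S (\<lambda>p. snd (f p))"
  by (rule smooth_on_bounded_linear[OF bounded_linear_snd])

lemma smooth_on_compose:
  fixes f :: "'b::euclidean_space \<Rightarrow> 'c::real_normed_vector"
  assumes "open S" "open T" "smooth_on T f" "smooth_on S g" "\<And>p. p \<in> S \<Longrightarrow> g p \<in> T"
  shows "smooth_on S (\<lambda>p. f (g p))"
  using assms Ck_on_compose unfolding smooth_on_def by blast

text \<open>The derivative is a product of copies of the function itself and a constant, so the
  induction on the order closes.\<close>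

lemma smooth_on_real_inverse: "smooth_on (- {0}) (inverse :: real \<Rightarrow> real)"
proof -
  have "Ck_on k (- {0}) (inverse :: real \<Rightarrow> real)" for k
  proof (induction k)
    case 0 show ?case by (auto intro!: continuous_intros)
  next
    case (Suc k)
    show ?case
      by (rule Ck_on_SucI[where f'="\<lambda>x h. - (inverse x * h * inverse x)"])
         (auto intro!: has_derivative_inverse' Suc Ck_on_const Ck_on_bilinear[OF bounded_bilinear_mult]
            Ck_on_bounded_linear[OF bounded_linear_minus[OF bounded_linear_ident]])
  qed
  then show ?thesis by (simp add: smooth_on_def)
qed

lemma smooth_on_divide:
  fixes f g :: "'a::real_normed_vector \<Rightarrow> real"
  assumes "open S" "smooth_on S f" "smooth_on S g" "\<And>p. p \<in> S \<Longrightarrow> g p \<noteq> 0"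
  shows "smooth_on S (\<lambda>p. f p / g p)"
  unfolding divide_inverse
  by (intro smooth_on_mult assms smooth_on_compose[OF _ _ smooth_on_real_inverse]) (use assms in auto)

lemma smooth_on_exp:
  fixes f :: "'a::real_normed_vector \<Rightarrow> real"
  assumes "open S" "smooth_on S f" shows "smooth_on S (\<lambda>p. exp (f p))"
proof (rule smooth_on_compose[OF assms(1) open_UNIV _ assms(2)])
  \<comment> \<open>The constant \<open>c\<close> absorbs the direction \<open>h\<close> that each
    differentiation produces, so the statement reproduces itself.\<close>
  have "Ck_on k UNIV (\<lambda>x::real. exp x * c)" for k c
  proof (induction k arbitrary: c)
    case 0 show ?case by (auto intro!: continuous_intros)
  next
    case (Suc k)
    show ?case
      by (rule Ck_on_SucI[where f'="\<lambda>x h. exp x * (h * c)"])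
         (auto intro!: derivative_eq_intros Suc)
  qed
  from this[of _ 1] show "smooth_on UNIV (exp :: real \<Rightarrow> real)" by (simp add: smooth_on_def)
qed auto

lemmas smooth_on_intros = smooth_on_const smooth_on_ident smooth_on_add smooth_on_diff smooth_on_minus
  smooth_on_mult smooth_on_power smooth_on_divide smooth_on_exp smooth_on_fst smooth_on_snd smooth_on_Pair

section \<open>First and second derivatives along curves\<close>

lemma dd_chain:
  fixes F :: "'a::real_normed_vector \<Rightarrow> 'b::real_normed_vector"
  assumes "smooth_on S F" "\<gamma> s \<in> S" "(\<gamma> has_vector_derivative \<gamma>') (at s)"
  shows "((\<lambda>s. F (\<gamma> s)) has_vector_derivative dd \<gamma>' F (\<gamma> s)) (at s)"
proof -
  have "(F \<circ> \<gamma> has_derivative (\<lambda>v. dd v F (\<gamma> s)) \<circ> (\<lambda>h. h *\<^sub>R \<gamma>')) (at s)"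
    by (rule diff_chain_at) (use assms(3) smooth_onD[OF assms(1,2)] in \<open>auto simp: has_vector_derivative_def\<close>)
  moreover have "(\<lambda>v. dd v F (\<gamma> s)) \<circ> (\<lambda>h. h *\<^sub>R \<gamma>') = (\<lambda>h. h *\<^sub>R dd \<gamma>' F (\<gamma> s))"
    using linear_scale[OF linear_dd[OF smooth_on_differentiable[OF assms(1,2)]]] by auto
  ultimately show ?thesis by (simp add: has_vector_derivative_def o_def)
qed

lemma dd_dd_basis:
  fixes F :: "'a::euclidean_space \<Rightarrow> 'b::real_normed_vector"
  assumes "open S" "smooth_on S F" "p \<in> S"
  shows "(\<Sum>i\<in>Basis. (h \<bullet> i) *\<^sub>R dd k (dd i F) p) = dd k (dd h F) p"
proof -
  have "((\<lambda>p. \<Sum>i\<in>Basis. (h \<bullet> i) *\<^sub>R dd i F p) has_derivative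
      (\<lambda>k. \<Sum>i\<in>Basis. (h \<bullet> i) *\<^sub>R dd k (dd i F) p)) (at p)"
    by (intro has_derivative_sum has_derivative_scaleR_right smooth_onD[OF smooth_on_dd[OF assms(2)] assms(3)])
  then have "(dd h F has_derivative (\<lambda>k. \<Sum>i\<in>Basis. (h \<bullet> i) *\<^sub>R dd k (dd i F) p)) (at p)"
    by (rule has_derivative_transform_within_open[OF _ assms(1,3)])
       (use dd_basis[OF smooth_on_differentiable[OF assms(2)]] in metis)
  from dd_eqI[OF this] show ?thesis by simp
qed

text \<open>The direction of differentiation moves with \<open>s\<close>; it is expanded in a basis,
  and the product rule applies to the moving coefficients. The two terms are the contributions of
  the acceleration and of the velocity. The first is needed because a straight line in the base,
  lifted to a graph, is no longer straight.\<close>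

lemma dd_chain2:
  fixes F :: "'a::euclidean_space \<Rightarrow> 'b::real_normed_vector"
  assumes "open S" "smooth_on S F" "\<gamma> s \<in> S" "(\<gamma> has_vector_derivative \<gamma>1 s) (at s)"
    "(\<gamma>1 has_vector_derivative \<gamma>2) (at s)"
  shows "((\<lambda>s. dd (\<gamma>1 s) F (\<gamma> s)) has_vector_derivative
      dd \<gamma>2 F (\<gamma> s) + dd (\<gamma>1 s) (dd (\<gamma>1 s) F) (\<gamma> s)) (at s)"
proof -
  have cont: "isCont \<gamma> s"
    using assms(4) has_vector_derivative_continuous by blast
  have "((\<lambda>s. \<Sum>i\<in>Basis. (\<gamma>1 s \<bullet> i) *\<^sub>R dd i F (\<gamma> s)) has_vector_derivative
      (\<Sum>i\<in>Basis. (\<gamma>1 s \<bullet> i) *\<^sub>R dd (\<gamma>1 s) (dd i F) (\<gamma> s) + (\<gamma>2 \<bullet> i) *\<^sub>R dd i F (\<gamma> s))) (at s)"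
    by (intro has_vector_derivative_sum has_vector_derivative_scaleR
        dd_chain[OF smooth_on_dd[OF assms(2)] assms(3,4)])
       (use bounded_linear.has_vector_derivative[OF bounded_linear_inner_left assms(5)]
        in \<open>auto simp: has_real_derivative_iff_has_vector_derivative\<close>)
  moreover have "(\<Sum>i\<in>Basis. (\<gamma>1 s \<bullet> i) *\<^sub>R dd (\<gamma>1 s) (dd i F) (\<gamma> s) + (\<gamma>2 \<bullet> i) *\<^sub>R dd i F (\<gamma> s))
      = dd \<gamma>2 F (\<gamma> s) + dd (\<gamma>1 s) (dd (\<gamma>1 s) F) (\<gamma> s)"
    by (simp only: sum.distrib dd_dd_basis[OF assms(1-3)]
        dd_basis[OF smooth_on_differentiable[OF assms(2,3)], of \<gamma>2] add.commute)
  ultimately have *: "((\<lambda>s. \<Sum>i\<in>Basis. (\<gamma>1 s \<bullet> i) *\<^sub>R dd i F (\<gamma> s)) has_vector_derivative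
      dd \<gamma>2 F (\<gamma> s) + dd (\<gamma>1 s) (dd (\<gamma>1 s) F) (\<gamma> s)) (at s)" by metis
  have "\<forall>\<^sub>F r in nhds s. \<gamma> r \<in> S"
    using cont assms(1,3) by (simp add: isCont_def tendsto_at_iff_tendsto_nhds topological_tendstoD)
  then obtain N where N: "open N" "s \<in> N" "\<And>r. r \<in> N \<Longrightarrow> \<gamma> r \<in> S"
    unfolding eventually_nhds by blast
  show ?thesis
    by (rule has_vector_derivative_transform_within_open[OF * N(1,2)])
       (metis dd_basis[OF smooth_on_differentiable[OF assms(2) N(3)]])
qed

section \<open>The smooth inverse function theorem in dimension three\<close>

text \<open>Cramer's rule, written out so that the inverse is visibly rational in the entries of
  \<open>A\<close>. This is the form in which differentiability passes from a matrix to its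
  inverse.\<close>

lemma inv_linear_base:
  fixes A :: "base \<Rightarrow> base"
  assumes "linear A" "bij A" "A (1,0,0) = (a1,a2,a3)" "A (0,1,0) = (b1,b2,b3)" "A (0,0,1) = (c1,c2,c3)"
  defines "\<Delta> \<equiv> a1*(b2*c3-b3*c2) - b1*(a2*c3-a3*c2) + c1*(a2*b3-a3*b2)"
  shows "\<Delta> \<noteq> 0"
    "inv A (v1,v2,v3) =
      ((v1*(b2*c3-b3*c2) - b1*(v2*c3-v3*c2) + c1*(v2*b3-v3*b2)) / \<Delta>,
       (a1*(v2*c3-v3*c2) - v1*(a2*c3-a3*c2) + c1*(a2* v3-a3* v2)) / \<Delta>,
       (a1*(b2* v3-b3* v2) - b1*(a2* v3-a3* v2) + v1*(a2*b3-a3*b2)) / \<Delta>)"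
proof -
  have A: "A (x,y,z) = (x*a1+y*b1+z*c1, x*a2+y*b2+z*c2, x*a3+y*b3+z*c3)" for x y z
  proof -
    have "A (x,y,z) = A (x *\<^sub>R (1,0,0) + y *\<^sub>R (0,1,0) + z *\<^sub>R (0,0,1))" by simp
    also have "\<dots> = x *\<^sub>R A (1,0,0) + y *\<^sub>R A (0,1,0) + z *\<^sub>R A (0,0,1)"
      by (simp only: linear_add[OF assms(1)] linear_scale[OF assms(1)])
    finally show ?thesis using assms(3-5) by simp
  qed
  have inv: "\<exists>x y z. inv A (v1,v2,v3) = (x,y,z) \<and> x*a1+y*b1+z*c1 = v1 \<and> x*a2+y*b2+z*c2 = v2 \<and> x*a3+y*b3+z*c3 = v3"
    for v1 v2 v3
    using surj_f_inv_f[OF bij_is_surj[OF assms(2)], of "(v1,v2,v3)"] A by (cases "inv A (v1,v2,v3)") auto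
  obtain x1 y1 z1 where 1: "x1*a1+y1*b1+z1*c1 = 1" "x1*a2+y1*b2+z1*c2 = 0" "x1*a3+y1*b3+z1*c3 = 0"
    using inv[of 1 0 0] by auto
  obtain x2 y2 z2 where 2: "x2*a1+y2*b1+z2*c1 = 0" "x2*a2+y2*b2+z2*c2 = 1" "x2*a3+y2*b3+z2*c3 = 0"
    using inv[of 0 1 0] by auto
  obtain x3 y3 z3 where 3: "x3*a1+y3*b1+z3*c1 = 0" "x3*a2+y3*b2+z3*c2 = 0" "x3*a3+y3*b3+z3*c3 = 1"
    using inv[of 0 0 1] by auto
  \<comment> \<open>Multiplicativity of the determinant: the preimages of the basis vectors are the
    rows of the second matrix, and the product of the two matrices is the identity.\<close>
  have "\<Delta> * (x1*(y2*z3-z2*y3) - y1*(x2*z3-z2*x3) + z1*(x2*y3-y2*x3)) =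
     (x1*a1+y1*b1+z1*c1) * ((x2*a2+y2*b2+z2*c2)*(x3*a3+y3*b3+z3*c3) - (x2*a3+y2*b3+z2*c3)*(x3*a2+y3*b2+z3*c2))
   - (x1*a2+y1*b2+z1*c2) * ((x2*a1+y2*b1+z2*c1)*(x3*a3+y3*b3+z3*c3) - (x2*a3+y2*b3+z2*c3)*(x3*a1+y3*b1+z3*c1))
   + (x1*a3+y1*b3+z1*c3) * ((x2*a1+y2*b1+z2*c1)*(x3*a2+y3*b2+z3*c2) - (x2*a2+y2*b2+z2*c2)*(x3*a1+y3*b1+z3*c1))"
    unfolding \<Delta>_def by algebra
  also have "\<dots> = 1" by (simp only: 1 2 3) simp
  finally show \<Delta>: "\<Delta> \<noteq> 0" by auto
  obtain x y z where i: "inv A (v1,v2,v3) = (x,y,z)" and v: "v1 = x*a1+y*b1+z*c1" "v2 = x*a2+y*b2+z*c2" "v3 = x*a3+y*b3+z*c3"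
    using inv[of v1 v2 v3] by auto
  show "inv A (v1,v2,v3) =
      ((v1*(b2*c3-b3*c2) - b1*(v2*c3-v3*c2) + c1*(v2*b3-v3*b2)) / \<Delta>,
       (a1*(v2*c3-v3*c2) - v1*(a2*c3-a3*c2) + c1*(a2* v3-a3* v2)) / \<Delta>,
       (a1*(b2* v3-b3* v2) - b1*(a2* v3-a3* v2) + v1*(a2*b3-a3*b2)) / \<Delta>)"
    unfolding i using \<Delta> by (simp add: eq_divide_eq) (simp add: v \<Delta>_def, algebra)
qed

text \<open>The inverse function theorem gives a continuous local inverse \<open>g\<close> whose
  derivative at \<open>y\<close> is the inverse of the derivative of \<open>f\<close> at
  \<open>g y\<close>. The rest is a bootstrap: if \<open>g\<close> is of class \<open>k\<close>, so
  are the entries of the Jacobian matrix of \<open>f\<close> along \<open>g\<close>, and by Cramer's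
  rule so is the derivative of \<open>g\<close>; thus \<open>g\<close> is of class
  \<open>Suc k\<close>.\<close>

lemma smooth_inverse_function:
  fixes f :: "base \<Rightarrow> base"
  assumes "open U" "smooth_on U f" "z0 \<in> U" "inj (\<lambda>v. dd v f z0)"
  obtains D D' g where "open D" "z0 \<in> D" "D \<subseteq> U" "open D'" "homeomorphism D D' f g" "smooth_on D' g"
proof -
  define f' where "f' x = Blinfun (\<lambda>v. dd v f x)" for x
  have bl: "bounded_linear (\<lambda>v. dd v f x)" if "x \<in> U" for x
    using smooth_onD[OF assms(2) that] has_derivative_bounded_linear by blast
  have f': "blinfun_apply (f' x) = (\<lambda>v. dd v f x)" if "x \<in> U" for x
    unfolding f'_def using bl[OF that] by (simp add: bounded_linear_Blinfun_apply)
  have cont: "continuous_on U f'"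
  proof (rule continuous_on_blinfun_componentwise)
    fix i :: base
    show "continuous_on U (\<lambda>x. blinfun_apply (f' x) i)"
      using smooth_on_continuous_on[OF smooth_on_dd[OF assms(2), of i]] f'
      by (simp cong: continuous_on_cong)
  qed
  have lin0: "linear (\<lambda>v. dd v f z0)" using bl[OF assms(3)] bounded_linear.linear by blast
  obtain h where h: "linear h" "h \<circ> (\<lambda>v. dd v f z0) = id"
    using linear_injective_left_inverse[OF lin0 assms(4)] by blast
  have "Blinfun h o\<^sub>L f' z0 = id_blinfun"
    by (rule blinfun_eqI)
       (use h in \<open>auto simp: f'[OF assms(3)] bounded_linear_Blinfun_apply linear_conv_bounded_linear fun_eq_iff\<close>)
  from inverse_function_theorem[OF assms(1) _ cont assms(3) this]
  obtain D D' g g' where D: "open D" "D \<subseteq> U" "z0 \<in> D" "open D'" and hom: "homeomorphism D D' f g"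
    and g: "\<And>y. y \<in> D' \<Longrightarrow> (g has_derivative g' y) (at y)"
      "\<And>y. y \<in> D' \<Longrightarrow> g' y = inv (blinfun_apply (f' (g y)))"
      "\<And>y. y \<in> D' \<Longrightarrow> bij (blinfun_apply (f' (g y)))"
    using f' smooth_onD[OF assms(2)] by metis
  have gD: "g y \<in> D" if "y \<in> D'" for y
    using hom that by (auto simp: homeomorphism_def)
  define e where "e j = (if j = 0 then (1,0,0) else if j = 1 then (0,1,0) else (0,0,1) :: base)" for j :: nat
  define m where "m i j y = (let w = dd (e j) f (g y) in if i = 0 then fst w else if i = 1 then fst (snd w) else snd (snd w))"
    for i j :: nat and y
  define \<Delta> where "\<Delta> y = m 0 0 y*(m 1 1 y*m 2 2 y-m 2 1 y*m 1 2 y) - m 0 1 y*(m 1 0 y*m 2 2 y-m 2 0 y*m 1 2 y)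
      + m 0 2 y*(m 1 0 y*m 2 1 y-m 2 0 y*m 1 1 y)" for y
  have "Ck_on k D' g" for k
  proof (induction k)
    case 0 then show ?case using hom by (auto simp: homeomorphism_def)
  next
    case (Suc k)
    have m: "Ck_on k D' (m i j)" for i j
    proof -
      have "Ck_on k D' (\<lambda>y. dd (e j) f (g y))"
        by (rule Ck_on_compose[OF D(4) D(1) gD _ Suc])
           (use smooth_on_dd[OF smooth_on_subset[OF assms(2) D(2)]] in \<open>auto simp: smooth_on_def\<close>)
      then show ?thesis unfolding m_def Let_def
        by (cases "i = 0"; cases "i = 1")
           (auto intro!: Ck_on_bounded_linear[OF bounded_linear_fst D(4)] Ck_on_bounded_linear[OF bounded_linear_snd D(4)])
    qed
    note arith = Ck_on_const[OF D(4)] Ck_on_add[OF D(4)] Ck_on_bilinear[OF bounded_bilinear_mult D(4)]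
      Ck_on_bounded_linear[OF bounded_linear_minus[OF bounded_linear_ident] D(4)] m
    have inv: "\<Delta> y \<noteq> 0 \<and> g' y (v1,v2,v3) =
       ((v1*(m 1 1 y*m 2 2 y-m 2 1 y*m 1 2 y) - m 0 1 y*(v2*m 2 2 y-v3*m 1 2 y) + m 0 2 y*(v2*m 2 1 y-v3*m 1 1 y)) / \<Delta> y,
       (m 0 0 y*(v2*m 2 2 y-v3*m 1 2 y) - v1*(m 1 0 y*m 2 2 y-m 2 0 y*m 1 2 y) + m 0 2 y*(m 1 0 y* v3-m 2 0 y* v2)) / \<Delta> y,
       (m 0 0 y*(m 1 1 y* v3-m 2 1 y* v2) - m 0 1 y*(m 1 0 y* v3-m 2 0 y* v2) + v1*(m 1 0 y*m 2 1 y-m 2 0 y*m 1 1 y)) / \<Delta> y)"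
      if "y \<in> D'" for y v1 v2 v3
    proof -
      have "g y \<in> U" using gD[OF that] D(2) by blast
      note b = linear_dd[OF smooth_on_differentiable[OF assms(2) this]] g(3)[OF that, unfolded f'[OF this]]
      have "dd (1,0,0) f (g y) = (m 0 0 y, m 1 0 y, m 2 0 y)" "dd (0,1,0) f (g y) = (m 0 1 y, m 1 1 y, m 2 1 y)"
        "dd (0,0,1) f (g y) = (m 0 2 y, m 1 2 y, m 2 2 y)"
        by (auto simp: m_def e_def Let_def)
      from inv_linear_base[OF b this] show ?thesis
        unfolding g(2)[OF that] f'[OF \<open>g y \<in> U\<close>] \<Delta>_def by blast
    qed
    have "Ck_on k D' \<Delta>" unfolding \<Delta>_def diff_conv_add_uminus by (intro arith)
    moreover have "Ck_on k (- {0}) (inverse :: real \<Rightarrow> real)"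
      using smooth_on_real_inverse by (simp add: smooth_on_def)
    ultimately have i: "Ck_on k D' (\<lambda>y. inverse (\<Delta> y))"
      by (intro Ck_on_compose[OF D(4), where T="- {0}" and f=inverse]) (use inv in auto)
    show ?case
    proof (rule Ck_on_SucI[OF D(4) g(1)])
      fix v :: base
      obtain v1 v2 v3 where v: "v = (v1,v2,v3)" by (cases v)
      show "Ck_on k D' (\<lambda>y. g' y v)" unfolding v
        by (rule Ck_on_cong_imp[OF D(4), OF conjunct2[OF inv, symmetric]])
           (auto simp only: diff_conv_add_uminus divide_inverse intro!: Ck_on_Pair D(4) i arith)
    qed
  qed
  then show ?thesis using that[OF D(1,3,2,4) hom] by (simp add: smooth_on_def)
qed

section \<open>Prolongation of a point symmetry along the graph of a solution\<close>

text \<open>Nested pairs split off the coordinate \<open>t\<close>, not \<open>u\<close>; the three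
  maps provide the splitting into base and fibre. They serve points and tangent vectors alike:
  \<open>lift \<zeta> (V \<zeta>)\<close> is the vector over \<open>\<zeta>\<close> that is tangent
  to a graph with differential \<open>V\<close>.\<close>

definition lift :: "base \<Rightarrow> real \<Rightarrow> total" where
  "lift z u = (fst z, fst (snd z), snd (snd z), u)"

definition base_part :: "total \<Rightarrow> base" where
  "base_part p = (fst p, fst (snd p), fst (snd (snd p)))"

definition fibre_part :: "total \<Rightarrow> real" where
  "fibre_part p = snd (snd (snd p))"

lemma lift_simps [simp]: "lift (t, x, y) u = (t, x, y, u)" "base_part (t, x, y, u) = (t, x, y)"
  "fibre_part (t, x, y, u) = u" "base_part (lift z u) = z" "fibre_part (lift z u) = u"
  "lift (base_part p) (fibre_part p) = p"
  by (auto simp: lift_def base_part_def fibre_part_def)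

lemma bounded_linear_base_part: "bounded_linear base_part"
  unfolding base_part_def[abs_def]
  by (intro bounded_linear_Pair bounded_linear_fst bounded_linear_snd bounded_linear_compose[OF bounded_linear_fst]
      bounded_linear_compose[OF bounded_linear_snd])

lemma bounded_linear_fibre_part: "bounded_linear fibre_part"
  unfolding fibre_part_def[abs_def]
  by (intro bounded_linear_snd bounded_linear_compose[OF bounded_linear_snd])

lemma bounded_linear_lift: "bounded_linear (\<lambda>q. lift (fst q) (snd q))"
  unfolding lift_def
  by (intro bounded_linear_Pair bounded_linear_fst bounded_linear_snd bounded_linear_compose[OF bounded_linear_fst]
      bounded_linear_compose[OF bounded_linear_snd])

lemma has_derivative_lift:
  assumes "(f has_derivative f') (at z)" "(g has_derivative g') (at z)"
  shows "((\<lambda>s. lift (f s) (g s)) has_derivative (\<lambda>h. lift (f' h) (g' h))) (at z)"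
  using bounded_linear.has_derivative[OF bounded_linear_lift has_derivative_Pair[OF assms]] by simp

lemma has_vector_derivative_lift:
  assumes "(f has_vector_derivative f') (at s)" "(g has_vector_derivative g') (at s)"
  shows "((\<lambda>s. lift (f s) (g s)) has_vector_derivative lift f' g') (at s)"
  using bounded_linear.has_vector_derivative[OF bounded_linear_lift has_vector_derivative_Pair[OF assms]] by simp

lemma smooth_on_lift:
  "open S \<Longrightarrow> smooth_on S f \<Longrightarrow> smooth_on S g \<Longrightarrow> smooth_on S (\<lambda>p. lift (f p) (g p))"
  unfolding lift_def by (intro smooth_on_intros)

lemma graph_on_eq: "graph_on D v = (\<lambda>z. lift z (v z)) ` D"
  unfolding graph_on_def by force

lemma base_projection_eq: "base_projection U = base_part ` U"
  unfolding base_projection_def by force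

abbreviation "Dt \<equiv> dd ((1,0,0) :: base)"
abbreviation "Dx \<equiv> dd ((0,1,0) :: base)"
abbreviation "Dy \<equiv> dd ((0,0,1) :: base)"

section \<open>The differential operator and its solutions\<close>

text \<open>Directional Frechet derivatives replace the one-variable \<open>deriv\<close>, so that
  the calculus of \<open>dd\<close> applies; for smooth functions on open sets the two readings
  agree.\<close>

definition kolmogorov :: "(base \<Rightarrow> real) \<Rightarrow> base \<Rightarrow> real" where
  "kolmogorov v z = Dt v z + fst (snd z) * Dy v z - Dx (Dx v) z"

lemma line_deriv:
  fixes F :: "'a::real_normed_vector \<Rightarrow> real"
  assumes "smooth_on S F" "p \<in> S"
  shows "((\<lambda>s. F (p + (s - c) *\<^sub>R h)) has_real_derivative dd h F p) (at c)"
proof -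
  have "((\<lambda>s. p + (s - c) *\<^sub>R h) has_vector_derivative h) (at c)"
    by (auto intro!: derivative_eq_intros simp: has_vector_derivative_def algebra_simps)
  from dd_chain[OF assms(1) _ this] show ?thesis
    using assms(2) by (simp add: has_real_derivative_iff_has_vector_derivative)
qed

lemma
  fixes v :: "base \<Rightarrow> real"
  assumes "smooth_on D v" "(t, x, y) \<in> D"
  shows deriv_t: "((\<lambda>s. v (s, x, y)) has_real_derivative Dt v (t, x, y)) (at t)"
    and deriv_x: "((\<lambda>s. v (t, s, y)) has_real_derivative Dx v (t, x, y)) (at x)"
    and deriv_y: "((\<lambda>s. v (t, x, s)) has_real_derivative Dy v (t, x, y)) (at y)"
  using line_deriv[OF assms, of t "(1,0,0)"] line_deriv[OF assms, of x "(0,1,0)"] line_deriv[OF assms, of y "(0,0,1)"]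
  by simp_all

lemma deriv_xx:
  fixes v :: "base \<Rightarrow> real"
  assumes "open D" "smooth_on D v" "(t, x, y) \<in> D"
  shows "(deriv ^^ 2) (\<lambda>s. v (t, s, y)) x = Dx (Dx v) (t, x, y)"
proof -
  define N where "N = (\<lambda>s. (t, s, y)) -` D"
  have "open N" unfolding N_def
    by (intro open_vimage assms continuous_intros)
  moreover have "x \<in> N" using assms by (simp add: N_def)
  moreover have "deriv (\<lambda>s. v (t, s, y)) s = Dx v (t, s, y)" if "s \<in> N" for s
    using deriv_x[OF assms(2), of t s y] that by (simp add: N_def DERIV_imp_deriv)
  ultimately have "((deriv (\<lambda>s. v (t, s, y))) has_real_derivative Dx (Dx v) (t, x, y)) (at x)"
    using has_field_derivative_transform_within_open[OF deriv_x[OF smooth_on_dd[OF assms(2)] assms(3)]] by simp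
  then show ?thesis by (simp add: numeral_2_eq_2 DERIV_imp_deriv)
qed

lemma solution_iff: "solution D v \<longleftrightarrow> open D \<and> smooth_on D v \<and> (\<forall>z\<in>D. kolmogorov v z = 0)"
proof -
  have "(deriv (\<lambda>s. v (s, x, y)) t + x * deriv (\<lambda>s. v (t, x, s)) y = (deriv ^^ 2) (\<lambda>s. v (t, s, y)) x) \<longleftrightarrow>
    kolmogorov v (t, x, y) = 0" if "open D" "smooth_on D v" "(t, x, y) \<in> D" for t x y
    unfolding kolmogorov_def using deriv_t[OF that(2,3)] deriv_y[OF that(2,3)] deriv_xx[OF that] by (auto simp: DERIV_imp_deriv)
  then show ?thesis unfolding solution_def by fastforce
qed

lemma kolmogorov_cong:
  assumes "open D" "smooth_on D v" "z \<in> D" "\<And>z. z \<in> D \<Longrightarrow> v z = w z"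
  shows "kolmogorov v z = kolmogorov w z"
proof -
  have 1: "dd h v z = dd h w z" if "z \<in> D" for h z
    by (rule dd_cong[OF assms(1,4) that smooth_on_differentiable[OF assms(2) that]])
  have "Dx (Dx v) z = Dx (Dx w) z"
    by (rule dd_cong[OF assms(1) 1 assms(3) smooth_on_differentiable[OF smooth_on_dd[OF assms(2)] assms(3)]])
  then show ?thesis unfolding kolmogorov_def by (simp add: 1[OF assms(3)])
qed

lemma solution_subset: "solution D v \<Longrightarrow> open D' \<Longrightarrow> D' \<subseteq> D \<Longrightarrow> solution D' v"
  unfolding solution_iff using smooth_on_subset by blast

text \<open>By \<open>J\<close> the image of the graph is parametrised near the image of
  \<open>p0\<close> by its base coordinates, so it is the graph of a function \<open>w\<close>,
  which the symmetry makes a solution; \<open>\<omega>\<close> is the differential of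
  \<open>w\<close> at the image point. The second property is the chain rule for \<open>w\<close>.
  If the image of \<open>a\<close> has base part \<open>(0,1,0)\<close>, then \<open>Q\<close> is
  the acceleration of the image curve, and what \<open>\<omega>\<close> does not account for in
  \<open>Q\<close> is the second \<open>x\<close>-derivative of \<open>w\<close>. The equation for
  \<open>w\<close> equates it with the left-hand side.\<close>

lemma prolonged_equation:
  assumes "point_transformation U \<Phi>" "maps_equation_to_itself U \<Phi>" "solution UNIV v"
    and p0: "p0 = lift z0 (v z0)" "p0 \<in> U"
    and J: "inj (\<lambda>\<zeta>. base_part (dd (lift \<zeta> (dd \<zeta> v z0)) \<Phi> p0))"
  obtains \<omega> where "linear \<omega>"
    "\<And>\<zeta>. \<omega> (base_part (dd (lift \<zeta> (dd \<zeta> v z0)) \<Phi> p0)) = fibre_part (dd (lift \<zeta> (dd \<zeta> v z0)) \<Phi> p0)"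
    "\<And>a Q. base_part (dd (lift a (dd a v z0)) \<Phi> p0) = (0,1,0) \<Longrightarrow>
       Q = dd (lift 0 (dd a (dd a v) z0)) \<Phi> p0 + dd (lift a (dd a v z0)) (dd (lift a (dd a v z0)) \<Phi>) p0 \<Longrightarrow>
       \<omega> (1,0,0) + fst (snd (\<Phi> p0)) * \<omega> (0,0,1) = fibre_part Q - \<omega> (base_part Q)"
proof -
  have U: "open U" "smooth_on U \<Phi>" using assms(1) by (auto simp: point_transformation_def)
  have v: "smooth_on UNIV v" using assms(3) by (simp add: solution_iff)
  define G where "G z = lift z (v z)" for z
  have G: "smooth_on UNIV G" unfolding G_def[abs_def] by (intro smooth_on_lift smooth_on_ident v open_UNIV)
  have Gd: "(G has_derivative (\<lambda>\<zeta>. lift \<zeta> (dd \<zeta> v z))) (at z)" for z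
    unfolding G_def[abs_def] by (rule has_derivative_lift[OF has_derivative_ident smooth_onD[OF v UNIV_I]])
  define D0 where "D0 = G -` U"
  have D0: "open D0" unfolding D0_def
    by (rule open_vimage[OF U(1) smooth_on_continuous_on[OF G]])
  have \<Phi>G: "smooth_on D0 (\<lambda>z. \<Phi> (G z))"
    by (rule smooth_on_compose[OF D0 U smooth_on_subset[OF G]]) (auto simp: D0_def)
  define \<psi> where "\<psi> z = base_part (\<Phi> (G z))" for z
  define h where "h z = fibre_part (\<Phi> (G z))" for z
  have \<psi>: "smooth_on D0 \<psi>" unfolding \<psi>_def[abs_def] by (rule smooth_on_bounded_linear[OF bounded_linear_base_part D0 \<Phi>G])
  have h: "smooth_on D0 h" unfolding h_def[abs_def] by (rule smooth_on_bounded_linear[OF bounded_linear_fibre_part D0 \<Phi>G])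
  have Gz0: "G z0 = p0" by (simp add: G_def p0)
  then have z0: "z0 \<in> D0" using p0(2) by (simp add: D0_def)
  have \<psi>d: "dd \<zeta> \<psi> z0 = base_part (dd (lift \<zeta> (dd \<zeta> v z0)) \<Phi> p0)" for \<zeta>
  proof -
    have "((\<lambda>z. \<Phi> (G z)) has_derivative (\<lambda>\<zeta>. dd (lift \<zeta> (dd \<zeta> v z0)) \<Phi> (G z0))) (at z0)"
      using has_derivative_compose[OF Gd smooth_onD[OF U(2), of "G z0"]] Gz0 p0(2) by simp
    from bounded_linear.has_derivative[OF bounded_linear_base_part this]
    show ?thesis unfolding \<psi>_def[abs_def] Gz0 by (rule dd_eqI)
  qed
  then have "inj (\<lambda>\<zeta>. dd \<zeta> \<psi> z0)" using J by simp
  from smooth_inverse_function[OF D0 \<psi> z0 this]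
  obtain D D' g where D: "open D" "z0 \<in> D" "D \<subseteq> D0" "open D'" "homeomorphism D D' \<psi> g" "smooth_on D' g" by blast
  have g: "g (\<psi> z) = z" "\<psi> z \<in> D'" if "z \<in> D" for z using D(5) that by (auto simp: homeomorphism_def)
  have gD: "g z \<in> D" "\<psi> (g z) = z" if "z \<in> D'" for z using D(5) that by (auto simp: homeomorphism_def)
  define w where "w z = h (g z)" for z
  have w: "smooth_on D' w" unfolding w_def[abs_def]
    by (rule smooth_on_compose[OF D(4) D(1) smooth_on_subset[OF h D(3)] D(6) gD(1)])
  have wh: "w (\<psi> z) = h z" if "z \<in> D" for z using g(1)[OF that] by (simp add: w_def)
  have "\<Phi> ` graph_on D v = graph_on D' w"
  proof -
    have "\<Phi> (G z) = lift (\<psi> z) (w (\<psi> z))" if "z \<in> D" for z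
      unfolding wh[OF that] by (simp add: h_def \<psi>_def)
    then have "\<Phi> ` graph_on D v = (\<lambda>z. lift z (w z)) ` (\<psi> ` D)"
      unfolding graph_on_eq G_def[symmetric] image_image by (intro image_cong) auto
    moreover have "\<psi> ` D = D'" using D(5) by (simp add: homeomorphism_def)
    ultimately show ?thesis by (simp add: graph_on_eq)
  qed
  moreover have "graph_on D v \<subseteq> U" using D(3) by (auto simp: graph_on_eq D0_def G_def)
  ultimately have "solution D' w"
    using assms(2) D(1,4) w smooth_on_subset[OF v, of D] solution_subset[OF assms(3) D(1)]
    unfolding maps_equation_to_itself_def by blast
  then have kolmogorov: "kolmogorov w (\<psi> z0) = 0" using g(2)[OF D(2)] by (simp add: solution_iff)
  have D'0: "\<psi> z0 \<in> D'" by (rule g(2)[OF D(2)])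
  \<comment> \<open>Along the lift \<open>P\<close> of the straight line through \<open>z0\<close>
    in direction \<open>a\<close>, the fibre part of \<open>\<Phi> (P s)\<close> is \<open>w\<close>
    at its base part. This identity is differentiated once and twice; \<open>Q\<close> is the second
    derivative of the image curve at \<open>0\<close>.\<close>
  have curve: "dd (base_part (dd (lift a (dd a v z0)) \<Phi> p0)) w (\<psi> z0) = fibre_part (dd (lift a (dd a v z0)) \<Phi> p0) \<and>
     dd (base_part Q) w (\<psi> z0) + dd (base_part (dd (lift a (dd a v z0)) \<Phi> p0)) (dd (base_part (dd (lift a (dd a v z0)) \<Phi> p0)) w) (\<psi> z0)
       = fibre_part Q"
    if Q: "Q = dd (lift 0 (dd a (dd a v) z0)) \<Phi> p0 + dd (lift a (dd a v z0)) (dd (lift a (dd a v z0)) \<Phi>) p0" for a Q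
  proof -
    define N where "N = (\<lambda>s. z0 + s *\<^sub>R a) -` D"
    have N: "open N" unfolding N_def by (intro open_vimage D continuous_intros)
    have N0: "0 \<in> N" using D by (simp add: N_def)
    define P where "P s = G (z0 + s *\<^sub>R a)" for s :: real
    define P1 where "P1 s = lift a (dd a v (z0 + s *\<^sub>R a))" for s :: real
    have P0: "P 0 = p0" by (simp add: P_def Gz0)
    have PU: "P s \<in> U" if "s \<in> N" for s using that D(3) by (auto simp: N_def P_def D0_def)
    have line: "((\<lambda>s. z0 + s *\<^sub>R a) has_vector_derivative a) (at s)" for s
      by (auto intro!: derivative_eq_intros simp: has_vector_derivative_def)
    have P: "(P has_vector_derivative P1 s) (at s)" for s
      unfolding P_def[abs_def] P1_def G_def
      by (intro has_vector_derivative_lift line dd_chain[OF v])  auto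
    have P1: "(P1 has_vector_derivative lift 0 (dd a (dd a v) z0)) (at 0)"
      unfolding P1_def[abs_def]
      using dd_chain[OF smooth_on_dd[OF v, of a] UNIV_I line[of 0]]
      by (intro has_vector_derivative_lift) auto
    define R1 where "R1 s = dd (P1 s) \<Phi> (P s)" for s
    have R: "((\<lambda>s. \<Phi> (P s)) has_vector_derivative R1 s) (at s)" if "s \<in> N" for s
      unfolding R1_def by (rule dd_chain[OF U(2) PU[OF that] P])
    have R1: "(R1 has_vector_derivative Q) (at 0)"
      using dd_chain2[OF U, of P 0 P1, OF PU[OF N0] P P1]
      unfolding R1_def[abs_def] Q P0 by (simp add: P1_def)
    define \<beta> where "\<beta> s = base_part (\<Phi> (P s))" for s
    define \<beta>1 where "\<beta>1 s = base_part (R1 s)" for s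
    have \<beta>: "(\<beta> has_vector_derivative \<beta>1 s) (at s)" if "s \<in> N" for s
      unfolding \<beta>_def[abs_def] \<beta>1_def by (rule bounded_linear.has_vector_derivative[OF bounded_linear_base_part R[OF that]])
    have \<beta>1: "(\<beta>1 has_vector_derivative base_part Q) (at 0)"
      unfolding \<beta>1_def[abs_def] by (rule bounded_linear.has_vector_derivative[OF bounded_linear_base_part R1])
    have \<beta>D: "\<beta> s \<in> D'" "w (\<beta> s) = fibre_part (\<Phi> (P s))" if "s \<in> N" for s
      using g(2)[of "z0 + s *\<^sub>R a"] wh[of "z0 + s *\<^sub>R a"] that by (auto simp: N_def \<beta>_def \<psi>_def P_def h_def)
    have first: "dd (\<beta>1 s) w (\<beta> s) = fibre_part (R1 s)" if "s \<in> N" for s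
    proof -
      have "((\<lambda>s. w (\<beta> s)) has_vector_derivative fibre_part (R1 s)) (at s)"
        by (rule has_vector_derivative_transform_within_open[OF
              bounded_linear.has_vector_derivative[OF bounded_linear_fibre_part R[OF that]] N that])
           (simp add: \<beta>D)
      with dd_chain[OF w \<beta>D(1)[OF that] \<beta>[OF that]] show ?thesis
        by (rule vector_derivative_unique_at)
    qed
    have "((\<lambda>s. dd (\<beta>1 s) w (\<beta> s)) has_vector_derivative fibre_part Q) (at 0)"
      by (rule has_vector_derivative_transform_within_open[OF
            bounded_linear.has_vector_derivative[OF bounded_linear_fibre_part R1] N N0])
         (simp add: first)
    moreover have "((\<lambda>s. dd (\<beta>1 s) w (\<beta> s)) has_vector_derivative
        dd (base_part Q) w (\<beta> 0) + dd (\<beta>1 0) (dd (\<beta>1 0) w) (\<beta> 0)) (at 0)"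
      by (rule dd_chain2[OF D(4) w \<beta>D(1)[OF N0] \<beta>[OF N0] \<beta>1])
    ultimately have "fibre_part Q = dd (base_part Q) w (\<beta> 0) + dd (\<beta>1 0) (dd (\<beta>1 0) w) (\<beta> 0)"
      by (rule vector_derivative_unique_at)
    moreover have "\<beta> 0 = \<psi> z0" by (simp add: \<beta>_def P0 \<psi>_def Gz0)
    moreover have "R1 0 = dd (lift a (dd a v z0)) \<Phi> p0" by (simp add: R1_def P1_def P0)
    ultimately show ?thesis using first[OF N0] by (simp add: \<beta>1_def)
  qed
  show ?thesis
  proof (rule that[of "\<lambda>h. dd h w (\<psi> z0)"])
    show "linear (\<lambda>h. dd h w (\<psi> z0))" by (rule linear_dd[OF smooth_on_differentiable[OF w D'0]])
    show "dd (base_part (dd (lift \<zeta> (dd \<zeta> v z0)) \<Phi> p0)) w (\<psi> z0) = fibre_part (dd (lift \<zeta> (dd \<zeta> v z0)) \<Phi> p0)" for \<zeta>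
      using curve[OF refl] by blast
    show "Dt w (\<psi> z0) + fst (snd (\<Phi> p0)) * Dy w (\<psi> z0) = fibre_part Q - dd (base_part Q) w (\<psi> z0)"
      if "base_part (dd (lift a (dd a v z0)) \<Phi> p0) = (0,1,0)"
        "Q = dd (lift 0 (dd a (dd a v) z0)) \<Phi> p0 + dd (lift a (dd a v z0)) (dd (lift a (dd a v z0)) \<Phi>) p0" for a Q
    proof -
      have "fst (snd (\<psi> z0)) = fst (snd (\<Phi> p0))" by (simp add: \<psi>_def Gz0 base_part_def)
      then show ?thesis using curve[OF that(2)] kolmogorov unfolding that(1) kolmogorov_def by simp
    qed
  qed
qed

text \<open>
  In the coordinates \<open>\<tau>, \<xi>, \<eta>\<close>, centred at \<open>z0\<close> by a Galilean shift, the equation keeps its form.  The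
  terms with \<open>\<alpha>\<close> and \<open>\<beta>\<close> change only the pure second derivatives in \<open>\<tau>\<close> and \<open>\<eta>\<close> of the 2-jet at \<open>z0\<close>.
\<close>

definition test_solution :: "base \<Rightarrow> real \<Rightarrow> real \<Rightarrow> real \<Rightarrow> real \<Rightarrow> real \<Rightarrow> real \<Rightarrow> base \<Rightarrow> real" where
  "test_solution z0 u p s e \<alpha> \<beta> = (\<lambda>z.
     let \<tau> = fst z - fst z0; \<xi> = fst (snd z) - fst (snd z0);
         \<eta> = snd (snd z) - snd (snd z0) - fst (snd z0) * \<tau>
     in u + p * \<xi> + s * (\<eta> - \<xi> * \<tau>) + e * (\<xi>^2 + 2 * \<tau>) + \<alpha> * (\<xi>^4 + 12 * \<tau> * \<xi>^2 + 12 * \<tau>^2)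
        + \<beta> * (\<eta>^2 - 2 * \<tau> * \<xi> * \<eta> + \<tau>^2 * \<xi>^2 + 2 / 3 * \<tau>^3))"

lemma dd_test_solution:
  "dd (a, b, c) (test_solution (t0, x0, y0) u p s e \<alpha> \<beta>) = (\<lambda>z.
     let \<tau> = fst z - t0; \<xi> = fst (snd z) - x0; \<eta> = snd (snd z) - y0 - x0 * \<tau>
     in a * (s * (- x0 - \<xi>) + 2 * e + \<alpha> * (12 * \<xi>^2 + 24 * \<tau>)
              + \<beta> * (- 2 * x0 * \<eta> - 2 * \<xi> * \<eta> + 2 * x0 * \<tau> * \<xi> + 2 * \<tau> * \<xi>^2 + 2 * \<tau>^2))
        + b * (p - s * \<tau> + 2 * e * \<xi> + \<alpha> * (4 * \<xi>^3 + 24 * \<tau> * \<xi>) + \<beta> * (2 * \<tau>^2 * \<xi> - 2 * \<tau> * \<eta>))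
        + c * (s + \<beta> * (2 * \<eta> - 2 * \<tau> * \<xi>)))"
  (is "_ = ?R")
proof (rule ext)
  fix z :: base
  have "(test_solution (t0, x0, y0) u p s e \<alpha> \<beta> has_derivative (\<lambda>(a, b, c).
     let \<tau> = fst z - t0; \<xi> = fst (snd z) - x0; \<eta> = snd (snd z) - y0 - x0 * \<tau>
     in a * (s * (- x0 - \<xi>) + 2 * e + \<alpha> * (12 * \<xi>^2 + 24 * \<tau>)
              + \<beta> * (- 2 * x0 * \<eta> - 2 * \<xi> * \<eta> + 2 * x0 * \<tau> * \<xi> + 2 * \<tau> * \<xi>^2 + 2 * \<tau>^2))
        + b * (p - s * \<tau> + 2 * e * \<xi> + \<alpha> * (4 * \<xi>^3 + 24 * \<tau> * \<xi>) + \<beta> * (2 * \<tau>^2 * \<xi> - 2 * \<tau> * \<eta>))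
        + c * (s + \<beta> * (2 * \<eta> - 2 * \<tau> * \<xi>)))) (at z)"
    unfolding test_solution_def Let_def fst_conv snd_conv
    by (rule derivative_eq_intros refl)+
       (auto simp: fun_eq_iff power2_eq_square power3_eq_cube field_simps)
  from dd_eqI[OF this] show "dd (a, b, c) (test_solution (t0, x0, y0) u p s e \<alpha> \<beta>) z = ?R z" by simp
qed

lemma dd_dd_test_solution:
  "dd (a, b, c) (dd (a, b, c) (test_solution (t0, x0, y0) u p s e \<alpha> \<beta>)) (t, x, y) =
     (let \<tau> = t - t0; \<xi> = x - x0; \<eta> = y - y0 - x0 * \<tau>; k = c - x0 * a
      in a * (- s * b + \<alpha> * (24 * \<xi> * b + 24 * a)
              + \<beta> * (- 2 * x0 * k - 2 * b * \<eta> - 2 * \<xi> * k + 2 * x0 * a * \<xi> + 2 * x0 * \<tau> * b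
                     + 2 * a * \<xi>^2 + 4 * \<tau> * \<xi> * b + 4 * \<tau> * a))
        + b * (- s * a + 2 * e * b + \<alpha> * (12 * \<xi>^2 * b + 24 * a * \<xi> + 24 * \<tau> * b)
              + \<beta> * (4 * \<tau> * a * \<xi> + 2 * \<tau>^2 * b - 2 * a * \<eta> - 2 * \<tau> * k))
        + c * (\<beta> * (2 * k - 2 * a * \<xi> - 2 * \<tau> * b)))"
  unfolding dd_test_solution
  by (rule trans[OF dd_eqI], unfold Let_def, (rule derivative_eq_intros refl)+)
     (simp add: power2_eq_square power3_eq_cube algebra_simps)

lemma smooth_on_test_solution: "smooth_on UNIV (test_solution z0 u p s e \<alpha> \<beta>)"
  unfolding test_solution_def Let_def by (intro smooth_on_intros open_UNIV)

text \<open>In the coordinates \<open>\<tau>\<close>, \<open>\<xi>\<close>, \<open>\<eta>\<close>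
  every summand is a solution by itself. The terms with \<open>e\<close> and \<open>\<alpha>\<close>
  are the heat polynomials of degree 2 and 4 in \<open>\<xi>\<close>. The quantity
  \<open>\<eta> - \<xi> \<tau>\<close> is constant along the transport field; the bracket after
  \<open>\<beta>\<close> is its square, whose second \<open>\<xi>\<close>-derivative
  \<open>2 \<tau>^2\<close> is compensated by \<open>2/3 \<tau>^3\<close>.\<close>

lemma solution_test_solution: "solution UNIV (test_solution z0 u p s e \<alpha> \<beta>)"
proof (cases z0)
  case (fields t0 x0 y0)
  have "kolmogorov (test_solution (t0, x0, y0) u p s e \<alpha> \<beta>) (t, x, y) = 0" for t x y
    unfolding kolmogorov_def dd_dd_test_solution unfolding dd_test_solution Let_def fst_conv snd_conv
    by (simp add: algebra_simps power2_eq_square)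
  then show ?thesis unfolding solution_iff using smooth_on_test_solution fields by auto
qed

text \<open>The derivatives \<open>u_x = p\<close>, \<open>u_y = s\<close> and
  \<open>u_t = 2 e - x0 s\<close> are independent, so every first-order jet occurs, and
  \<open>u_xx = 2 e\<close> is the value that the equation then forces. The parameters
  \<open>\<alpha>\<close> and \<open>\<beta>\<close> are invisible to first order and enter the
  second-order form only through \<open>a\<close> and \<open>c\<close>.\<close>

lemma test_solution_jet:
  fixes t0 x0 y0 u p s e \<alpha> \<beta> :: real
  defines "v \<equiv> test_solution (t0, x0, y0) u p s e \<alpha> \<beta>"
  shows "v (t0, x0, y0) = u"
    "dd (a, b, c) v (t0, x0, y0) = a * (2 * e - x0 * s) + b * p + c * s"
    "dd (a, b, c) (dd (a, b, c) v) (t0, x0, y0)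
       = 24 * \<alpha> * a^2 + 2 * \<beta> * (c - x0 * a)^2 - 2 * s * a * b + 2 * e * b^2"
proof -
  show "v (t0, x0, y0) = u" by (simp add: v_def test_solution_def Let_def)
  show "dd (a, b, c) v (t0, x0, y0) = a * (2 * e - x0 * s) + b * p + c * s"
    unfolding v_def dd_test_solution by (simp add: Let_def algebra_simps)
  show "dd (a, b, c) (dd (a, b, c) v) (t0, x0, y0)
       = 24 * \<alpha> * a^2 + 2 * \<beta> * (c - x0 * a)^2 - 2 * s * a * b + 2 * e * b^2"
    unfolding v_def dd_dd_test_solution by (simp add: Let_def power2_eq_square algebra_simps)
qed

text \<open>\<open>V\<close> is the differential of the test solution at the base point of
  \<open>p0\<close>. Transversality \<open>J\<close> depends on the jet through \<open>V\<close>
  alone, so it holds for all \<open>\<alpha>\<close> and \<open>\<beta>\<close> at once; these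
  appear only in the coefficient of the vertical derivative of \<open>\<Phi>\<close> in
  \<open>Q\<close>.\<close>

lemma test_equation:
  fixes p s e \<alpha> \<beta> :: real
  assumes sym: "point_transformation U \<Phi>" "maps_equation_to_itself U \<Phi>"
    and p0: "p0 = (t0, x0, y0, u0)" "p0 \<in> U"
    and V: "V = (\<lambda>(a, b, c). a * (2 * e - x0 * s) + b * p + c * s)"
    and J: "inj (\<lambda>\<zeta>. base_part (dd (lift \<zeta> (V \<zeta>)) \<Phi> p0))"
  obtains \<omega> where "linear \<omega>"
    "\<And>\<zeta>. \<omega> (base_part (dd (lift \<zeta> (V \<zeta>)) \<Phi> p0)) = fibre_part (dd (lift \<zeta> (V \<zeta>)) \<Phi> p0)"
    "\<And>a b c Q. base_part (dd (lift (a, b, c) (V (a, b, c))) \<Phi> p0) = (0,1,0) \<Longrightarrow>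
       Q = (24 * \<alpha> * a^2 + 2 * \<beta> * (c - x0 * a)^2 - 2 * s * a * b + 2 * e * b^2) *\<^sub>R dd (0,0,0,1) \<Phi> p0
         + dd (lift (a, b, c) (V (a, b, c))) (dd (lift (a, b, c) (V (a, b, c))) \<Phi>) p0 \<Longrightarrow>
       \<omega> (1,0,0) + fst (snd (\<Phi> p0)) * \<omega> (0,0,1) = fibre_part Q - \<omega> (base_part Q)"
proof -
  define v where "v = test_solution (t0, x0, y0) u0 p s e \<alpha> \<beta>"
  have Vd: "dd \<zeta> v (t0, x0, y0) = V \<zeta>" for \<zeta>
    using test_solution_jet(2) unfolding v_def V by (cases \<zeta>) auto
  have "dd (lift 0 r) \<Phi> p0 = r *\<^sub>R dd (0,0,0,1) \<Phi> p0" for r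
  proof -
    have "lift 0 r = r *\<^sub>R (0,0,0,1)" by (simp add: lift_def)
    moreover have "\<Phi> differentiable (at p0)"
      using sym(1) p0(2) smooth_on_differentiable by (auto simp: point_transformation_def)
    ultimately show ?thesis using linear_scale[OF linear_dd] by metis
  qed
  moreover have "p0 = lift (t0, x0, y0) (v (t0, x0, y0))"
    unfolding v_def test_solution_jet(1) p0 by simp
  moreover have "solution UNIV v" unfolding v_def by (rule solution_test_solution)
  ultimately show ?thesis
    using prolonged_equation[OF sym, of v p0 "(t0, x0, y0)"] p0(2) J that unfolding Vd
    by (smt (verit) test_solution_jet(3) v_def)
qed

section \<open>Pointwise consequences of the determining equations\<close>

lemma point_transformation_smooth:
  "point_transformation U \<Phi> \<Longrightarrow> open U" "point_transformation U \<Phi> \<Longrightarrow> smooth_on U \<Phi>"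
  by (auto simp: point_transformation_def)

lemma point_transformation_linear:
  assumes "point_transformation U \<Phi>" "p \<in> U" shows "linear (\<lambda>h. dd h \<Phi> p)"
  by (rule linear_dd[OF smooth_on_differentiable[OF point_transformation_smooth(2)[OF assms(1)] assms(2)]])

text \<open>The chain rule for the smooth inverse supplies a left inverse of the derivative.\<close>

lemma point_transformation_inj:
  assumes "point_transformation U \<Phi>" "p \<in> U" shows "inj (\<lambda>h. dd h \<Phi> p)"
proof -
  define \<Psi> where "\<Psi> = inv_into U \<Phi>"
  have U: "open U" "smooth_on U \<Phi>" "inj_on \<Phi> U" "open (\<Phi> ` U)" "smooth_on (\<Phi> ` U) \<Psi>"
    using assms(1) by (auto simp: point_transformation_def \<Psi>_def)
  have "((\<lambda>p. \<Psi> (\<Phi> p)) has_derivative (\<lambda>h. dd (dd h \<Phi> p) \<Psi> (\<Phi> p))) (at p)"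
    using has_derivative_compose[OF smooth_onD[OF U(2) assms(2)] smooth_onD[OF U(5) imageI[OF assms(2)]]] .
  moreover have "((\<lambda>p. \<Psi> (\<Phi> p)) has_derivative (\<lambda>h. h)) (at p)"
    by (rule has_derivative_transform_within_open[OF has_derivative_ident U(1) assms(2)])
       (simp add: \<Psi>_def inv_into_f_f[OF U(3)])
  ultimately have "(\<lambda>h. dd (dd h \<Phi> p) \<Psi> (\<Phi> p)) = (\<lambda>h. h)" by (rule has_derivative_unique)
  then show ?thesis by (intro inj_on_inverseI[where g="\<lambda>k. dd k \<Psi> (\<Phi> p)"]) (rule fun_cong)
qed

lemma point_transformation_surj:
  assumes "point_transformation U \<Phi>" "p \<in> U" shows "surj (\<lambda>h. dd h \<Phi> p)"
  using linear_injective_imp_surjective[OF point_transformation_linear[OF assms] point_transformation_inj[OF assms]] by simp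

section \<open>Transversality of graphs and their images\<close>

lemma lift_decompose:
  assumes "linear V" shows "h = lift (base_part h) (V (base_part h)) + (fibre_part h - V (base_part h)) *\<^sub>R (0,0,0,1)"
  by (simp add: lift_def base_part_def fibre_part_def prod_eq_iff)

lemma linear_horizontal:
  assumes "linear L" "linear V"
  shows "linear (\<lambda>\<zeta>. base_part (L (lift \<zeta> (V \<zeta>))))"
proof (rule linearI)
  have *: "lift (x + y) (V (x + y)) = lift x (V x) + lift y (V y)"
    "lift (c *\<^sub>R x) (V (c *\<^sub>R x)) = c *\<^sub>R lift x (V x)" for x y c
    by (auto simp: lift_def linear_add[OF assms(2)] linear_scale[OF assms(2)])
  show "base_part (L (lift (x + y) (V (x + y)))) = base_part (L (lift x (V x))) + base_part (L (lift y (V y)))" for x y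
    by (simp add: * linear_add[OF assms(1)] base_part_def)
  show "base_part (L (lift (c *\<^sub>R x) (V (c *\<^sub>R x)))) = c *\<^sub>R base_part (L (lift x (V x)))" for x c
    by (simp add: * linear_scale[OF assms(1)] base_part_def)
qed

text \<open>The kernel of \<open>base_part\<close> after \<open>L\<close> is the line spanned by
  \<open>k\<close>, the vector sent to the vertical direction. The tangent plane of the graph meets
  this line only in zero as soon as \<open>k\<close> itself is not in the plane.\<close>

lemma inj_horizontal:
  assumes "linear L" "inj L" "L k = (0,0,0,1)" "linear V" "fibre_part k \<noteq> V (base_part k)"
  shows "inj (\<lambda>\<zeta>. base_part (L (lift \<zeta> (V \<zeta>))))"
proof -
  note lin = linear_horizontal[OF assms(1,4)]
  have "\<zeta> = 0" if "base_part (L (lift \<zeta> (V \<zeta>))) = 0" for \<zeta>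
  proof -
    define r where "r = fibre_part (L (lift \<zeta> (V \<zeta>)))"
    have "L (lift \<zeta> (V \<zeta>)) = r *\<^sub>R L k"
      using that by (simp add: r_def assms(3) base_part_def fibre_part_def prod_eq_iff)
    also have "\<dots> = L (r *\<^sub>R k)" by (simp add: linear_scale[OF assms(1)])
    finally have *: "lift \<zeta> (V \<zeta>) = r *\<^sub>R k" using assms(2) by (simp add: inj_eq)
    have 1: "\<zeta> = r *\<^sub>R base_part k"
      using arg_cong[OF *, of base_part]
      by (simp add: linear_scale[OF bounded_linear.linear[OF bounded_linear_base_part]])
    have 2: "V \<zeta> = r * fibre_part k"
      using arg_cong[OF *, of fibre_part]
      by (simp add: linear_scale[OF bounded_linear.linear[OF bounded_linear_fibre_part]])
    have "V \<zeta> = r * V (base_part k)" unfolding 1 by (simp add: linear_scale[OF assms(4)])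
    with 2 assms(5) have "r = 0" by auto
    then show ?thesis using 1 by simp
  qed
  then show ?thesis using linear_injective_0[OF lin] by blast
qed

text \<open>The functional sending a vector to its fibre part minus \<open>\<omega>\<close> of its
  base part vanishes on the image of the graph plane. If it vanished on the image of the vertical
  vector too, it would vanish on the whole range of \<open>L\<close>, which contains the vertical
  vector, where its value is 1.\<close>

lemma conormal_nonzero:
  assumes "linear L" "surj L" "linear V" "linear \<omega>"
    and \<omega>: "\<And>\<zeta>. \<omega> (base_part (L (lift \<zeta> (V \<zeta>)))) = fibre_part (L (lift \<zeta> (V \<zeta>)))"
  shows "fibre_part (L (0,0,0,1)) \<noteq> \<omega> (base_part (L (0,0,0,1)))"
proof
  assume *: "fibre_part (L (0,0,0,1)) = \<omega> (base_part (L (0,0,0,1)))"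
  obtain k where k: "L k = (0,0,0,1)" using assms(2) by (metis surjD)
  define r where "r = fibre_part k - V (base_part k)"
  have "L k = L (lift (base_part k) (V (base_part k))) + r *\<^sub>R L (0,0,0,1)"
    by (subst lift_decompose[OF assms(3), of k]) (simp only: linear_add[OF assms(1)] linear_scale[OF assms(1)] r_def)
  then have "\<omega> (base_part (L k)) = fibre_part (L k)"
    using \<omega>[of "base_part k"] * bounded_linear.linear[OF bounded_linear_base_part] bounded_linear.linear[OF bounded_linear_fibre_part]
    by (simp add: linear_add linear_scale assms(4))
  then have "\<omega> 0 = 1" unfolding k by (simp add: zero_prod_def)
  then show False by (simp add: linear_0[OF assms(4)])
qed

lemma linear_jet: "linear (\<lambda>(a, b, c). a * r + b * p + c * s :: real)"
  by (rule linearI) (auto simp: algebra_simps split: prod.splits)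

section \<open>Projectability: the new t and y do not see x and u\<close>

text \<open>The condition on \<open>k\<close> says that the jet \<open>(r, p, s)\<close> is
  transversal. For such a jet the differential \<open>\<omega>\<close> of the image is the same for
  all \<open>\<alpha>\<close>, \<open>\<beta>\<close>, while the second-order relation depends on
  them through \<open>24 \<alpha> a^2 + 2 \<beta> (c - x0 a)^2\<close> times a nonzero factor. Hence
  the direction \<open>(a, b, c)\<close> sent to the new \<open>x\<close>-axis has
  \<open>a = c = 0\<close>, and its lift is a multiple of \<open>(0,1,0,p)\<close>.\<close>

lemma projectable_step:
  assumes sym: "point_transformation U \<Phi>" "maps_equation_to_itself U \<Phi>"
    and p0: "p0 = (t0, x0, y0, u0)" "p0 \<in> U"
    and k: "dd k \<Phi> p0 = (0,0,0,1)" "fibre_part k \<noteq> (\<lambda>(a, b, c). a * r + b * p + c * s) (base_part k)"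
  shows "fst (dd (0,1,0,p) \<Phi> p0) = 0 \<and> fst (snd (snd (dd (0,1,0,p) \<Phi> p0))) = 0"
proof -
  define L where "L h = dd h \<Phi> p0" for h
  define V where "V = (\<lambda>(a, b, c). a * r + b * p + c * s)"
  \<comment> \<open>The \<open>t\<close>-derivative of the test solution is
    \<open>2 e - x0 s\<close>; this choice makes it \<open>r\<close>.\<close>
  define e where "e = (r + x0 * s) / 2"
  have V_eq: "V = (\<lambda>(a, b, c). a * (2 * e - x0 * s) + b * p + c * s)"
  proof -
    have "2 * e - x0 * s = r" by (simp add: e_def field_simps)
    then show ?thesis by (simp add: V_def)
  qed
  have lin: "linear L" "inj L" "surj L"
    using point_transformation_linear[OF sym(1) p0(2)] point_transformation_inj[OF sym(1) p0(2)]
      point_transformation_surj[OF sym(1) p0(2)] by (auto simp: L_def[abs_def])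
  have linV: "linear V" unfolding V_def by (rule linear_jet)
  define M where "M \<zeta> = base_part (L (lift \<zeta> (V \<zeta>)))" for \<zeta>
  have J: "inj M" unfolding M_def[abs_def]
    by (rule inj_horizontal[OF lin(1,2) _ linV]) (use k in \<open>auto simp: L_def V_def\<close>)
  have linM: "linear M" unfolding M_def[abs_def] by (rule linear_horizontal[OF lin(1) linV])
  have surjM: "surj M" using linear_injective_imp_surjective[OF linM J] by simp
  note te = test_equation[OF sym p0 V_eq, folded L_def, OF J[unfolded M_def[abs_def]]]
  obtain a b c where abc: "M (a, b, c) = (0,1,0)" using surjM by (metis surjD prod_cases3)
  define R where "R = dd (lift (a, b, c) (V (a, b, c))) (dd (lift (a, b, c) (V (a, b, c))) \<Phi>) p0"
  define q0 where "q0 = - 2 * s * a * b + 2 * e * b^2"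
  have "\<exists>\<omega>. linear \<omega> \<and> (\<forall>\<zeta>. \<omega> (M \<zeta>) = fibre_part (L (lift \<zeta> (V \<zeta>)))) \<and>
     \<omega> (1,0,0) + fst (snd (\<Phi> p0)) * \<omega> (0,0,1)
     = (24 * \<alpha> * a^2 + 2 * \<beta> * (c - x0 * a)^2 + q0) * (fibre_part (L (0,0,0,1)) - \<omega> (base_part (L (0,0,0,1))))
       + (fibre_part R - \<omega> (base_part R))" for \<alpha> \<beta>
  proof (rule te[where \<alpha>=\<alpha> and \<beta>=\<beta>], goal_cases)
    case (1 \<omega>)
    have lb: "linear base_part" "linear fibre_part"
      using bounded_linear.linear bounded_linear_base_part bounded_linear_fibre_part by auto
    define q where "q = 24 * \<alpha> * a^2 + 2 * \<beta> * (c - x0 * a)^2 - 2 * s * a * b + 2 * e * b^2"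
    have q: "q = 24 * \<alpha> * a^2 + 2 * \<beta> * (c - x0 * a)^2 + q0" by (simp add: q_def q0_def)
    have *: "fibre_part (q *\<^sub>R L (0,0,0,1) + R) = q * fibre_part (L (0,0,0,1)) + fibre_part R"
      "\<omega> (base_part (q *\<^sub>R L (0,0,0,1) + R)) = q * \<omega> (base_part (L (0,0,0,1))) + \<omega> (base_part R)"
      by (simp_all add: linear_add[OF lb(1)] linear_add[OF lb(2)]
          linear_scale[OF lb(1)] linear_scale[OF lb(2)] linear_add[OF 1(1)] linear_scale[OF 1(1)])
    have "\<omega> (1,0,0) + fst (snd (\<Phi> p0)) * \<omega> (0,0,1) = q * (fibre_part (L (0,0,0,1)) - \<omega> (base_part (L (0,0,0,1))))
       + (fibre_part R - \<omega> (base_part R))"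
      using 1(3)[OF abc[unfolded M_def] refl, folded R_def q_def, unfolded *] by (simp add: algebra_simps)
    then show ?case using 1(1,2) unfolding q by (intro exI[of _ \<omega>]) (simp add: M_def)
  qed
  then obtain \<omega> where \<omega>: "linear (\<omega> \<alpha> \<beta>)" "\<omega> \<alpha> \<beta> (M \<zeta>) = fibre_part (L (lift \<zeta> (V \<zeta>)))"
    "\<omega> \<alpha> \<beta> (1,0,0) + fst (snd (\<Phi> p0)) * \<omega> \<alpha> \<beta> (0,0,1)
     = (24 * \<alpha> * a^2 + 2 * \<beta> * (c - x0 * a)^2 + q0) * (fibre_part (L (0,0,0,1)) - \<omega> \<alpha> \<beta> (base_part (L (0,0,0,1))))
       + (fibre_part R - \<omega> \<alpha> \<beta> (base_part R))" for \<alpha> \<beta> \<zeta>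
    by metis
  \<comment> \<open>The first-order relation fixes the values of \<open>\<omega>\<close> on the
    range of \<open>M\<close>, which is the whole base.\<close>
  have same: "\<omega> \<alpha> \<beta> = \<omega> 0 0" for \<alpha> \<beta>
  proof
    show "\<omega> \<alpha> \<beta> z = \<omega> 0 0 z" for z using \<omega>(2) surjM by (metis surjD)
  qed
  have \<kappa>: "fibre_part (L (0,0,0,1)) - \<omega> 0 0 (base_part (L (0,0,0,1))) \<noteq> 0"
    using conormal_nonzero[OF lin(1,3) linV \<omega>(1)[of 0 0]] \<omega>(2)[of 0 0] by (simp add: M_def)
  \<comment> \<open>The relations for \<open>\<alpha> = 1\<close> and \<open>\<alpha> = 0\<close>
    differ by \<open>24 a^2\<close> times the nonzero conormal factor; \<open>\<beta>\<close> is
    treated likewise below.\<close>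
  have a: "a = 0"
    using \<omega>(3)[of 1 0, unfolded same[of 1 0]] \<omega>(3)[of 0 0] \<kappa> by (auto simp: algebra_simps)
  have c: "c = 0"
    using \<omega>(3)[of 0 1, unfolded same[of 0 1]] \<omega>(3)[of 0 0] \<kappa> a by (auto simp: algebra_simps)
  have *: "lift (a, b, c) (V (a, b, c)) = b *\<^sub>R (0,1,0,p)" by (simp add: a c V_def)
  have "base_part (b *\<^sub>R L (0,1,0,p)) = (0,1,0)" using abc unfolding M_def * linear_scale[OF lin(1)] .
  then show ?thesis by (auto simp: base_part_def L_def)
qed

text \<open>One slope \<open>p\<close> controls only the combination \<open>(0,1,0,p)\<close>; two
  different slopes span the plane of the \<open>x\<close>- and \<open>u\<close>-directions. If
  \<open>kt\<close> or \<open>ky\<close> is nonzero, \<open>r\<close> or \<open>s\<close> can be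
  adjusted to make any slope transversal; otherwise only the slope with \<open>ku = kx * p\<close>
  is excluded.\<close>

lemma projectable:
  assumes sym: "point_transformation U \<Phi>" "maps_equation_to_itself U \<Phi>" and "p0 \<in> U"
  shows "fst (dd (0,b,0,d) \<Phi> p0) = 0" "fst (snd (snd (dd (0,b,0,d) \<Phi> p0))) = 0"
proof -
  obtain t0 x0 y0 u0 where p0: "p0 = (t0, x0, y0, u0)" by (cases p0)
  define L where "L h = dd h \<Phi> p0" for h
  have lin: "linear L" "surj L"
    using point_transformation_linear[OF sym(1) assms(3)] point_transformation_surj[OF sym(1) assms(3)] by (auto simp: L_def[abs_def])
  obtain kt kx ky ku where k: "L (kt, kx, ky, ku) = (0,0,0,1)" using lin(2) by (metis surjD prod_cases4)
  define ok where "ok p \<longleftrightarrow> fst (L (0,1,0,p)) = 0 \<and> fst (snd (snd (L (0,1,0,p)))) = 0" for p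
  have ok: "ok p" if "ku \<noteq> kt * r + kx * p + ky * s" for p r s
    using projectable_step[OF sym p0 assms(3), of "(kt, kx, ky, ku)" r p s] k that by (simp add: L_def ok_def)
  have or: "ok p \<or> (kt = 0 \<and> ky = 0 \<and> ku = kx * p)" for p
  proof (cases "kt = 0 \<and> ky = 0")
    case True then show ?thesis using ok[of 0 p 0] by auto
  next
    case False
    have "ku \<noteq> kt * ((ku - kx * p + 1) / kt) + kx * p + ky * 0" if "kt \<noteq> 0" using that by simp
    moreover have "ku \<noteq> kt * 0 + kx * p + ky * ((ku - kx * p + 1) / ky)" if "ky \<noteq> 0" using that by simp
    ultimately show ?thesis using ok False by blast
  qed
  have "(kt, kx, ky, ku) \<noteq> 0" using k linear_0[OF lin(1)] by (auto simp: zero_prod_def)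
  \<comment> \<open>At most one slope fails, since \<open>kt = ky = 0\<close> and
    \<open>ku = kx * p\<close> for two values of \<open>p\<close> would force \<open>k\<close> to
    vanish. Hence two of any three slopes are available.\<close>
  then have "ok 0 \<and> ok 1 \<or> ok 0 \<and> ok 2 \<or> ok 1 \<and> ok 2"
    using or[of 0] or[of 1] or[of 2] by (auto simp: zero_prod_def)
  moreover have "(0::real) \<noteq> 1" "(0::real) \<noteq> 2" "(1::real) \<noteq> 2" by simp_all
  ultimately obtain p p' where p: "p \<noteq> p'" "ok p" "ok p'" by blast
  define g where "g = (d - b * p) / (p' - p)"
  have "g * (p' - p) = d - b * p" using p(1) by (simp add: g_def)
  then have "b = (b - g) + g" "d = (b - g) * p + g * p'" by (auto simp: algebra_simps)
  then have "(0,b,0,d) = (b - g) *\<^sub>R (0,1,0,p) + g *\<^sub>R (0,1,0,p')" by simp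
  then have "L (0,b,0,d) = (b - g) *\<^sub>R L (0,1,0,p) + g *\<^sub>R L (0,1,0,p')"
    by (metis linear_add[OF lin(1)] linear_scale[OF lin(1)])
  then show "fst (dd (0,b,0,d) \<Phi> p0) = 0" "fst (snd (snd (dd (0,b,0,d) \<Phi> p0))) = 0"
    using p(2,3) by (auto simp: ok_def L_def[symmetric])
qed

lemma dd_bounded_linear:
  assumes "bounded_linear L" "smooth_on S f" "p \<in> S"
  shows "dd h (\<lambda>p. L (f p)) p = L (dd h f p)"
  by (rule dd_eqI[OF bounded_linear.has_derivative[OF assms(1) smooth_onD[OF assms(2,3)]]])

lemma dd_dd_bounded_linear:
  assumes "bounded_linear L" "open S" "smooth_on S f" "p \<in> S"
  shows "dd k (dd h (\<lambda>p. L (f p))) p = L (dd k (dd h f) p)"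
proof -
  have "dd k (dd h (\<lambda>p. L (f p))) p = dd k (\<lambda>p. L (dd h f p)) p"
    by (rule dd_cong[OF assms(2) dd_bounded_linear[OF assms(1,3)] assms(4)
          smooth_on_differentiable[OF smooth_on_dd[OF smooth_on_bounded_linear[OF assms(1-3)]] assms(4)]])
  also have "\<dots> = L (dd k (dd h f) p)"
    by (rule dd_bounded_linear[OF assms(1) smooth_on_dd[OF assms(3)] assms(4)])
  finally show ?thesis .
qed

lemma dd_dd_scale:
  assumes "open S" "smooth_on S f" "p \<in> S"
  shows "dd (b *\<^sub>R h) (dd (b *\<^sub>R h) f) p = b^2 *\<^sub>R dd h (dd h f) p"
proof -
  have lin: "dd (b *\<^sub>R h) f q = b *\<^sub>R dd h f q" if "smooth_on S f" "q \<in> S" for q and f :: "'a \<Rightarrow> 'b"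
    by (rule linear_scale[OF linear_dd[OF smooth_on_differentiable[OF that]]])
  have "dd (b *\<^sub>R h) (dd (b *\<^sub>R h) f) p = dd (b *\<^sub>R h) (\<lambda>q. b *\<^sub>R dd h f q) p"
    by (rule dd_cong[OF assms(1) lin[OF assms(2)] assms(3) smooth_on_differentiable[OF smooth_on_dd[OF assms(2)] assms(3)]])
  also have "\<dots> = b *\<^sub>R dd (b *\<^sub>R h) (dd h f) p"
    by (rule dd_bounded_linear[OF bounded_linear_scaleR_right smooth_on_dd[OF assms(2)] assms(3)])
  finally show ?thesis using lin[OF smooth_on_dd[OF assms(2)] assms(3)] by (simp add: power2_eq_square)
qed

lemma dd_zero_cong:
  assumes "open S" "smooth_on S f" "p \<in> S" "\<And>q. q \<in> S \<Longrightarrow> f q = 0"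
  shows "dd k f p = 0"
proof -
  have "dd k f p = dd k (\<lambda>q. 0) p"
    by (rule dd_cong[OF assms(1,4,3) smooth_on_differentiable[OF assms(2,3)]])
  then show ?thesis using dd_eqI[OF has_derivative_const] by simp
qed

lemma linear_total:
  fixes L :: "total \<Rightarrow> 'a::real_vector"
  assumes "linear L"
  shows "L (a, b, c, d) = a *\<^sub>R L (1,0,0,0) + b *\<^sub>R L (0,1,0,0) + c *\<^sub>R L (0,0,1,0) + d *\<^sub>R L (0,0,0,1)"
proof -
  have "L (a, b, c, d) = L (a *\<^sub>R (1,0,0,0) + b *\<^sub>R (0,1,0,0) + c *\<^sub>R (0,0,1,0) + d *\<^sub>R (0,0,0,1))" by simp
  then show ?thesis by (simp only: linear_add[OF assms] linear_scale[OF assms])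
qed

lemma linear_base:
  fixes \<omega> :: "base \<Rightarrow> real"
  assumes "linear \<omega>"
  shows "\<omega> (a, b, c) = \<omega> (1,0,0) * a + \<omega> (0,1,0) * b + \<omega> (0,0,1) * c"
proof -
  have "\<omega> (a, b, c) = \<omega> (a *\<^sub>R (1,0,0) + b *\<^sub>R (0,1,0) + c *\<^sub>R (0,0,1))" by simp
  then show ?thesis by (simp only: linear_add[OF assms] linear_scale[OF assms]) simp
qed

text \<open>With the vanishing \<open>x\<close>- and \<open>u\<close>-derivatives of the new
  \<open>t\<close> and \<open>y\<close> the Jacobian matrix is block triangular. Surjectivity makes
  the \<open>(t, y)\<close> block regular and prevents the new \<open>x\<close> from losing both
  \<open>x\<close> and \<open>u\<close>.\<close>

lemma projectable_jacobian:
  assumes sym: "point_transformation U \<Phi>" "maps_equation_to_itself U \<Phi>" and p: "p \<in> U"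
  obtains Tt Xt Yt Wt Xx Wx Ty Xy Yy Wy Xu Wu where
    "\<And>a b c d. dd (a, b, c, d) \<Phi> p = (a*Tt + c*Ty, a*Xt + b*Xx + c*Xy + d*Xu, a*Yt + c*Yy, a*Wt + b*Wx + c*Wy + d*Wu)"
    "Tt * Yy - Ty * Yt \<noteq> 0" "Xx \<noteq> 0 \<or> Xu \<noteq> 0"
proof -
  define L where "L h = dd h \<Phi> p" for h
  have lin: "linear L" "surj L"
    using point_transformation_linear[OF sym(1) p] point_transformation_surj[OF sym(1) p] by (auto simp: L_def[abs_def])
  obtain Tt Xt Yt Wt where 1: "L (1,0,0,0) = (Tt,Xt,Yt,Wt)" by (cases "L (1,0,0,0)")
  obtain Tx Xx Yx Wx where 2: "L (0,1,0,0) = (Tx,Xx,Yx,Wx)" by (cases "L (0,1,0,0)")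
  obtain Ty Xy Yy Wy where 3: "L (0,0,1,0) = (Ty,Xy,Yy,Wy)" by (cases "L (0,0,1,0)")
  obtain Tu Xu Yu Wu where 4: "L (0,0,0,1) = (Tu,Xu,Yu,Wu)" by (cases "L (0,0,0,1)")
  have 0: "Tx = 0" "Yx = 0" "Tu = 0" "Yu = 0"
    using projectable[OF sym p, of 1 0] projectable[OF sym p, of 0 1] 2 4 by (auto simp: L_def)
  have L: "L (a, b, c, d) = (a*Tt + c*Ty, a*Xt + b*Xx + c*Xy + d*Xu, a*Yt + c*Yy, a*Wt + b*Wx + c*Wy + d*Wu)" for a b c d
    unfolding linear_total[OF lin(1), of a b c d] 1 2 3 4 by (simp add: 0)
  obtain a b c d where h1: "L (a, b, c, d) = (1,0,0,0)" using lin(2) by (metis surjD prod_cases4)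
  obtain a' b' c' d' where h3: "L (a', b', c', d') = (0,0,1,0)" using lin(2) by (metis surjD prod_cases4)
  obtain a'' b'' c'' d'' where h2: "L (a'', b'', c'', d'') = (0,1,0,0)" using lin(2) by (metis surjD prod_cases4)
  have "(Tt * Yy - Ty * Yt) * (a * c' - a' * c) = (a*Tt + c*Ty) * (a'*Yt + c'*Yy) - (a'*Tt + c'*Ty) * (a*Yt + c*Yy)"
    by algebra
  also have "\<dots> = 1" using h1 h3 unfolding L by simp
  finally have \<Delta>: "Tt * Yy - Ty * Yt \<noteq> 0" by auto
  have e: "a''*Tt + c''*Ty = 0" "a''*Yt + c''*Yy = 0" "a''*Xt + b''*Xx + c''*Xy + d''*Xu = 1" using h2 unfolding L by auto
  have "a'' * (Tt * Yy - Ty * Yt) = (a''*Tt + c''*Ty) * Yy - (a''*Yt + c''*Yy) * Ty"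
    "c'' * (Tt * Yy - Ty * Yt) = (a''*Yt + c''*Yy) * Tt - (a''*Tt + c''*Ty) * Yt" by algebra+
  then have "a'' = 0" "c'' = 0" using \<Delta> unfolding e by auto
  then have "Xx \<noteq> 0 \<or> Xu \<noteq> 0" using e(3) by auto
  then show ?thesis using that L \<Delta> unfolding L_def by blast
qed

text \<open>The direction sent to the new \<open>x\<close>-axis is now a multiple of
  \<open>(0,1,0,p)\<close>, and \<open>Xx + p * Xu\<close> is the total \<open>x\<close>-derivative
  of the new \<open>x\<close> along the graph; its nonvanishing is transversality.
  \<open>\<omega>T\<close>, \<open>\<omega>X\<close>, \<open>\<omega>Y\<close> are the derivatives
  of the image function, and the fourth relation is its equation, cleared of the
  denominator.\<close>

lemma projectable_equation:
  fixes p s e :: real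
  assumes sym: "point_transformation U \<Phi>" "maps_equation_to_itself U \<Phi>"
    and p0: "p0 = (t0, x0, y0, u0)" "p0 \<in> U"
    and jac: "\<And>a b c d. dd (a, b, c, d) \<Phi> p0 = (a*Tt + c*Ty, a*Xt + b*Xx + c*Xy + d*Xu, a*Yt + c*Yy, a*Wt + b*Wx + c*Wy + d*Wu)"
    and \<Delta>: "Tt * Yy - Ty * Yt \<noteq> 0" and \<chi>: "Xx + p * Xu \<noteq> 0"
    and h: "h = (0,1,0,p)" and H: "H = dd h (dd h \<Phi>) p0"
  obtains \<omega>T \<omega>X \<omega>Y where
    "\<omega>X * (Xx + p * Xu) = Wx + p * Wu"
    "\<omega>T * Tt + \<omega>X * (Xt + (2 * e - x0 * s) * Xu) + \<omega>Y * Yt = Wt + (2 * e - x0 * s) * Wu"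
    "\<omega>T * Ty + \<omega>X * (Xy + s * Xu) + \<omega>Y * Yy = Wy + s * Wu"
    "(\<omega>T + fst (snd (\<Phi> p0)) * \<omega>Y) * (Xx + p * Xu)^2
      = snd (snd (snd H)) + 2 * e * Wu - \<omega>X * (fst (snd H) + 2 * e * Xu)"
    "Wu \<noteq> \<omega>X * Xu"
proof -
  define L where "L h = dd h \<Phi> p0" for h
  have L: "L (a, b, c, d) = (a*Tt + c*Ty, a*Xt + b*Xx + c*Xy + d*Xu, a*Yt + c*Yy, a*Wt + b*Wx + c*Wy + d*Wu)" for a b c d
    by (simp add: L_def jac)
  have lin: "linear L" "surj L"
    using point_transformation_linear[OF sym(1) p0(2)] point_transformation_surj[OF sym(1) p0(2)] by (auto simp: L_def[abs_def])
  note U = point_transformation_smooth[OF sym(1)]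
  define r where "r = 2 * e - x0 * s"
  define V where "V = (\<lambda>(a, b, c). a * (2 * e - x0 * s) + b * p + c * s)"
  have linV: "linear V" unfolding V_def by (rule linear_jet)
  have M: "base_part (L (lift (a, b, c) (V (a, b, c)))) = (a*Tt + c*Ty, a*(Xt + r*Xu) + b*(Xx + p*Xu) + c*(Xy + s*Xu), a*Yt + c*Yy)" for a b c
    by (simp add: L V_def r_def algebra_simps)
  have J: "inj (\<lambda>\<zeta>. base_part (L (lift \<zeta> (V \<zeta>))))"
  proof -
    have "\<zeta> = 0" if "base_part (L (lift \<zeta> (V \<zeta>))) = 0" for \<zeta>
    proof (cases \<zeta>)
      case (fields a b c)
      have e: "a*Tt + c*Ty = 0" "a*Yt + c*Yy = 0" "a*(Xt + r*Xu) + b*(Xx + p*Xu) + c*(Xy + s*Xu) = 0"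
        using that unfolding fields M by (auto simp: zero_prod_def)
      have "a * (Tt * Yy - Ty * Yt) = (a*Tt + c*Ty) * Yy - (a*Yt + c*Yy) * Ty"
        "c * (Tt * Yy - Ty * Yt) = (a*Yt + c*Yy) * Tt - (a*Tt + c*Ty) * Yt" by algebra+
      then have "a = 0" "c = 0" using \<Delta> unfolding e by auto
      moreover have "b = 0" using calculation e(3) \<chi> by auto
      ultimately show ?thesis by (simp add: fields zero_prod_def)
    qed
    then show ?thesis using linear_injective_0[OF linear_horizontal[OF lin(1) linV]] by blast
  qed
  obtain \<omega> where \<omega>: "linear \<omega>"
    "\<And>\<zeta>. \<omega> (base_part (L (lift \<zeta> (V \<zeta>)))) = fibre_part (L (lift \<zeta> (V \<zeta>)))"
    and eq: "\<And>a b c Q. base_part (L (lift (a, b, c) (V (a, b, c)))) = (0,1,0) \<Longrightarrow>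
       Q = (24 * 0 * a^2 + 2 * 0 * (c - x0 * a)^2 - 2 * s * a * b + 2 * e * b^2) *\<^sub>R L (0,0,0,1)
         + dd (lift (a, b, c) (V (a, b, c))) (dd (lift (a, b, c) (V (a, b, c))) \<Phi>) p0 \<Longrightarrow>
       \<omega> (1,0,0) + fst (snd (\<Phi> p0)) * \<omega> (0,0,1) = fibre_part Q - \<omega> (base_part Q)"
    using test_equation[OF sym p0 V_def, of 0 0 thesis, folded L_def, OF J] by blast
  define \<omega>T where "\<omega>T = \<omega> (1,0,0)"
  define \<omega>X where "\<omega>X = \<omega> (0,1,0)"
  define \<omega>Y where "\<omega>Y = \<omega> (0,0,1)"
  note lw = linear_base[OF \<omega>(1), folded \<omega>T_def \<omega>X_def \<omega>Y_def]
  have *: "\<omega>T * (a*Tt + c*Ty) + \<omega>X * (a*(Xt + r*Xu) + b*(Xx + p*Xu) + c*(Xy + s*Xu)) + \<omega>Y * (a*Yt + c*Yy)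
     = a*Wt + b*Wx + c*Wy + (a*r + b*p + c * s) * Wu" for a b c
    using \<omega>(2)[of "(a, b, c)", unfolded M lw] by (simp add: L V_def r_def)
  \<comment> \<open>The derivatives of the new \<open>t\<close> and \<open>y\<close> along
    \<open>h\<close> vanish on all of \<open>U\<close>, so they can be differentiated once
    more.\<close>
  have T0: "fst H = 0" "fst (snd (snd H)) = 0"
  proof -
    have bl: "bounded_linear (\<lambda>q::total. fst q)" "bounded_linear (\<lambda>q::total. fst (snd (snd q)))"
      by (intro bounded_linear_fst bounded_linear_snd bounded_linear_compose[OF bounded_linear_fst]
          bounded_linear_compose[OF bounded_linear_snd])+
    have "dd h (\<lambda>q. fst (dd h \<Phi> q)) p0 = 0" "dd h (\<lambda>q. fst (snd (snd (dd h \<Phi> q)))) p0 = 0"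
      by (rule dd_zero_cong[OF U(1) smooth_on_bounded_linear[OF bl(1) U(1) smooth_on_dd[OF U(2)]] p0(2)],
          simp add: h projectable[OF sym],
          rule dd_zero_cong[OF U(1) smooth_on_bounded_linear[OF bl(2) U(1) smooth_on_dd[OF U(2)]] p0(2)],
          simp add: h projectable[OF sym])
    then show "fst H = 0" "fst (snd (snd H)) = 0"
      unfolding H dd_bounded_linear[OF bl(1) smooth_on_dd[OF U(2)] p0(2)] dd_bounded_linear[OF bl(2) smooth_on_dd[OF U(2)] p0(2)] .
  qed
  obtain X2 W2 where H2: "H = (0, X2, 0, W2)" using T0 by (cases H) auto
  define b where "b = 1 / (Xx + p * Xu)"
  have b: "b * (Xx + p * Xu) = 1" using \<chi> by (simp add: b_def)
  have "lift (0, b, 0) (V (0, b, 0)) = b *\<^sub>R h" by (simp add: V_def h)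
  moreover have "base_part (L (lift (0, b, 0) (V (0, b, 0)))) = (0,1,0)" unfolding M using b by simp
  ultimately have "\<omega>T + fst (snd (\<Phi> p0)) * \<omega>Y = fibre_part ((2 * e * b^2) *\<^sub>R L (0,0,0,1) + b^2 *\<^sub>R H)
       - \<omega> (base_part ((2 * e * b^2) *\<^sub>R L (0,0,0,1) + b^2 *\<^sub>R H))"
    using eq[of 0 b 0, OF _ refl] dd_dd_scale[OF U p0(2), of b h] unfolding H \<omega>T_def \<omega>Y_def by simp
  also have "\<dots> = b^2 * (W2 + 2 * e * Wu - \<omega>X * (X2 + 2 * e * Xu))"
    by (simp add: H2 L lw algebra_simps)
  finally have "(\<omega>T + fst (snd (\<Phi> p0)) * \<omega>Y) * (Xx + p * Xu)^2 = (b * (Xx + p * Xu))^2 * (W2 + 2 * e * Wu - \<omega>X * (X2 + 2 * e * Xu))"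
    by (simp add: power_mult_distrib)
  then have 4: "(\<omega>T + fst (snd (\<Phi> p0)) * \<omega>Y) * (Xx + p * Xu)^2 = W2 + 2 * e * Wu - \<omega>X * (X2 + 2 * e * Xu)"
    unfolding b by simp
  have 5: "Wu \<noteq> \<omega>X * Xu"
    using conormal_nonzero[OF lin linV \<omega>] by (simp add: L lw)
  show ?thesis
    using that[of \<omega>X \<omega>T \<omega>Y] *[of 0 1 0] *[of 1 0 0] *[of 0 0 1] 4 5 by (simp add: H2 r_def)
qed

text \<open>The relations are linear in \<open>\<omega>T\<close> and \<open>\<omega>Y\<close>, so
  jets with equal \<open>p\<close> are compared by subtraction. A change of \<open>s\<close> alone
  gives the transport relation between the first derivatives of the new \<open>t\<close> and
  \<open>y\<close>; a change of \<open>e\<close> alone gives the relation with the squared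
  \<open>x\<close>-scaling. The relations for \<open>e = s = 0\<close> and arbitrary slope are kept
  for the study of the new \<open>u\<close>.\<close>

lemma point_structure:
  assumes sym: "point_transformation U \<Phi>" "maps_equation_to_itself U \<Phi>"
    and p0: "p0 = (t0, x0, y0, u0)" "p0 \<in> U"
  obtains Tt Xt Yt Wt Xx Wx Ty Xy Yy Wy Wu where
    "\<And>a b c d. dd (a, b, c, d) \<Phi> p0 = (a*Tt + c*Ty, a*Xt + b*Xx + c*Xy, a*Yt + c*Yy, a*Wt + b*Wx + c*Wy + d*Wu)"
    "Tt * Yy - Ty * Yt \<noteq> 0" "Xx \<noteq> 0" "Wu \<noteq> 0"
    "fst (snd (\<Phi> p0)) * (Tt + x0 * Ty) = Yt + x0 * Yy"
    "(Yy - fst (snd (\<Phi> p0)) * Ty) * Xx^2 = Tt * Yy - Ty * Yt"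
    "\<forall>p. \<exists>\<omega>T \<omega>X \<omega>Y. \<omega>X * Xx = Wx + p * Wu \<and> \<omega>T * Tt + \<omega>X * Xt + \<omega>Y * Yt = Wt \<and> \<omega>T * Ty + \<omega>X * Xy + \<omega>Y * Yy = Wy \<and>
       (\<omega>T + fst (snd (\<Phi> p0)) * \<omega>Y) * Xx^2
         = snd (snd (snd (dd (0,1,0,p) (dd (0,1,0,p) \<Phi>) p0))) - \<omega>X * fst (snd (dd (0,1,0,p) (dd (0,1,0,p) \<Phi>) p0))"
proof -
  obtain Tt Xt Yt Wt Xx Wx Ty Xy Yy Wy Xu Wu where
    jac: "\<And>a b c d. dd (a, b, c, d) \<Phi> p0 = (a*Tt + c*Ty, a*Xt + b*Xx + c*Xy + d*Xu, a*Yt + c*Yy, a*Wt + b*Wx + c*Wy + d*Wu)"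
    and \<Delta>: "Tt * Yy - Ty * Yt \<noteq> 0" and nz: "Xx \<noteq> 0 \<or> Xu \<noteq> 0"
    using projectable_jacobian[OF sym p0(2)] by metis
  define X where "X = fst (snd (\<Phi> p0))"
  have eq: "\<exists>\<omega>T \<omega>X \<omega>Y. \<omega>X * (Xx + p * Xu) = Wx + p * Wu \<and>
    \<omega>T * Tt + \<omega>X * (Xt + (2 * e - x0 * s) * Xu) + \<omega>Y * Yt = Wt + (2 * e - x0 * s) * Wu \<and>
    \<omega>T * Ty + \<omega>X * (Xy + s * Xu) + \<omega>Y * Yy = Wy + s * Wu \<and>
    (\<omega>T + X * \<omega>Y) * (Xx + p * Xu)^2 = snd (snd (snd H)) + 2 * e * Wu - \<omega>X * (fst (snd H) + 2 * e * Xu) \<and>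
    Wu \<noteq> \<omega>X * Xu"
    if "Xx + p * Xu \<noteq> 0" "H = dd (0,1,0,p) (dd (0,1,0,p) \<Phi>) p0" for p e s H
    by (rule projectable_equation[OF sym p0 jac \<Delta> that(1) refl that(2), folded X_def, of e s]) blast
  \<comment> \<open>The jets \<open>(e, s)\<close> compared here are \<open>(0,0)\<close>,
    \<open>(0,1)\<close> and \<open>(1,0)\<close>. The factor \<open>K\<close> is the conormal value
    of the vertical vector, nonzero by the last relation.\<close>
  have step: "X * (Tt + x0 * Ty) = Yt + x0 * Yy" "(Yy - X * Ty) * (Xx + p * Xu)^2 = Tt * Yy - Ty * Yt"
    if \<chi>: "Xx + p * Xu \<noteq> 0" for p
  proof -
    define H where "H = dd (0,1,0,p) (dd (0,1,0,p) \<Phi>) p0"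
    obtain \<omega>T \<omega>X \<omega>Y where a:
      "\<omega>X * (Xx + p * Xu) = Wx + p * Wu"
      "\<omega>T * Tt + \<omega>X * Xt + \<omega>Y * Yt = Wt"
      "\<omega>T * Ty + \<omega>X * Xy + \<omega>Y * Yy = Wy"
      "(\<omega>T + X * \<omega>Y) * (Xx + p * Xu)^2 = snd (snd (snd H)) - \<omega>X * (fst (snd H))"
      "Wu \<noteq> \<omega>X * Xu"
      using eq[OF \<chi> H_def, of 0 0] by auto
    obtain \<omega>T' \<omega>X' \<omega>Y' where b:
      "\<omega>X' * (Xx + p * Xu) = Wx + p * Wu"
      "\<omega>T' * Tt + \<omega>X' * (Xt - x0 * Xu) + \<omega>Y' * Yt = Wt - x0 * Wu"
      "\<omega>T' * Ty + \<omega>X' * (Xy + Xu) + \<omega>Y' * Yy = Wy + Wu"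
      "(\<omega>T' + X * \<omega>Y') * (Xx + p * Xu)^2 = snd (snd (snd H)) - \<omega>X' * (fst (snd H))"
      using eq[OF \<chi> H_def, of 0 1] by auto
    obtain \<omega>T'' \<omega>X'' \<omega>Y'' where c:
      "\<omega>X'' * (Xx + p * Xu) = Wx + p * Wu"
      "\<omega>T'' * Tt + \<omega>X'' * (Xt + 2 * Xu) + \<omega>Y'' * Yt = Wt + 2 * Wu"
      "\<omega>T'' * Ty + \<omega>X'' * Xy + \<omega>Y'' * Yy = Wy"
      "(\<omega>T'' + X * \<omega>Y'') * (Xx + p * Xu)^2 = snd (snd (snd H)) + 2 * Wu - \<omega>X'' * (fst (snd H) + 2 * Xu)"
      using eq[OF \<chi> H_def, of 1 0] by auto
    have s: "\<omega>X' = \<omega>X" "\<omega>X'' = \<omega>X" using a(1) b(1) c(1) \<chi> by (metis mult_cancel_right)+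
    define K where "K = Wu - \<omega>X * Xu"
    have K: "K \<noteq> 0" using a(5) by (simp add: K_def)
    have "(\<omega>T' + X * \<omega>Y') * (Xx + p * Xu)^2 = (\<omega>T + X * \<omega>Y) * (Xx + p * Xu)^2" using a(4) b(4) s by simp
    then have "\<omega>T' + X * \<omega>Y' = \<omega>T + X * \<omega>Y" using \<chi> by simp
    then have 1: "(\<omega>T' - \<omega>T) + X * (\<omega>Y' - \<omega>Y) = 0" by (simp add: algebra_simps)
    have 2: "(\<omega>T' - \<omega>T) * Tt + (\<omega>Y' - \<omega>Y) * Yt = - x0 * K" "(\<omega>T' - \<omega>T) * Ty + (\<omega>Y' - \<omega>Y) * Yy = K"
      using a(2,3) b(2,3) unfolding s K_def by (simp_all add: algebra_simps)
    have "(\<omega>Y' - \<omega>Y) * (Yt + x0 * Yy - X * (Tt + x0 * Ty)) = 0" using 1 2 by algebra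
    moreover have "\<omega>Y' - \<omega>Y \<noteq> 0" using 1 2 K by auto
    ultimately show "X * (Tt + x0 * Ty) = Yt + x0 * Yy" by simp
    have 3: "((\<omega>T'' - \<omega>T) + X * (\<omega>Y'' - \<omega>Y)) * (Xx + p * Xu)^2 = 2 * K"
      using a(4) c(4) unfolding s K_def by (simp add: algebra_simps)
    have 4: "(\<omega>T'' - \<omega>T) * Tt + (\<omega>Y'' - \<omega>Y) * Yt = 2 * K" "(\<omega>T'' - \<omega>T) * Ty + (\<omega>Y'' - \<omega>Y) * Yy = 0"
      using a(2,3) c(2,3) unfolding s K_def by (simp_all add: algebra_simps)
    have 5: "(\<omega>T'' - \<omega>T) * (Tt * Yy - Ty * Yt) = 2 * K * Yy" "(\<omega>Y'' - \<omega>Y) * (Tt * Yy - Ty * Yt) = - 2 * K * Ty"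
      using 4 by algebra+
    have "2 * K * (Tt * Yy - Ty * Yt) = ((\<omega>T'' - \<omega>T) * (Tt * Yy - Ty * Yt) + X * ((\<omega>Y'' - \<omega>Y) * (Tt * Yy - Ty * Yt))) * (Xx + p * Xu)^2"
      using 3 by algebra
    also have "\<dots> = 2 * K * ((Yy - X * Ty) * (Xx + p * Xu)^2)" unfolding 5 by (simp add: algebra_simps)
    finally show "(Yy - X * Ty) * (Xx + p * Xu)^2 = Tt * Yy - Ty * Yt" using K by simp
  qed
  \<comment> \<open>In the second relation only \<open>(Xx + p * Xu)^2\<close> depends on
    \<open>p\<close>. If \<open>Xu\<close> were nonzero, suitable slopes would make it 1 and 4,
    against the regularity of the \<open>(t, y)\<close> block.\<close>
  have Xu: "Xu = 0"
  proof (rule ccontr)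
    assume "Xu \<noteq> 0"
    then have *: "Xx + ((1 - Xx) / Xu) * Xu = 1" "Xx + ((2 - Xx) / Xu) * Xu = 2" by auto
    have "(Yy - X * Ty) * 1^2 = Tt * Yy - Ty * Yt" "(Yy - X * Ty) * 2^2 = Tt * Yy - Ty * Yt"
      using step(2)[of "(1 - Xx) / Xu"] step(2)[of "(2 - Xx) / Xu"] unfolding * by auto
    then show False using \<Delta> by simp
  qed
  with nz have Xx: "Xx \<noteq> 0" by simp
  have C: "\<exists>\<omega>T \<omega>X \<omega>Y. \<omega>X * Xx = Wx + p * Wu \<and> \<omega>T * Tt + \<omega>X * Xt + \<omega>Y * Yt = Wt \<and> \<omega>T * Ty + \<omega>X * Xy + \<omega>Y * Yy = Wy \<and>
       (\<omega>T + X * \<omega>Y) * Xx^2 = snd (snd (snd H)) - \<omega>X * fst (snd H) \<and> Wu \<noteq> 0"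
    if "H = dd (0,1,0,p) (dd (0,1,0,p) \<Phi>) p0" for p H
    using eq[of p H 0 0] Xx that by (simp add: Xu)
  have Wu: "Wu \<noteq> 0" using C[OF refl] by blast
  have C': "\<exists>\<omega>T \<omega>X \<omega>Y. \<omega>X * Xx = Wx + p * Wu \<and> \<omega>T * Tt + \<omega>X * Xt + \<omega>Y * Yt = Wt \<and> \<omega>T * Ty + \<omega>X * Xy + \<omega>Y * Yy = Wy \<and>
       (\<omega>T + X * \<omega>Y) * Xx^2 = snd (snd (snd H)) - \<omega>X * fst (snd H)"
    if "H = dd (0,1,0,p) (dd (0,1,0,p) \<Phi>) p0" for p H
    using C[OF that] by blast
  show ?thesis
    by (rule that[where Wu=Wu, folded X_def, OF _ \<Delta> Xx Wu step(1)[of 0] step(2)[of 0, unfolded Xu, simplified]])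
       (simp add: jac Xu, simp add: Xx Xu, simp add: Xx, intro allI, rule C', rule refl)
qed

section \<open>Integration of the determining equations\<close>

lemma dd_mult:
  fixes f g :: "'a::real_normed_vector \<Rightarrow> real"
  assumes "smooth_on S f" "smooth_on S g" "p \<in> S"
  shows "dd h (\<lambda>z. f z * g z) p = dd h f p * g p + f p * dd h g p"
  using dd_eqI[OF has_derivative_mult[OF smooth_onD[OF assms(1,3)] smooth_onD[OF assms(2,3)]]] by simp

lemma dd_dd_mult:
  fixes f g :: "'a::real_normed_vector \<Rightarrow> real"
  assumes "open S" "smooth_on S f" "smooth_on S g" "p \<in> S"
  shows "dd h (dd h (\<lambda>z. f z * g z)) p = dd h (dd h f) p * g p + 2 * dd h f p * dd h g p + f p * dd h (dd h g) p"
proof -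
  note d = smooth_on_dd[OF assms(2), of h] smooth_on_dd[OF assms(3), of h]
  have "dd h (dd h (\<lambda>z. f z * g z)) p = dd h (\<lambda>p. dd h f p * g p + f p * dd h g p) p"
    by (rule dd_cong[OF assms(1) dd_mult[OF assms(2,3)] assms(4)
          smooth_on_differentiable[OF smooth_on_dd[OF smooth_on_mult[OF assms(1-3)]] assms(4)]])
  also have "\<dots> = dd h (dd h f) p * g p + dd h f p * dd h g p + (dd h f p * dd h g p + f p * dd h (dd h g) p)"
    by (rule trans[OF dd_eqI, OF has_derivative_add[OF has_derivative_mult[OF smooth_onD[OF d(1) assms(4)] smooth_onD[OF assms(3,4)]]
        has_derivative_mult[OF smooth_onD[OF assms(2,4)] smooth_onD[OF d(2) assms(4)]]]]) simp
  finally show ?thesis by simp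
qed

text \<open>Insert \<open>h = A g\<close> into the operator with drift,
  \<open>h_t + x h_y - \<xi> h_x - h_xx\<close>. The two conditions are the vanishing of the
  coefficients of \<open>g_x\<close> and of \<open>g\<close>; what remains is \<open>A\<close> times
  the drift-free operator applied to \<open>g\<close>.\<close>

abbreviation gauge_factor :: "real \<Rightarrow> (base \<Rightarrow> real) \<Rightarrow> real \<Rightarrow> real \<Rightarrow> real \<Rightarrow> bool" where
  "gauge_factor \<xi> A t x y \<equiv> 2 * Dx A (t, x, y) = - \<xi> * A (t, x, y) \<and>
     Dt A (t, x, y) + x * Dy A (t, x, y) - \<xi> * Dx A (t, x, y) = Dx (Dx A) (t, x, y)"

lemma gauge_identity:
  assumes "open S" "smooth_on S A" "smooth_on S g" "z \<in> S"
    and "2 * Dx A z = - \<xi> * A z"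
    and "Dt A z + fst (snd z) * Dy A z - \<xi> * Dx A z = Dx (Dx A) z"
    and h: "\<And>z. z \<in> S \<Longrightarrow> h z = A z * g z"
  shows "Dt h z + fst (snd z) * Dy h z - \<xi> * Dx h z - Dx (Dx h) z = A z * kolmogorov g z"
proof -
  have sm: "smooth_on S (\<lambda>z. A z * g z)" by (rule smooth_on_mult[OF assms(1-3)])
  then have smh: "smooth_on S h" using smooth_on_cong[OF assms(1), of h "\<lambda>z. A z * g z"] h by blast
  have 1: "dd k h z = dd k (\<lambda>z. A z * g z) z" if "z \<in> S" for k z
    by (rule dd_cong[OF assms(1) h that smooth_on_differentiable[OF smh that]])
  have 2: "Dx (Dx h) z = Dx (Dx (\<lambda>z. A z * g z)) z"
    by (rule dd_cong[OF assms(1) 1 assms(4) smooth_on_differentiable[OF smooth_on_dd[OF smh] assms(4)]])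
  show ?thesis
    unfolding 2 1[OF assms(4)] unfolding kolmogorov_def dd_mult[OF assms(2-4)] dd_dd_mult[OF assms(1-4)] using assms(5,6) by algebra
qed

lemma kolmogorov_add:
  assumes "open S" "smooth_on S f" "smooth_on S g" "z \<in> S"
  shows "kolmogorov (\<lambda>z. f z + g z) z = kolmogorov f z + kolmogorov g z"
proof -
  have add: "dd h (\<lambda>z. f z + g z) z = dd h f z + dd h g z"
    if "smooth_on S f" "smooth_on S g" "z \<in> S" for h z and f g :: "base \<Rightarrow> real"
    by (rule dd_eqI[OF has_derivative_add[OF smooth_onD[OF that(1,3)] smooth_onD[OF that(2,3)]]])
  have "Dx (Dx (\<lambda>z. f z + g z)) z = Dx (\<lambda>z. Dx f z + Dx g z) z"
    by (rule dd_cong[OF assms(1) add[OF assms(2,3)] assms(4)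
          smooth_on_differentiable[OF smooth_on_dd[OF smooth_on_add[OF assms(1-3)]] assms(4)]])
  then show ?thesis
    unfolding kolmogorov_def by (simp add: add assms smooth_on_dd algebra_simps)
qed

lemma kolmogorov_const: "kolmogorov (\<lambda>z. c) z = 0"
proof -
  have "dd h (\<lambda>z. c) = (\<lambda>z. 0)" for h :: base and c :: real
    using dd_eqI[OF has_derivative_const] by (metis ext)
  then show ?thesis by (simp add: kolmogorov_def)
qed

text \<open>The slope \<open>c\<close> of the test graphs is free, so second derivatives along
  \<open>h + c *\<^sub>R k\<close> become polynomials in \<open>c\<close> whose coefficients can be
  compared.\<close>

lemma dd_dd_line:
  fixes F :: "'a::real_normed_vector \<Rightarrow> real"
  assumes "open S" "smooth_on S F" "p \<in> S"
  shows "dd (h + c *\<^sub>R k) (dd (h + c *\<^sub>R k) F) p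
    = dd h (dd h F) p + c * (dd h (dd k F) p + dd k (dd h F) p) + c^2 * dd k (dd k F) p"
proof -
  have lin: "dd (h + c *\<^sub>R k) f q = dd h f q + c * dd k f q" if "smooth_on S f" "q \<in> S" for f :: "'a \<Rightarrow> real" and q
    using linear_add[OF linear_dd[OF smooth_on_differentiable[OF that]]] linear_scale[OF linear_dd[OF smooth_on_differentiable[OF that]]]
    by simp
  note d = smooth_on_dd[OF assms(2)]
  have "dd (h + c *\<^sub>R k) (dd (h + c *\<^sub>R k) F) p = dd (h + c *\<^sub>R k) (\<lambda>q. dd h F q + c * dd k F q) p"
    by (rule dd_cong[OF assms(1) lin[OF assms(2)] assms(3) smooth_on_differentiable[OF d assms(3)]])
  also have "\<dots> = dd (h + c *\<^sub>R k) (dd h F) p + c * dd (h + c *\<^sub>R k) (dd k F) p"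
    by (rule dd_eqI[OF has_derivative_add[OF smooth_onD[OF d assms(3)] has_derivative_mult_right[OF smooth_onD[OF d assms(3)]]]])
  finally show ?thesis unfolding lin[OF d assms(3)] by (simp add: algebra_simps power2_eq_square)
qed

abbreviation "eT \<equiv> (1,0,0,0) :: total"
abbreviation "eX \<equiv> (0,1,0,0) :: total"
abbreviation "eY \<equiv> (0,0,1,0) :: total"
abbreviation "eU \<equiv> (0,0,0,1) :: total"

lemma
  fixes F :: "total \<Rightarrow> real"
  assumes "smooth_on S F" "(t, x, y, u) \<in> S"
  shows deriv4_t: "((\<lambda>s. F (s, x, y, u)) has_real_derivative dd eT F (t, x, y, u)) (at t)"
    and deriv4_x: "((\<lambda>s. F (t, s, y, u)) has_real_derivative dd eX F (t, x, y, u)) (at x)"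
    and deriv4_y: "((\<lambda>s. F (t, x, s, u)) has_real_derivative dd eY F (t, x, y, u)) (at y)"
    and deriv4_u: "((\<lambda>s. F (t, x, y, s)) has_real_derivative dd eU F (t, x, y, u)) (at u)"
  using line_deriv[OF assms, of t eT] line_deriv[OF assms, of x eX]
    line_deriv[OF assms, of y eY] line_deriv[OF assms, of u eU] by simp_all

lemma deriv_eq_on_open:
  fixes f g :: "real \<Rightarrow> real"
  assumes "(f has_real_derivative a) (at s)" "(g has_real_derivative b) (at s)" "open N" "s \<in> N" "\<And>r. r \<in> N \<Longrightarrow> f r = g r"
  shows "a = b"
  using DERIV_unique[OF has_field_derivative_transform_within_open[OF assms(1,3,4,5)] assms(2)] by simp

lemma constant_on_convex:
  fixes f :: "real \<Rightarrow> real"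
  assumes "convex N" "\<And>s. s \<in> N \<Longrightarrow> (f has_real_derivative 0) (at s)" "r \<in> N" "s \<in> N"
  shows "f r = f s"
proof -
  have "\<exists>c. \<forall>s\<in>N. f s = c"
    by (rule has_field_derivative_zero_constant[OF assms(1)]) (use assms(2) has_field_derivative_at_within in blast)
  then show ?thesis using assms(3,4) by auto
qed

abbreviation "box3 t x y \<delta> \<equiv> ball (t :: real) \<delta> \<times> ball (x :: real) \<delta> \<times> ball (y :: real) \<delta>"
abbreviation "box4 t x y u \<delta> \<equiv> ball (t :: real) \<delta> \<times> ball (x :: real) \<delta> \<times> ball (y :: real) \<delta> \<times> ball (u :: real) \<delta>"

lemma open_total_box:
  fixes U :: "total set"
  assumes "open U" "(t, x, y, u) \<in> U"
  obtains \<delta> where "\<delta> > 0" "box4 t x y u \<delta> \<subseteq> U"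
proof -
  obtain A B C D where o: "open A" "open B" "open C" "open D" "t \<in> A" "x \<in> B" "y \<in> C" "u \<in> D" "A \<times> B \<times> C \<times> D \<subseteq> U"
  proof -
    obtain A R where 1: "open A" "open R" "(t, x, y, u) \<in> A \<times> R" "A \<times> R \<subseteq> U"
      using open_prod_elim[OF assms] by metis
    then have "(x, y, u) \<in> R" by simp
    then obtain B R' where 2: "open B" "open R'" "(x, y, u) \<in> B \<times> R'" "B \<times> R' \<subseteq> R"
      using open_prod_elim[OF 1(2)] by metis
    then have "(y, u) \<in> R'" by simp
    then obtain C D where 3: "open C" "open D" "(y, u) \<in> C \<times> D" "C \<times> D \<subseteq> R'"
      using open_prod_elim[OF 2(2)] by metis
    have "A \<times> B \<times> C \<times> D \<subseteq> U" using 1(4) 2(4) 3(4) by blast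
    then show ?thesis using that 1 2 3 by auto
  qed
  obtain a b c d where e: "a > 0" "b > 0" "c > 0" "d > 0" "ball t a \<subseteq> A" "ball x b \<subseteq> B" "ball y c \<subseteq> C" "ball u d \<subseteq> D"
    using o(1-8) open_contains_ball by metis
  define \<delta> where "\<delta> = min (min a b) (min c d)"
  have "ball t \<delta> \<subseteq> ball t a" "ball x \<delta> \<subseteq> ball x b" "ball y \<delta> \<subseteq> ball y c" "ball u \<delta> \<subseteq> ball u d" "\<delta> > 0"
    using e(1-4) by (auto simp: \<delta>_def)
  then show ?thesis using that[of \<delta>] e(5-8) o(9) by blast
qed

text \<open>The condition with \<open>X p\<close> on the left says that the transport field
  \<open>\<partial>_t + x \<partial>_y\<close> fixes \<open>X\<close> as the quotient of its
  derivatives of \<open>Y\<close> and \<open>T\<close>. The last condition becomes the parabolic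
  scaling \<open>T_t = X_x^2\<close> once \<open>T_y = 0\<close> is known.\<close>

abbreviation base_structure :: "(total \<Rightarrow> real) \<Rightarrow> (total \<Rightarrow> real) \<Rightarrow> (total \<Rightarrow> real) \<Rightarrow> real \<Rightarrow> total \<Rightarrow> bool" where
  "base_structure T X Y x p \<equiv>
     dd eX T p = 0 \<and> dd eU T p = 0 \<and> dd eX Y p = 0 \<and> dd eU Y p = 0 \<and> dd eU X p = 0 \<and> dd eX X p \<noteq> 0 \<and>
     dd eT T p * dd eY Y p - dd eY T p * dd eT Y p \<noteq> 0 \<and>
     X p * (dd eT T p + x * dd eY T p) = dd eT Y p + x * dd eY Y p \<and>
     (dd eY Y p - X p * dd eY T p) * (dd eX X p)^2 = dd eT T p * dd eY Y p - dd eY T p * dd eT Y p"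

text \<open>Here \<open>c\<close> is the slope \<open>u_x\<close> of the test solution. It stays
  universally quantified because the relations will be read as identities between polynomials in
  \<open>c\<close>; the multipliers depend on it.\<close>

lemma component_structure:
  fixes \<Phi> :: "total \<Rightarrow> total"
  assumes sym: "point_transformation U \<Phi>" "maps_equation_to_itself U \<Phi>"
  defines "T \<equiv> \<lambda>p. fst (\<Phi> p)" and "X \<equiv> \<lambda>p. fst (snd (\<Phi> p))" and "Y \<equiv> \<lambda>p. fst (snd (snd (\<Phi> p)))"
    and "W \<equiv> \<lambda>p. snd (snd (snd (\<Phi> p)))"
  shows "smooth_on U T" "smooth_on U X" "smooth_on U Y" "smooth_on U W"
    and "\<And>t x y u p. (t, x, y, u) \<in> U \<Longrightarrow> p = (t, x, y, u) \<Longrightarrow>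
      base_structure T X Y x p \<and> dd eU W p \<noteq> 0 \<and>
      (\<forall>c. \<exists>\<omega>T \<omega>X \<omega>Y. \<omega>X * dd eX X p = dd eX W p + c * dd eU W p \<and>
         \<omega>T * dd eT T p + \<omega>X * dd eT X p + \<omega>Y * dd eT Y p = dd eT W p \<and>
         \<omega>T * dd eY T p + \<omega>X * dd eY X p + \<omega>Y * dd eY Y p = dd eY W p \<and>
         (\<omega>T + X p * \<omega>Y) * (dd eX X p)^2 = dd (eX + c *\<^sub>R eU) (dd (eX + c *\<^sub>R eU) W) p - \<omega>X * dd (eX + c *\<^sub>R eU) (dd (eX + c *\<^sub>R eU) X) p)"
proof -
  note U = point_transformation_smooth[OF sym(1)]
  have bl: "bounded_linear (\<lambda>q::total. fst q)" "bounded_linear (\<lambda>q::total. fst (snd q))"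
    "bounded_linear (\<lambda>q::total. fst (snd (snd q)))" "bounded_linear (\<lambda>q::total. snd (snd (snd q)))"
    by (intro bounded_linear_fst bounded_linear_snd bounded_linear_compose[OF bounded_linear_fst]
        bounded_linear_compose[OF bounded_linear_snd])+
  show "smooth_on U T" "smooth_on U X" "smooth_on U Y" "smooth_on U W"
    unfolding T_def X_def Y_def W_def by (rule smooth_on_bounded_linear[OF _ U], rule bl)+
  fix t x y u p assume p: "(t, x, y, u) \<in> U" "p = (t, x, y, u)"
  have p': "p \<in> U" using p by simp
  obtain Tt Xt Yt Wt Xx Wx Ty Xy Yy Wy Wu where
    jac: "\<And>a b c d. dd (a, b, c, d) \<Phi> p = (a*Tt + c*Ty, a*Xt + b*Xx + c*Xy, a*Yt + c*Yy, a*Wt + b*Wx + c*Wy + d*Wu)"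
    and ps: "Tt * Yy - Ty * Yt \<noteq> 0" "Xx \<noteq> 0" "Wu \<noteq> 0"
    "fst (snd (\<Phi> p)) * (Tt + x * Ty) = Yt + x * Yy"
    "(Yy - fst (snd (\<Phi> p)) * Ty) * Xx^2 = Tt * Yy - Ty * Yt"
    "\<forall>c. \<exists>\<omega>T \<omega>X \<omega>Y. \<omega>X * Xx = Wx + c * Wu \<and> \<omega>T * Tt + \<omega>X * Xt + \<omega>Y * Yt = Wt \<and> \<omega>T * Ty + \<omega>X * Xy + \<omega>Y * Yy = Wy \<and>
       (\<omega>T + fst (snd (\<Phi> p)) * \<omega>Y) * Xx^2
         = snd (snd (snd (dd (0,1,0,c) (dd (0,1,0,c) \<Phi>) p))) - \<omega>X * fst (snd (dd (0,1,0,c) (dd (0,1,0,c) \<Phi>) p))"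
    by (rule point_structure[OF sym p(2) p']) (rule that; (assumption | blast))
  note d = dd_bounded_linear[OF bl(1) U(2) p', folded T_def] dd_bounded_linear[OF bl(2) U(2) p', folded X_def]
    dd_bounded_linear[OF bl(3) U(2) p', folded Y_def] dd_bounded_linear[OF bl(4) U(2) p', folded W_def]
  note d2 = dd_dd_bounded_linear[OF bl(2) U p', folded X_def] dd_dd_bounded_linear[OF bl(4) U p', folded W_def]
  have c: "eX + c *\<^sub>R eU = (0,1,0,c)" for c by simp
  show "base_structure T X Y x p \<and> dd eU W p \<noteq> 0 \<and>
      (\<forall>c. \<exists>\<omega>T \<omega>X \<omega>Y. \<omega>X * dd eX X p = dd eX W p + c * dd eU W p \<and>
         \<omega>T * dd eT T p + \<omega>X * dd eT X p + \<omega>Y * dd eT Y p = dd eT W p \<and>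
         \<omega>T * dd eY T p + \<omega>X * dd eY X p + \<omega>Y * dd eY Y p = dd eY W p \<and>
         (\<omega>T + X p * \<omega>Y) * (dd eX X p)^2 = dd (eX + c *\<^sub>R eU) (dd (eX + c *\<^sub>R eU) W) p - \<omega>X * dd (eX + c *\<^sub>R eU) (dd (eX + c *\<^sub>R eU) X) p)"
    unfolding c d2 unfolding d jac fst_conv snd_conv
    using ps by (simp add: X_def)
qed

section \<open>Normal form of the new t, x and y\<close>

lemma smooth_real_deriv:
  fixes f :: "real \<Rightarrow> real"
  assumes "smooth_on S f" "t \<in> S"
  shows "(f has_real_derivative dd 1 f t) (at t)"
  using dd_chain[of S f "\<lambda>s. s" t 1, OF assms] by (simp add: has_real_derivative_iff_has_vector_derivative)

lemma power5_inj:
  fixes a b c :: real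
  assumes "a ^ 5 = c^2" "b ^ 5 = c^2" "c \<noteq> 0"
  shows "a = b"
proof -
  have "a ^ 5 > 0" "b ^ 5 > 0" using assms by simp_all
  then have "a > 0" "b > 0" by (simp_all add: zero_less_power_eq)
  moreover have "a ^ 5 = b ^ 5" using assms by simp
  ultimately show ?thesis by (metis less_eq_real_def power_eq_imp_eq_base zero_less_numeral)
qed

text \<open>For fixed \<open>t\<close> and \<open>y\<close> the transport relation makes
  \<open>X\<close> fractional linear in \<open>x\<close>, and the scaling relation then forces its
  denominator to be constant, so \<open>T\<close> depends on \<open>t\<close> alone. From
  \<open>X_x^2 = T_t\<close> the \<open>x\<close>-scaling \<open>m\<close> is a function of
  \<open>t\<close>, which gives \<open>Y_y = m^3\<close>, and the transport relation returns
  \<open>X\<close> from \<open>Y\<close>. A box is used because independence of a variable follows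
  from a vanishing derivative on an interval.\<close>

lemma base_normal_form:
  fixes T X Y :: "total \<Rightarrow> real" and t0 x0 y0 u0 \<delta> :: real
  defines "I \<equiv> ball t0 \<delta>" and "J \<equiv> ball x0 \<delta>" and "K \<equiv> ball y0 \<delta>" and "L \<equiv> ball u0 \<delta>"
  defines "B \<equiv> I \<times> J \<times> K \<times> L"
  assumes \<delta>: "\<delta> > 0" and sm: "smooth_on B T" "smooth_on B X" "smooth_on B Y"
    and str: "\<And>t x y u p. (t, x, y, u) \<in> B \<Longrightarrow> p = (t, x, y, u) \<Longrightarrow>
      base_structure T X Y x p"
  obtains \<tau> m k where "smooth_on I \<tau>" "smooth_on I m" "smooth_on I k"
    "\<And>t. t \<in> I \<Longrightarrow> m t \<noteq> 0" "\<And>t. t \<in> I \<Longrightarrow> dd 1 \<tau> t = (m t)^2"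
    "\<And>t x y u. (t, x, y, u) \<in> B \<Longrightarrow> T (t, x, y, u) = \<tau> t \<and> Y (t, x, y, u) = (m t)^3 * y + k t
       \<and> X (t, x, y, u) = m t * x + 3 * dd 1 m t * y + dd 1 k t / (m t)^2"
    "\<And>t x y u p. (t, x, y, u) \<in> B \<Longrightarrow> p = (t, x, y, u) \<Longrightarrow> dd eY T p = 0 \<and> dd eX X p = m t \<and> dd eY Y p = (m t)^3 \<and> dd eT T p = (m t)^2"
proof -
  have oB: "open B" by (simp add: B_def I_def J_def K_def L_def open_Times)
  have c0: "t0 \<in> I" "x0 \<in> J" "y0 \<in> K" "u0 \<in> L" using \<delta> by (auto simp: I_def J_def K_def L_def)
  have op: "open I" "open J" "open K" "open L" by (auto simp: I_def J_def K_def L_def)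
  have cv: "convex I" "convex J" "convex K" "convex L" by (auto simp: I_def J_def K_def L_def)
  have mem: "(t, x, y, u) \<in> B \<longleftrightarrow> t \<in> I \<and> x \<in> J \<and> y \<in> K \<and> u \<in> L" for t x y u by (simp add: B_def)
  have const: "(\<And>p. p \<in> B \<Longrightarrow> dd eX F p = 0) \<Longrightarrow> x' \<in> J \<Longrightarrow> F (t, x, y, u) = F (t, x', y, u)"
    "(\<And>p. p \<in> B \<Longrightarrow> dd eY F p = 0) \<Longrightarrow> y' \<in> K \<Longrightarrow> F (t, x, y, u) = F (t, x, y', u)"
    "(\<And>p. p \<in> B \<Longrightarrow> dd eU F p = 0) \<Longrightarrow> u' \<in> L \<Longrightarrow> F (t, x, y, u) = F (t, x, y, u')"
    if F: "smooth_on B F" and B: "(t, x, y, u) \<in> B" for F :: "total \<Rightarrow> real" and t x y u x' y' u'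
  proof -
    have m: "t \<in> I" "x \<in> J" "y \<in> K" "u \<in> L" using B by (auto simp: mem)
    show "F (t, x, y, u) = F (t, x', y, u)" if d: "\<And>p. p \<in> B \<Longrightarrow> dd eX F p = 0" and "x' \<in> J"
    proof (rule constant_on_convex[OF cv(2) _ m(2) \<open>x' \<in> J\<close>])
      show "((\<lambda>s. F (t, s, y, u)) has_real_derivative 0) (at s)" if "s \<in> J" for s
        using deriv4_x[OF F, of t s y u] d[of "(t, s, y, u)"] that m by (simp add: mem)
    qed
    show "F (t, x, y, u) = F (t, x, y', u)" if d: "\<And>p. p \<in> B \<Longrightarrow> dd eY F p = 0" and "y' \<in> K"
    proof (rule constant_on_convex[OF cv(3) _ m(3) \<open>y' \<in> K\<close>])
      show "((\<lambda>s. F (t, x, s, u)) has_real_derivative 0) (at s)" if "s \<in> K" for s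
        using deriv4_y[OF F, of t x s u] d[of "(t, x, s, u)"] that m by (simp add: mem)
    qed
    show "F (t, x, y, u) = F (t, x, y, u')" if d: "\<And>p. p \<in> B \<Longrightarrow> dd eU F p = 0" and "u' \<in> L"
    proof (rule constant_on_convex[OF cv(4) _ m(4) \<open>u' \<in> L\<close>])
      show "((\<lambda>s. F (t, x, y, s)) has_real_derivative 0) (at s)" if "s \<in> L" for s
        using deriv4_u[OF F, of t x y s] d[of "(t, x, y, s)"] that m by (simp add: mem)
    qed
  qed
  have indep: "F (t, x, y, u) = F (t, x', y, u')"
    if F: "smooth_on B F" "\<And>p. p \<in> B \<Longrightarrow> dd eX F p = 0" "\<And>p. p \<in> B \<Longrightarrow> dd eU F p = 0"
      and B: "(t, x, y, u) \<in> B" "x' \<in> J" "u' \<in> L" for F :: "total \<Rightarrow> real" and t x y u x' u'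
  proof -
    have "(t, x', y, u) \<in> B" using B by (auto simp: mem)
    then show ?thesis
      using const(1)[OF F(1) B(1) F(2) B(2)] const(3)[OF F(1) _ F(3) B(3)] by metis
  qed
  have str0: "dd eX T p = 0" "dd eU T p = 0" "dd eX Y p = 0" "dd eU Y p = 0" if "p \<in> B" for p
    using str that by (cases p, simp)+
  have indepT: "T (t, x, y, u) = T (t, x', y, u')" and indepY: "Y (t, x, y, u) = Y (t, x', y, u')"
    if "(t, x, y, u) \<in> B" "x' \<in> J" "u' \<in> L" for t x y u x' u'
    using indep[OF sm(1) str0(1,2) that] indep[OF sm(3) str0(3,4) that] by auto
  have dindep: "dd eT F (t, x, y, u) = dd eT F (t, x', y, u')" "dd eY F (t, x, y, u) = dd eY F (t, x', y, u')"
    if F: "smooth_on B F" "\<And>t x y u x' u'. (t, x, y, u) \<in> B \<Longrightarrow> x' \<in> J \<Longrightarrow> u' \<in> L \<Longrightarrow> F (t, x, y, u) = F (t, x', y, u')"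
      and B: "(t, x, y, u) \<in> B" "x' \<in> J" "u' \<in> L" for F :: "total \<Rightarrow> real" and t x y u x' u'
  proof -
    have B': "(t, x', y, u') \<in> B" using B by (auto simp: mem)
    show "dd eT F (t, x, y, u) = dd eT F (t, x', y, u')"
      by (rule deriv_eq_on_open[OF deriv4_t[OF F(1) B(1)] deriv4_t[OF F(1) B'] op(1)]) (use B in \<open>simp add: mem\<close>, rule F(2), use B in \<open>simp_all add: mem\<close>)
    show "dd eY F (t, x, y, u) = dd eY F (t, x', y, u')"
      by (rule deriv_eq_on_open[OF deriv4_y[OF F(1) B(1)] deriv4_y[OF F(1) B'] op(3)]) (use B in \<open>simp add: mem\<close>, rule F(2), use B in \<open>simp_all add: mem\<close>)
  qed
  have main: "dd eY T (t, x, y, u) = 0 \<and> dd eX X (t, x, y, u) * dd eT T (t, x, y, u) = dd eY Y (t, x, y, u)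
     \<and> (dd eX X (t, x, y, u))^2 = dd eT T (t, x, y, u)" if B: "(t, x, y, u) \<in> B" for t x y u
  proof -
    define \<alpha> where "\<alpha> = dd eT T (t, x, y, u)"
    define \<beta> where "\<beta> = dd eY T (t, x, y, u)"
    define a where "a = dd eT Y (t, x, y, u)"
    define b where "b = dd eY Y (t, x, y, u)"
    define \<Delta> where "\<Delta> = \<alpha> * b - \<beta> * a"
    have at: "dd eT T (t, s, y, u) = \<alpha>" "dd eY T (t, s, y, u) = \<beta>" "dd eT Y (t, s, y, u) = a" "dd eY Y (t, s, y, u) = b"
      if "s \<in> J" for s
      using dindep[OF sm(1) indepT B that, of u] dindep[OF sm(3) indepY B that, of u] B
      by (simp_all add: \<alpha>_def \<beta>_def a_def b_def mem)
    have pt: "\<Delta> \<noteq> 0" "X (t, s, y, u) * (\<alpha> + s * \<beta>) = a + s * b"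
      "(b - X (t, s, y, u) * \<beta>) * (dd eX X (t, s, y, u))^2 = \<Delta>" if "s \<in> J" for s
      using str[of t s y u, OF _ refl] that B unfolding at[OF that] mem \<Delta>_def by auto
    have D: "\<alpha> + s * \<beta> \<noteq> 0" if "s \<in> J" for s
    proof
      assume 0: "\<alpha> + s * \<beta> = 0"
      then have "a + s * b = 0" using pt(2)[OF that] by simp
      then have "\<Delta> = 0" using 0 unfolding \<Delta>_def by algebra
      then show False using pt(1)[OF that] by simp
    qed
    \<comment> \<open>The coefficients do not change with \<open>s\<close>, since the derivatives of
      \<open>T\<close> and \<open>Y\<close> are independent of \<open>x\<close>;
      \<open>\<Delta>\<close> is the determinant of this fractional linear map and its derivative is
      \<open>\<Delta>\<close> over the squared denominator.\<close>
    have X: "X (t, s, y, u) = (a + s * b) / (\<alpha> + s * \<beta>)" if "s \<in> J" for s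
      using pt(2)[OF that] D[OF that] by (simp add: eq_divide_eq)
    have Xx: "dd eX X (t, s, y, u) = \<Delta> / (\<alpha> + s * \<beta>)^2" if s: "s \<in> J" for s
    proof (rule deriv_eq_on_open[OF deriv4_x[OF sm(2)] _ op(2) s])
      show "(t, s, y, u) \<in> B" using B s by (simp add: mem)
      show "((\<lambda>s. (a + s * b) / (\<alpha> + s * \<beta>)) has_real_derivative \<Delta> / (\<alpha> + s * \<beta>)^2) (at s)"
        using D[OF s] by (auto intro!: derivative_eq_intros simp: \<Delta>_def power2_eq_square field_simps)
    qed (use X in auto)
    \<comment> \<open>In the scaling relation one power of the denominator comes from
      \<open>Y_y - X T_y\<close> and four from \<open>X_x^2\<close>; this is the origin of the
      exponent 5.\<close>
    have pow: "(\<alpha> + s * \<beta>)^5 = \<Delta>^2" if s: "s \<in> J" for s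
    proof -
      have "b - X (t, s, y, u) * \<beta> = \<Delta> / (\<alpha> + s * \<beta>)" unfolding X[OF s] \<Delta>_def using D[OF s] by (simp add: field_simps)
      then have "\<Delta> / (\<alpha> + s * \<beta>) * (\<Delta> / (\<alpha> + s * \<beta>)^2)^2 = \<Delta>" using pt(3)[OF s] Xx[OF s] by simp
      moreover have "r / d * (r / d^2)^2 = r^3 / d^5" for r d :: real
        by (simp add: power_divide power2_eq_square eval_nat_numeral)
      ultimately have "\<Delta>^3 / (\<alpha> + s * \<beta>)^5 = \<Delta>" by metis
      moreover have "(\<alpha> + s * \<beta>)^5 \<noteq> 0" using D[OF s] by simp
      ultimately have "\<Delta>^3 = \<Delta> * (\<alpha> + s * \<beta>)^5" by (simp only: divide_eq_eq if_True not_False_eq_True)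
      then show ?thesis using pt(1)[OF s] by (simp add: power3_eq_cube power2_eq_square)
    qed
    \<comment> \<open>The fifth power has the same value at two distinct points, so the affine
      function \<open>\<alpha> + s * \<beta>\<close> has slope zero.\<close>
    have "x0 + \<delta>/2 \<in> J" using \<delta> by (simp add: J_def dist_real_def)
    then have "\<alpha> + (x0 + \<delta>/2) * \<beta> = \<alpha> + x0 * \<beta>"
      using power5_inj[OF pow pow pt(1)] c0 by blast
    then have \<beta>: "\<beta> = 0" using \<delta> by simp
    have x: "x \<in> J" using B by (simp add: mem)
    have \<alpha>: "\<alpha> \<noteq> 0" using D[OF x] \<beta> by simp
    have "dd eX X (t, x, y, u) = b / \<alpha>" using Xx[OF x] \<alpha> by (simp add: \<beta> \<Delta>_def power2_eq_square)
    moreover have "b^2 = \<alpha>^3"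
    proof -
      have "\<alpha>^5 = \<alpha>^2 * b^2" using pow[OF x] by (simp add: \<beta> \<Delta>_def power_mult_distrib)
      then have "\<alpha>^2 * (b^2 - \<alpha>^3) = 0" by algebra
      then show ?thesis using \<alpha> by simp
    qed
    ultimately show ?thesis using \<beta> \<alpha> unfolding \<alpha>_def[symmetric] \<beta>_def[symmetric] b_def[symmetric]
      by (simp add: power_divide power2_eq_square power3_eq_cube)
  qed
  have ng: "open I" "smooth_on I (\<lambda>t. (t, x0, y0, u0))" "t \<in> I \<Longrightarrow> (t, x0, y0, u0) \<in> B" for t
    using op c0 by (auto intro!: smooth_on_intros simp: mem)
  define \<tau> where "\<tau> t = T (t, x0, y0, u0)" for t
  define m where "m t = dd eX X (t, x0, y0, u0)" for t
  define k where "k t = Y (t, x0, y0, u0) - (m t)^3 * y0" for t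
  have sm1: "smooth_on I \<tau>" unfolding \<tau>_def[abs_def] by (rule smooth_on_compose[OF op(1) oB sm(1) ng(2,3)])
  have sm2: "smooth_on I m" unfolding m_def[abs_def] by (rule smooth_on_compose[OF op(1) oB smooth_on_dd[OF sm(2)] ng(2,3)])
  have "smooth_on I (\<lambda>t. Y (t, x0, y0, u0))" by (rule smooth_on_compose[OF op(1) oB sm(3) ng(2,3)])
  then have sm3: "smooth_on I k" unfolding k_def[abs_def] by (intro smooth_on_intros op sm2)
  have T: "T (t, x, y, u) = \<tau> t" if B: "(t, x, y, u) \<in> B" for t x y u
  proof -
    have "T (t, x, y, u) = T (t, x, y0, u)"
      by (rule const(2)[OF sm(1) B _ c0(3)]) (use main in auto)
    also have "\<dots> = \<tau> t" unfolding \<tau>_def by (rule indepT) (use B c0 in \<open>auto simp: mem\<close>)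
    finally show ?thesis .
  qed
  have Tt: "dd eT T (t, x, y, u) = dd 1 \<tau> t" if B: "(t, x, y, u) \<in> B" for t x y u
    by (rule deriv_eq_on_open[OF deriv4_t[OF sm(1) B] smooth_real_deriv[OF sm1] op(1)]) (use B T mem in auto)
  have sq: "(dd eX X p)^2 = dd 1 \<tau> (fst p)" "p \<in> B \<Longrightarrow> dd eX X p \<noteq> 0" if "p \<in> B" for p
    using main Tt str that by (cases p; force)+
  \<comment> \<open>The square of \<open>X_x\<close> equals a function of \<open>t\<close> alone.
    Differentiating it in another variable gives \<open>2 X_x\<close> times the derivative of
    \<open>X_x\<close>, and \<open>X_x\<close> does not vanish; no choice of sign of the root is
    involved.\<close>
  have Xx0: "dd h (dd eX X) (t, x, y, u) = 0" if B: "(t, x, y, u) \<in> B" and h: "h \<in> {eX, eY, eU}" for h t x y u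
  proof -
    have "dd h (\<lambda>p. dd eX X p * dd eX X p - dd 1 \<tau> (fst p)) (t, x, y, u) = 0"
    proof (rule dd_zero_cong[OF oB _ B])
      have "smooth_on B (\<lambda>p. dd 1 \<tau> (fst p))"
        by (rule smooth_on_compose[OF oB op(1) smooth_on_dd[OF sm1]]) (auto intro!: smooth_on_intros oB simp: mem)
      then show "smooth_on B (\<lambda>p. dd eX X p * dd eX X p - dd 1 \<tau> (fst p))"
        by (intro smooth_on_intros oB smooth_on_dd[OF sm(2)])
    qed (use sq in \<open>auto simp: power2_eq_square\<close>)
    moreover have "((\<lambda>p. dd eX X p * dd eX X p - dd 1 \<tau> (fst p)) has_derivative
      (\<lambda>h. dd eX X (t, x, y, u) * dd h (dd eX X) (t, x, y, u) + dd h (dd eX X) (t, x, y, u) * dd eX X (t, x, y, u) - dd (fst h) (dd 1 \<tau>) t)) (at (t, x, y, u))"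
      using B by (intro has_derivative_diff has_derivative_mult smooth_onD[OF smooth_on_dd[OF sm(2)] B]
          has_derivative_compose[OF has_derivative_fst[OF has_derivative_ident], of "dd 1 \<tau>", simplified]
          ) (use smooth_onD[OF smooth_on_dd[OF sm1, of 1], of t] in \<open>auto simp: mem\<close>)
    moreover have "dd 0 (dd 1 \<tau>) t = 0"
      using linear_0[OF linear_dd[OF smooth_on_differentiable[OF smooth_on_dd[OF sm1]]]] B mem by blast
    ultimately have "2 * dd eX X (t, x, y, u) * dd h (dd eX X) (t, x, y, u) = 0"
      using h by (auto dest: dd_eqI[where v=h])
    then show ?thesis using sq(2)[OF B B] by simp
  qed
  have Xx: "dd eX X (t, x, y, u) = m t" if B: "(t, x, y, u) \<in> B" for t x y u
  proof -
    have "dd eX X (t, x, y, u) = dd eX X (t, x, y0, u)"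
      by (rule const(2)[OF smooth_on_dd[OF sm(2)] B _ c0(3)]) (use Xx0 in auto)
    also have "\<dots> = m t" unfolding m_def
      by (rule indep[OF smooth_on_dd[OF sm(2)]]) (use Xx0 B c0 mem in auto)
    finally show ?thesis .
  qed
  have m0: "m t \<noteq> 0" "dd 1 \<tau> t = (m t)^2" if "t \<in> I" for t
    using sq[of "(t, x0, y0, u0)"] Xx[of t x0 y0 u0] that c0 mem by auto
  have Yy: "dd eY Y (t, x, y, u) = (m t)^3" if B: "(t, x, y, u) \<in> B" for t x y u
    using main[OF B] unfolding Xx[OF B] Tt[OF B] by (metis power2_eq_square power3_eq_cube mult.assoc)
  have Y: "Y (t, x, y, u) = (m t)^3 * y + k t" if B: "(t, x, y, u) \<in> B" for t x y u
  proof -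
    have "Y (t, x, y, u) - (m t)^3 * y = Y (t, x, y0, u) - (m t)^3 * y0"
    proof (rule constant_on_convex[OF cv(3), where f="\<lambda>s. Y (t, x, s, u) - (m t)^3 * s"])
      show "((\<lambda>s. Y (t, x, s, u) - (m t)^3 * s) has_real_derivative 0) (at s)" if "s \<in> K" for s
        using B that by (auto intro!: derivative_eq_intros deriv4_y[OF sm(3)] simp: Yy mem)
    qed (use B c0 mem in auto)
    moreover have "Y (t, x, y0, u) = Y (t, x0, y0, u0)" by (rule indepY) (use B c0 mem in auto)
    ultimately show ?thesis by (simp add: k_def)
  qed
  have Yt: "dd eT Y (t, x, y, u) = 3 * (m t)^2 * dd 1 m t * y + dd 1 k t" if B: "(t, x, y, u) \<in> B" for t x y u
  proof (rule deriv_eq_on_open[OF deriv4_t[OF sm(3) B] _ op(1)])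
    show "((\<lambda>t. (m t)^3 * y + k t) has_real_derivative 3 * (m t)^2 * dd 1 m t * y + dd 1 k t) (at t)"
      using B mem by (auto intro!: derivative_eq_intros smooth_real_deriv[OF sm2] smooth_real_deriv[OF sm3])
  qed (use B Y mem in auto)
  have X: "X (t, x, y, u) = m t * x + 3 * dd 1 m t * y + dd 1 k t / (m t)^2" if B: "(t, x, y, u) \<in> B" for t x y u
  proof -
    have t: "t \<in> I" using B mem by auto
    \<comment> \<open>The transport relation, with \<open>T_t = m^2\<close> and the known
      derivatives of \<open>Y\<close>, determines \<open>X\<close> completely.\<close>
    have "X (t, x, y, u) * (m t)^2 = 3 * (m t)^2 * dd 1 m t * y + dd 1 k t + x * (m t)^3"
      using str[OF B refl] main[OF B] unfolding Tt[OF B] Yy[OF B] Yt[OF B] m0(2)[OF t] by auto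
    then show ?thesis using m0(1)[OF t] by (simp add: field_simps power2_eq_square power3_eq_cube)
  qed
  show ?thesis
    by (rule that[OF sm1 sm2 sm3 m0]) (use T X Y Xx Yy Tt m0 main mem in auto)
qed

section \<open>The new u is affine in u\<close>

text \<open>\<open>E\<close> is a quadratic identity in the slope \<open>c\<close>. Its leading
  coefficient makes \<open>W\<close> affine in \<open>u\<close>, say \<open>C + A (u - u0)\<close>;
  the linear coefficient is the first gauge condition on \<open>A\<close>; the constant term, affine
  in \<open>u\<close> itself, splits into the second gauge condition and the drift equation for
  \<open>C\<close>. Hence \<open>C / A\<close> satisfies the drift-free equation, and
  \<open>f\<close> is \<open>C / A - u0\<close>.\<close>

lemma fibre_equations:
  fixes W :: "total \<Rightarrow> real" and t0 x0 y0 u0 \<delta> :: real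
  defines "B \<equiv> box4 t0 x0 y0 u0 \<delta>"
    and "D \<equiv> box3 t0 x0 y0 \<delta>"
  assumes \<delta>: "\<delta> > 0" and sm: "smooth_on B W" and nz: "\<And>p. p \<in> B \<Longrightarrow> dd eU W p \<noteq> 0"
    and E: "\<And>t x y u c p. (t, x, y, u) \<in> B \<Longrightarrow> p = (t, x, y, u) \<Longrightarrow>
      dd eT W p + x * dd eY W p - \<xi> (t, x, y) * (dd eX W p + c * dd eU W p) = dd (eX + c *\<^sub>R eU) (dd (eX + c *\<^sub>R eU) W) p"
  obtains A f where "smooth_on D A" "solution D f" "\<And>z. z \<in> D \<Longrightarrow> A z \<noteq> 0"
    "\<And>t x y u. (t, x, y, u) \<in> B \<Longrightarrow> W (t, x, y, u) = A (t, x, y) * (u + f (t, x, y))"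
    "\<And>z. z \<in> D \<Longrightarrow> 2 * Dx A z = - \<xi> z * A z"
    "\<And>z. z \<in> D \<Longrightarrow> Dt A z + fst (snd z) * Dy A z - \<xi> z * Dx A z = Dx (Dx A) z"
proof -
  have oB: "open B" and oD: "open D" by (auto simp: B_def D_def open_Times)
  have mem: "(t, x, y, u) \<in> B \<longleftrightarrow> (t, x, y) \<in> D \<and> u \<in> ball u0 \<delta>" for t x y u by (auto simp: B_def D_def)
  have op: "open (ball t0 \<delta>)" "open (ball x0 \<delta>)" "open (ball y0 \<delta>)" "open (ball u0 \<delta>)" by auto
  have u0: "u0 \<in> ball u0 \<delta>" using \<delta> by simp
  have E': "dd eT W p + x * dd eY W p - \<xi> (t, x, y) * (dd eX W p + c * dd eU W p)
     = dd eX (dd eX W) p + c * (dd eX (dd eU W) p + dd eU (dd eX W) p) + c^2 * dd eU (dd eU W) p"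
    if "(t, x, y, u) \<in> B" "p = (t, x, y, u)" for t x y u p c
    using E[OF that, of c] dd_dd_line[OF oB sm, of p eX c eU] that by simp
  \<comment> \<open>The slopes 0, 1 and -1 separate the three coefficients.\<close>
  have Wuu: "dd eU (dd eU W) p = 0" and cross: "dd eX (dd eU W) p + dd eU (dd eX W) p = - \<xi> (t, x, y) * dd eU W p"
    if "(t, x, y, u) \<in> B" "p = (t, x, y, u)" for t x y u p
    using E'[OF that, of 0] E'[OF that, of 1] E'[OF that, of "-1"] by (simp_all add: algebra_simps)
  have li: "smooth_on D (\<lambda>z. lift z u0)" "\<And>z. z \<in> D \<Longrightarrow> lift z u0 \<in> B"
    using u0 by (auto intro!: smooth_on_lift smooth_on_intros oD simp: mem)
  define A where "A z = dd eU W (lift z u0)" for z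
  define C where "C z = W (lift z u0)" for z
  have A: "smooth_on D A" unfolding A_def[abs_def] by (rule smooth_on_compose[OF oD oB smooth_on_dd[OF sm] li])
  have C: "smooth_on D C" unfolding C_def[abs_def] by (rule smooth_on_compose[OF oD oB sm li])
  have A0: "A z \<noteq> 0" if "z \<in> D" for z unfolding A_def by (rule nz[OF li(2)[OF that]])
  have Wu: "dd eU W (t, x, y, u) = A (t, x, y)" if B: "(t, x, y, u) \<in> B" for t x y u
  proof -
    have "(\<lambda>s. dd eU W (t, x, y, s)) u = (\<lambda>s. dd eU W (t, x, y, s)) u0"
    proof (rule constant_on_convex[where f="\<lambda>s. dd eU W (t, x, y, s)" and N="ball u0 \<delta>"])
      show "((\<lambda>s. dd eU W (t, x, y, s)) has_real_derivative 0) (at s)" if "s \<in> ball u0 \<delta>" for s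
        using deriv4_u[OF smooth_on_dd[OF sm, of eU], of t x y s] Wuu[OF _ refl, of t x y s] B that by (simp add: mem)
    qed (use B mem u0 in auto)
    then show ?thesis by (simp add: A_def)
  qed
  have W: "W (t, x, y, u) = C (t, x, y) + A (t, x, y) * (u - u0)" if B: "(t, x, y, u) \<in> B" for t x y u
  proof -
    have "(\<lambda>s. W (t, x, y, s) - A (t, x, y) * s) u = (\<lambda>s. W (t, x, y, s) - A (t, x, y) * s) u0"
    proof (rule constant_on_convex[where f="\<lambda>s. W (t, x, y, s) - A (t, x, y) * s" and N="ball u0 \<delta>"])
      fix s assume "s \<in> ball u0 \<delta>"
      then have s: "(t, x, y, s) \<in> B" using B by (simp add: mem)
      show "((\<lambda>s. W (t, x, y, s) - A (t, x, y) * s) has_real_derivative 0) (at s)"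
        using DERIV_diff[OF deriv4_u[OF sm s] DERIV_cmult[OF DERIV_ident, of "A (t, x, y)"]] Wu[OF s] by simp
    qed (use B mem u0 in auto)
    then show ?thesis by (simp add: C_def algebra_simps)
  qed
  have d1: "dd eT W (t, x, y, u) = Dt C (t, x, y) + Dt A (t, x, y) * (u - u0)"
    "dd eX W (t, x, y, u) = Dx C (t, x, y) + Dx A (t, x, y) * (u - u0)"
    "dd eY W (t, x, y, u) = Dy C (t, x, y) + Dy A (t, x, y) * (u - u0)" if B: "(t, x, y, u) \<in> B" for t x y u
  proof -
    have z: "(t, x, y) \<in> D" using B mem by simp
    show "dd eT W (t, x, y, u) = Dt C (t, x, y) + Dt A (t, x, y) * (u - u0)"
      by (rule deriv_eq_on_open[OF deriv4_t[OF sm B] DERIV_add[OF deriv_t[OF C z] DERIV_cmult_right[OF deriv_t[OF A z], where c="u - u0"]] op(1)])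
         (use B W in \<open>auto simp: B_def\<close>)
    show "dd eX W (t, x, y, u) = Dx C (t, x, y) + Dx A (t, x, y) * (u - u0)"
      by (rule deriv_eq_on_open[OF deriv4_x[OF sm B] DERIV_add[OF deriv_x[OF C z] DERIV_cmult_right[OF deriv_x[OF A z], where c="u - u0"]] op(2)])
         (use B W in \<open>auto simp: B_def\<close>)
    show "dd eY W (t, x, y, u) = Dy C (t, x, y) + Dy A (t, x, y) * (u - u0)"
      by (rule deriv_eq_on_open[OF deriv4_y[OF sm B] DERIV_add[OF deriv_y[OF C z] DERIV_cmult_right[OF deriv_y[OF A z], where c="u - u0"]] op(3)])
         (use B W in \<open>auto simp: B_def\<close>)
  qed
  have d2: "dd eX (dd eX W) (t, x, y, u) = Dx (Dx C) (t, x, y) + Dx (Dx A) (t, x, y) * (u - u0)"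
    "dd eX (dd eU W) (t, x, y, u) = Dx A (t, x, y)"
    "dd eU (dd eX W) (t, x, y, u) = Dx A (t, x, y)" if B: "(t, x, y, u) \<in> B" for t x y u
  proof -
    have z: "(t, x, y) \<in> D" using B mem by simp
    show "dd eX (dd eX W) (t, x, y, u) = Dx (Dx C) (t, x, y) + Dx (Dx A) (t, x, y) * (u - u0)"
      by (rule deriv_eq_on_open[OF deriv4_x[OF smooth_on_dd[OF sm] B]
            DERIV_add[OF deriv_x[OF smooth_on_dd[OF C] z] DERIV_cmult_right[OF deriv_x[OF smooth_on_dd[OF A] z], where c="u - u0"]] op(2)])
         (use B d1 in \<open>auto simp: B_def\<close>)
    show "dd eX (dd eU W) (t, x, y, u) = Dx A (t, x, y)"
      by (rule deriv_eq_on_open[OF deriv4_x[OF smooth_on_dd[OF sm] B] deriv_x[OF A z] op(2)])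
         (use B Wu in \<open>auto simp: B_def\<close>)
    have "((\<lambda>u. Dx C (t, x, y) + Dx A (t, x, y) * (u - u0)) has_real_derivative Dx A (t, x, y)) (at u)"
      by (auto intro!: derivative_eq_intros)
    then show "dd eU (dd eX W) (t, x, y, u) = Dx A (t, x, y)"
      by (rule deriv_eq_on_open[OF deriv4_u[OF smooth_on_dd[OF sm] B] _ op(4)])
         (use B d1 in \<open>auto simp: B_def\<close>)
  qed
  have eqA: "2 * Dx A z = - \<xi> z * A z" if "z \<in> D" for z
  proof (cases z)
    case (fields t x y)
    have B: "(t, x, y, u0) \<in> B" using that u0 fields by (simp add: mem)
    show ?thesis using cross[OF B refl] unfolding d2[OF B] Wu[OF B] fields by simp
  qed
  have eqC: "Dt C z + fst (snd z) * Dy C z - \<xi> z * Dx C z = Dx (Dx C) z"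
    and eqA2: "Dt A z + fst (snd z) * Dy A z - \<xi> z * Dx A z = Dx (Dx A) z" if "z \<in> D" for z
  proof -
    obtain t x y where fields: "z = (t, x, y)" by (cases z)
    have B: "(t, x, y, u0) \<in> B" using that u0 fields by (simp add: mem)
    \<comment> \<open>Subtracting the identities at the heights \<open>u0\<close> and
      \<open>u0 + \<eta>\<close> isolates the coefficient of \<open>u - u0\<close>.\<close>
    define \<eta> where "\<eta> = \<delta> / 2"
    have \<eta>: "\<eta> > 0" "\<eta> < \<delta>" using \<delta> by (auto simp: \<eta>_def)
    have B': "(t, x, y, u0 + \<eta>) \<in> B" using that \<eta> fields by (simp add: mem dist_real_def)
    show 1: "Dt C z + fst (snd z) * Dy C z - \<xi> z * Dx C z = Dx (Dx C) z"
      using E'[OF B refl, of 0] unfolding d1[OF B] d2[OF B] fields by simp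
    have 2: "Dt C z + Dt A z * (\<eta>) + x * (Dy C z + Dy A z * (\<eta>)) - \<xi> z * (Dx C z + Dx A z * (\<eta>))
       = Dx (Dx C) z + Dx (Dx A) z * (\<eta>)"
      using E'[OF B' refl, of 0] unfolding d1[OF B'] d2[OF B'] fields by simp
    have "(\<eta>) * (Dt A z + x * Dy A z - \<xi> z * Dx A z - Dx (Dx A) z) = 0"
      using 1 2 unfolding fields fst_conv snd_conv by (simp add: algebra_simps)
    then show "Dt A z + fst (snd z) * Dy A z - \<xi> z * Dx A z = Dx (Dx A) z"
      using \<eta> by (simp add: fields)
  qed
  \<comment> \<open>The gauge factor \<open>A\<close> takes the drift away from the equation for
    \<open>C = A g\<close>.\<close>
  define g where "g z = C z / A z" for z
  have g: "smooth_on D g" unfolding g_def[abs_def] by (intro smooth_on_divide oD C A A0)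
  have kg: "kolmogorov g z = 0" if z: "z \<in> D" for z
  proof -
    have "A z * kolmogorov g z = 0"
      using gauge_identity[OF oD A g z eqA[OF z] eqA2[OF z], of C] eqC[OF z] A0 by (simp add: g_def)
    then show ?thesis using A0[OF z] by simp
  qed
  have "solution D (\<lambda>z. g z + (- u0))"
    unfolding solution_iff
    by (intro conjI ballI oD smooth_on_add smooth_on_const g)
       (simp only: kolmogorov_add[OF oD g smooth_on_const[OF oD]] kolmogorov_const kg add_0)
  then show ?thesis
  proof (rule that[OF A _ A0])
    show "W (t, x, y, u) = A (t, x, y) * (u + (g (t, x, y) + (- u0)))" if B: "(t, x, y, u) \<in> B" for t x y u
    proof -
      have "A (t, x, y) * g (t, x, y) = C (t, x, y)" using A0[of "(t, x, y)"] B mem by (simp add: g_def)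
      then show ?thesis using W[OF B] by (simp add: algebra_simps)
    qed
  qed (use eqA eqA2 in auto)
qed

text \<open>With the base components known, the multipliers \<open>\<omega>T\<close>,
  \<open>\<omega>X\<close>, \<open>\<omega>Y\<close> can be eliminated. What is left is an equation
  for the new \<open>u\<close> alone, with an explicit drift \<open>\<xi>\<close> that is affine in
  \<open>x\<close> and \<open>y\<close>.\<close>

lemma symmetry_normal_form:
  assumes sym: "point_transformation U \<Phi>" "maps_equation_to_itself U \<Phi>" and p0: "(t0, x0, y0, u0) \<in> U"
  obtains \<delta> \<tau> m k A f where "\<delta> > 0" "box4 t0 x0 y0 u0 \<delta> \<subseteq> U"
    "smooth_on (ball t0 \<delta>) \<tau>" "smooth_on (ball t0 \<delta>) m" "smooth_on (ball t0 \<delta>) k"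
    "\<And>t. t \<in> ball t0 \<delta> \<Longrightarrow> m t \<noteq> 0" "\<And>t. t \<in> ball t0 \<delta> \<Longrightarrow> dd 1 \<tau> t = (m t)^2"
    "smooth_on (box3 t0 x0 y0 \<delta>) A" "solution (box3 t0 x0 y0 \<delta>) f"
    "\<And>z. z \<in> box3 t0 x0 y0 \<delta> \<Longrightarrow> A z \<noteq> 0"
    "\<And>t x y u. (t, x, y, u) \<in> box4 t0 x0 y0 u0 \<delta> \<Longrightarrow>
       \<Phi> (t, x, y, u) = (\<tau> t, m t * x + 3 * dd 1 m t * y + dd 1 k t / (m t)^2, (m t)^3 * y + k t, A (t, x, y) * (u + f (t, x, y)))"
    "\<And>t x y \<xi>. (t, x, y) \<in> box3 t0 x0 y0 \<delta> \<Longrightarrow>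
       \<xi> = (4 * dd 1 m t * x + 3 * dd 1 (dd 1 m) t * y + (dd 1 (dd 1 k) t * m t - 2 * dd 1 k t * dd 1 m t) / (m t)^3) / m t \<Longrightarrow>
       gauge_factor \<xi> A t x y"
proof -
  obtain \<delta> where \<delta>: "\<delta> > 0" "box4 t0 x0 y0 u0 \<delta> \<subseteq> U"
    using open_total_box[OF point_transformation_smooth(1)[OF sym(1)] p0] by blast
  define I where "I = ball t0 \<delta>"
  define D where "D = I \<times> ball x0 \<delta> \<times> ball y0 \<delta>"
  define B where "B = I \<times> box3 x0 y0 u0 \<delta>"
  have oB: "open B" and oI: "open I" by (auto simp: B_def I_def open_Times)
  define T X Y W where "T = (\<lambda>p. fst (\<Phi> p))" and "X = (\<lambda>p. fst (snd (\<Phi> p)))"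
    and "Y = (\<lambda>p. fst (snd (snd (\<Phi> p))))" and "W = (\<lambda>p. snd (snd (snd (\<Phi> p))))"
  have Xp: "X p = fst (snd (\<Phi> p))" for p by (simp add: X_def)
  note cs = component_structure[OF sym, folded T_def X_def Y_def W_def, folded Xp]
  have BU: "B \<subseteq> U" using \<delta> by (simp add: B_def I_def)
  have sm: "smooth_on B T" "smooth_on B X" "smooth_on B Y" "smooth_on B W"
    using cs(1-4) BU smooth_on_subset by blast+
  have str: "base_structure T X Y x p"
    if "(t, x, y, u) \<in> B" "p = (t, x, y, u)" for t x y u p
    using cs(5)[of t x y u p] that BU by blast
  obtain \<tau> m k where n: "smooth_on I \<tau>" "smooth_on I m" "smooth_on I k"
    "\<And>t. t \<in> I \<Longrightarrow> m t \<noteq> 0" "\<And>t. t \<in> I \<Longrightarrow> dd 1 \<tau> t = (m t)^2"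
    "\<And>t x y u. (t, x, y, u) \<in> B \<Longrightarrow> T (t, x, y, u) = \<tau> t \<and> Y (t, x, y, u) = (m t)^3 * y + k t
       \<and> X (t, x, y, u) = m t * x + 3 * dd 1 m t * y + dd 1 k t / (m t)^2"
    "\<And>t x y u p. (t, x, y, u) \<in> B \<Longrightarrow> p = (t, x, y, u) \<Longrightarrow> dd eY T p = 0 \<and> dd eX X p = m t \<and> dd eY Y p = (m t)^3 \<and> dd eT T p = (m t)^2"
    by (rule base_normal_form[OF \<delta>(1), of t0 x0 y0 u0 T X Y, folded I_def, folded B_def, OF sm(1-3) str]; (assumption | blast)?)
  \<comment> \<open>This is \<open>(X_t + x X_y) / X_x\<close> for the normal form of
    \<open>X\<close>.\<close>
  define \<xi> where "\<xi> = (\<lambda>(t, x, y). (4 * dd 1 m t * x + 3 * dd 1 (dd 1 m) t * y + (dd 1 (dd 1 k) t * m t - 2 * dd 1 k t * dd 1 m t) / (m t)^3) / m t)"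
  have E: "dd eT W p + x * dd eY W p - \<xi> (t, x, y) * (dd eX W p + c * dd eU W p) = dd (eX + c *\<^sub>R eU) (dd (eX + c *\<^sub>R eU) W) p"
    if B: "(t, x, y, u) \<in> B" "p = (t, x, y, u)" for t x y u c p
  proof -
    have pB: "p \<in> B" using B by simp
    have t: "t \<in> I" using B by (simp add: B_def)
    have Xt: "dd eT X p = dd 1 m t * x + 3 * dd 1 (dd 1 m) t * y + (dd 1 (dd 1 k) t * m t - 2 * dd 1 k t * dd 1 m t) / (m t)^3"
      unfolding B(2)
    proof (rule deriv_eq_on_open[OF deriv4_t[OF sm(2) B(1)] _ oI t])
      show "((\<lambda>t. m t * x + 3 * dd 1 m t * y + dd 1 k t / (m t)^2) has_real_derivative
        dd 1 m t * x + 3 * dd 1 (dd 1 m) t * y + (dd 1 (dd 1 k) t * m t - 2 * dd 1 k t * dd 1 m t) / (m t)^3) (at t)"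
        using n(4)[OF t] by (auto intro!: derivative_eq_intros smooth_real_deriv[OF n(2) t] smooth_real_deriv[OF smooth_on_dd[OF n(2)] t]
              smooth_real_deriv[OF smooth_on_dd[OF n(3)] t] simp: field_simps power2_eq_square power3_eq_cube)
    qed (use B n(6) in \<open>auto simp: B_def\<close>)
    have Xy: "dd eY X p = 3 * dd 1 m t" unfolding B(2)
    proof (rule deriv_eq_on_open[OF deriv4_y[OF sm(2) B(1)]])
      show "((\<lambda>y. m t * x + 3 * dd 1 m t * y + dd 1 k t / (m t)^2) has_real_derivative 3 * dd 1 m t) (at y)"
        by (auto intro!: derivative_eq_intros)
      show "open (ball y0 \<delta>)" "y \<in> ball y0 \<delta>" using B by (auto simp: B_def)
    qed (use B n(6) in \<open>auto simp: B_def\<close>)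
    have X2: "dd (eX + c *\<^sub>R eU) (dd (eX + c *\<^sub>R eU) X) p = 0"
    proof -
      have "dd h (dd eU X) p = 0" for h
        by (rule dd_zero_cong[OF oB smooth_on_dd[OF sm(2)] pB]) (use str in auto)
      moreover have "dd eX (dd eX X) p = 0" "dd eU (dd eX X) p = 0" unfolding B(2)
        by (rule deriv_eq_on_open[OF deriv4_x[OF smooth_on_dd[OF sm(2)] B(1)] DERIV_const[of "m t"], of "ball x0 \<delta>"],
            (use B n(7) in \<open>auto simp: B_def\<close>)[3],
            rule deriv_eq_on_open[OF deriv4_u[OF smooth_on_dd[OF sm(2)] B(1)] DERIV_const[of "m t"], of "ball u0 \<delta>"],
            (use B n(7) in \<open>auto simp: B_def\<close>)[3])
      ultimately show ?thesis unfolding dd_dd_line[OF oB sm(2) pB] by simp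
    qed
    define R where "R = dd eT X p + x * dd eY X p"
    have R: "\<xi> (t, x, y) * m t = R"
      using n(4)[OF t] by (simp add: R_def Xt Xy \<xi>_def)
    have "\<exists>\<omega>T \<omega>X \<omega>Y. \<omega>X * m t = dd eX W p + c * dd eU W p \<and>
         \<omega>T * (m t)^2 + \<omega>X * dd eT X p + \<omega>Y * dd eT Y p = dd eT W p \<and>
         \<omega>X * dd eY X p + \<omega>Y * (m t)^3 = dd eY W p \<and>
         (\<omega>T + X p * \<omega>Y) * (m t)^2 = dd (eX + c *\<^sub>R eU) (dd (eX + c *\<^sub>R eU) W) p"
      using cs(5)[OF _ B(2)] B BU n(7)[OF B] X2 by fastforce
    then obtain \<omega>T \<omega>X \<omega>Y where w: "\<omega>X * m t = dd eX W p + c * dd eU W p"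
         "\<omega>T * (m t)^2 + \<omega>X * dd eT X p + \<omega>Y * dd eT Y p = dd eT W p"
         "\<omega>X * dd eY X p + \<omega>Y * (m t)^3 = dd eY W p"
         "(\<omega>T + X p * \<omega>Y) * (m t)^2 = dd (eX + c *\<^sub>R eU) (dd (eX + c *\<^sub>R eU) W) p"
      by blast
    \<comment> \<open>Add \<open>x\<close> times the \<open>y\<close>-relation to the
      \<open>t\<close>-relation: by this identity the terms with \<open>\<omega>T\<close> and
      \<open>\<omega>Y\<close> combine to \<open>(\<omega>T + X \<omega>Y) m^2\<close>, while
      \<open>\<omega>X R\<close> equals \<open>\<xi> (W_x + c W_u)\<close>.\<close>
    have "X p * (m t)^2 = dd eT Y p + x * (m t)^3" using str[OF B] n(7)[OF B] by simp
    then show ?thesis using w R unfolding R_def by algebra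
  qed
  have nz: "dd eU W p \<noteq> 0" if "p \<in> B" for p
    using cs(5) that BU by (cases p) blast
  obtain A f where A: "smooth_on D A" "solution D f" "\<And>z. z \<in> D \<Longrightarrow> A z \<noteq> 0"
    "\<And>t x y u. (t, x, y, u) \<in> B \<Longrightarrow> W (t, x, y, u) = A (t, x, y) * (u + f (t, x, y))"
    "\<And>z. z \<in> D \<Longrightarrow> 2 * Dx A z = - \<xi> z * A z"
    "\<And>z. z \<in> D \<Longrightarrow> Dt A z + fst (snd z) * Dy A z - \<xi> z * Dx A z = Dx (Dx A) z"
    by (rule fibre_equations[OF \<delta>(1), of t0 x0 y0 u0 W \<xi>, folded I_def, folded B_def D_def, OF sm(4) nz E]; (assumption | blast)?)
  show ?thesis
  proof (rule that[OF \<delta>, folded I_def, folded B_def D_def, OF n(1-5) A(1-3)])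
    show "\<Phi> (t, x, y, u) = (\<tau> t, m t * x + 3 * dd 1 m t * y + dd 1 k t / (m t)^2, (m t)^3 * y + k t, A (t, x, y) * (u + f (t, x, y)))"
      if "(t, x, y, u) \<in> B" for t x y u
      using n(6)[OF that] A(4)[OF that] by (simp add: T_def X_def Y_def W_def prod_eq_iff)
  qed (use A(5,6) in \<open>force simp: \<xi>_def\<close>)+
qed

section \<open>The overdetermined system for the gauge factor\<close>

lemma quadratic_zero_on_ball:
  fixes a b c x0 \<delta> :: real
  assumes "\<delta> > 0" "\<And>x. x \<in> ball x0 \<delta> \<Longrightarrow> a + b * x + c * x^2 = 0"
  shows "a = 0" "b = 0" "c = 0"
proof -
  define h where "h = \<delta> / 2"
  have h: "h > 0" "h < \<delta>" using assms(1) by (auto simp: h_def)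
  have e: "a + b * x0 + c * x0^2 = 0" "a + b * (x0 + h) + c * (x0 + h)^2 = 0" "a + b * (x0 - h) + c * (x0 - h)^2 = 0"
    using assms(2)[of x0] assms(2)[of "x0 + h"] assms(2)[of "x0 - h"] h by (auto simp: dist_real_def)
  have "2 * c * h^2 = 0" using e by algebra
  then show c: "c = 0" using h by simp
  have "b * h = 0" using e unfolding c by algebra
  then show b: "b = 0" using h by simp
  show "a = 0" using e(1) by (simp add: b c)
qed

text \<open>
  The first equation determines the dependence of \<open>A\<close> on \<open>x\<close>; the coefficients of the powers of \<open>x\<close> in
  the second one, and then those of the powers of \<open>y\<close>, give the rest.
\<close>

lemma gauge_solution:
  fixes A :: "base \<Rightarrow> real" and \<alpha> \<beta> \<gamma> :: "real \<Rightarrow> real" and t0 x0 y0 \<delta> :: real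
  defines "I \<equiv> ball t0 \<delta>" and "D \<equiv> box3 t0 x0 y0 \<delta>"
  assumes \<delta>: "\<delta> > 0" and A: "smooth_on D A" "\<And>z. z \<in> D \<Longrightarrow> A z \<noteq> 0"
    and abc: "smooth_on I \<alpha>" "smooth_on I \<beta>" "smooth_on I \<gamma>"
    and eq: "\<And>t x y \<xi>. (t, x, y) \<in> D \<Longrightarrow> \<xi> = \<alpha> t * x + \<beta> t * y + \<gamma> t \<Longrightarrow>
       gauge_factor \<xi> A t x y"
  defines "\<nu> \<equiv> \<lambda>t. dd 1 \<beta> t - \<alpha> t * \<beta> t" and "\<mu> \<equiv> \<lambda>t. dd 1 \<gamma> t - \<alpha> t * \<gamma> t"
  obtains H where "\<And>t. t \<in> I \<Longrightarrow> dd 1 \<alpha> t + 2 * \<beta> t = (\<alpha> t)^2" "\<And>t. t \<in> I \<Longrightarrow> dd 1 \<mu> t = - \<beta> t * \<gamma> t"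
    "\<And>t. t \<in> I \<Longrightarrow> (H has_real_derivative H t * (- ((\<gamma> t)^2) / 4 - \<alpha> t / 2)) (at t)"
    "\<And>t x y. (t, x, y) \<in> D \<Longrightarrow> A (t, x, y) = H t * exp (- \<alpha> t * x^2 / 4 - (\<beta> t * y + \<gamma> t) * x / 2 + \<nu> t * y^2 / 4 + \<mu> t * y / 2)"
proof -
  have op: "open I" "open D" "open (ball x0 \<delta>)" "open (ball y0 \<delta>)" by (auto simp: I_def D_def open_Times)
  have mem: "(t, x, y) \<in> D \<longleftrightarrow> t \<in> I \<and> x \<in> ball x0 \<delta> \<and> y \<in> ball y0 \<delta>" for t x y by (auto simp: D_def I_def)
  have c0: "t0 \<in> I" "x0 \<in> ball x0 \<delta>" "y0 \<in> ball y0 \<delta>" using \<delta> by (auto simp: I_def)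
  note d\<alpha> = smooth_real_deriv[OF abc(1)] and d\<beta> = smooth_real_deriv[OF abc(2)] and d\<gamma> = smooth_real_deriv[OF abc(3)]
  have sm: "smooth_on I \<nu>" "smooth_on I \<mu>" unfolding \<nu>_def \<mu>_def by (intro smooth_on_intros smooth_on_dd abc op)+
  note d\<nu> = smooth_real_deriv[OF sm(1)] and d\<mu> = smooth_real_deriv[OF sm(2)]
  define \<xi> where "\<xi> t x y = \<alpha> t * x + \<beta> t * y + \<gamma> t" for t x y
  have Ax: "Dx A (t, x, y) = - \<xi> t x y / 2 * A (t, x, y)" if "(t, x, y) \<in> D" for t x y
    using eq[OF that \<xi>_def] by simp
  have Axx: "Dx (Dx A) (t, x, y) = ((\<xi> t x y)^2 / 4 - \<alpha> t / 2) * A (t, x, y)" if z: "(t, x, y) \<in> D" for t x y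
  proof (rule deriv_eq_on_open[OF deriv_x[OF smooth_on_dd[OF A(1), of "(0,1,0)"] z] _ op(3)])
    show "((\<lambda>x. - \<xi> t x y / 2 * A (t, x, y)) has_real_derivative ((\<xi> t x y)^2 / 4 - \<alpha> t / 2) * A (t, x, y)) (at x)"
      unfolding \<xi>_def by (auto intro!: derivative_eq_intros deriv_x[OF A(1) z] simp: Ax[OF z] \<xi>_def power2_eq_square field_simps)
  qed (use z Ax in \<open>auto simp: mem\<close>)
  have Aty: "Dt A (t, x, y) + x * Dy A (t, x, y) = - ((\<xi> t x y)^2 / 4 + \<alpha> t / 2) * A (t, x, y)"
    if z: "(t, x, y) \<in> D" for t x y
  proof -
    have "Dt A (t, x, y) + x * Dy A (t, x, y) = \<xi> t x y * Dx A (t, x, y) + Dx (Dx A) (t, x, y)"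
      using eq[OF z \<xi>_def] by simp
    then show ?thesis unfolding Axx[OF z] Ax[OF z] by (simp add: field_simps power2_eq_square)
  qed
  \<comment> \<open>\<open>E\<close> is an antiderivative of \<open>\<xi> / 2\<close> in
    \<open>x\<close>, so \<open>exp E\<close> cancels the dependence of \<open>A\<close> on
    \<open>x\<close> that the first gauge condition prescribes.\<close>
  define E where "E t x y = \<alpha> t * x^2 / 4 + (\<beta> t * y + \<gamma> t) * x / 2" for t x y
  define G where "G t y = A (t, x0, y) * exp (E t x0 y)" for t y
  have G: "G t y = A (t, x, y) * exp (E t x y)" if z: "(t, x, y) \<in> D" for t x y
    unfolding G_def
  proof (rule constant_on_convex[where f="\<lambda>s. A (t, s, y) * exp (E t s y)" and N="ball x0 \<delta>"])
    fix s assume "s \<in> ball x0 \<delta>"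
    then have s: "(t, s, y) \<in> D" using z by (simp add: mem)
    show "((\<lambda>s. A (t, s, y) * exp (E t s y)) has_real_derivative 0) (at s)"
      unfolding E_def by (auto intro!: derivative_eq_intros deriv_x[OF A(1) s] simp: Ax[OF s] \<xi>_def field_simps power2_eq_square)
  qed (use z c0 in \<open>auto simp: mem\<close>)
  have G0: "G t y \<noteq> 0" if "t \<in> I" "y \<in> ball y0 \<delta>" for t y
    using A(2)[of "(t, x0, y)"] that c0 by (simp add: G_def mem)
  define P where "P t y = (Dt A (t, x0, y) + A (t, x0, y) * (dd 1 \<alpha> t * x0^2 / 4 + (dd 1 \<beta> t * y + dd 1 \<gamma> t) * x0 / 2)) * exp (E t x0 y)" for t y
  define Q where "Q t y = (Dy A (t, x0, y) + A (t, x0, y) * (\<beta> t * x0 / 2)) * exp (E t x0 y)" for t y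
  have dt: "((\<lambda>t. A (t, x, y) * exp (E t x y)) has_real_derivative
      (Dt A (t, x, y) + A (t, x, y) * (dd 1 \<alpha> t * x^2 / 4 + (dd 1 \<beta> t * y + dd 1 \<gamma> t) * x / 2)) * exp (E t x y)) (at t)"
    and dy: "((\<lambda>y. A (t, x, y) * exp (E t x y)) has_real_derivative
      (Dy A (t, x, y) + A (t, x, y) * (\<beta> t * x / 2)) * exp (E t x y)) (at y)" if z: "(t, x, y) \<in> D" for t x y
  proof -
    have t: "t \<in> I" using z by (simp add: mem)
    show "((\<lambda>t. A (t, x, y) * exp (E t x y)) has_real_derivative
      (Dt A (t, x, y) + A (t, x, y) * (dd 1 \<alpha> t * x^2 / 4 + (dd 1 \<beta> t * y + dd 1 \<gamma> t) * x / 2)) * exp (E t x y)) (at t)"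
      unfolding E_def by (auto intro!: derivative_eq_intros deriv_t[OF A(1) z] d\<alpha>[OF t] d\<beta>[OF t] d\<gamma>[OF t] simp: field_simps)
    show "((\<lambda>y. A (t, x, y) * exp (E t x y)) has_real_derivative
      (Dy A (t, x, y) + A (t, x, y) * (\<beta> t * x / 2)) * exp (E t x y)) (at y)"
      unfolding E_def by (auto intro!: derivative_eq_intros deriv_y[OF A(1) z] simp: field_simps)
  qed
  have dG: "((\<lambda>t. G t y) has_real_derivative P t y) (at t)" "((\<lambda>y. G t y) has_real_derivative Q t y) (at y)"
    if "t \<in> I" "y \<in> ball y0 \<delta>" for t y
    using dt[of t x0 y] dy[of t x0 y] that c0 by (simp_all add: mem G_def[abs_def] P_def Q_def)
  \<comment> \<open>After division by \<open>exp E\<close> the second gauge condition is a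
    polynomial identity in \<open>x\<close>: the square gives the Riccati relation for
    \<open>\<alpha>\<close>, the linear term the \<open>y\<close>-derivative of \<open>G\<close>,
    the constant term its \<open>t\<close>-derivative.\<close>
  have coeff: "dd 1 \<alpha> t + 2 * \<beta> t = (\<alpha> t)^2 \<and> Q t y = G t y * (\<nu> t * y / 2 + \<mu> t / 2)
      \<and> P t y = G t y * (- ((\<beta> t * y + \<gamma> t)^2) / 4 - \<alpha> t / 2)" if ty: "t \<in> I" "y \<in> ball y0 \<delta>" for t y
  proof -
    define b where "b = \<beta> t * y + \<gamma> t"
    have "(P t y + G t y * (b^2 / 4 + \<alpha> t / 2)) + (Q t y - G t y * (\<nu> t * y / 2 + \<mu> t / 2)) * x
       + (- G t y * (dd 1 \<alpha> t / 4 + \<beta> t / 2 - (\<alpha> t)^2 / 4)) * x^2 = 0" if x: "x \<in> ball x0 \<delta>" for x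
    proof -
      have z: "(t, x, y) \<in> D" using x ty by (simp add: mem)
      have P: "P t y = (Dt A (t, x, y) + A (t, x, y) * (dd 1 \<alpha> t * x^2 / 4 + (dd 1 \<beta> t * y + dd 1 \<gamma> t) * x / 2)) * exp (E t x y)"
        by (rule deriv_eq_on_open[OF dG(1)[OF ty] dt[OF z] op(1) ty(1)]) (use G z in \<open>auto simp: mem\<close>)
      have Q: "Q t y = (Dy A (t, x, y) + A (t, x, y) * (\<beta> t * x / 2)) * exp (E t x y)"
        by (rule deriv_eq_on_open[OF dG(2)[OF ty] dy[OF z] op(4) ty(2)]) (use G z in \<open>auto simp: mem\<close>)
      have "P t y + x * Q t y = ((Dt A (t, x, y) + x * Dy A (t, x, y))
         + A (t, x, y) * (dd 1 \<alpha> t * x^2 / 4 + (dd 1 \<beta> t * y + dd 1 \<gamma> t) * x / 2 + x * (\<beta> t * x / 2))) * exp (E t x y)"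
        unfolding P Q by (simp add: algebra_simps)
      also have "\<dots> = G t y * (- ((\<xi> t x y)^2 / 4 + \<alpha> t / 2) + (dd 1 \<alpha> t * x^2 / 4 + (dd 1 \<beta> t * y + dd 1 \<gamma> t) * x / 2 + x * (\<beta> t * x / 2)))"
        unfolding Aty[OF z] G[OF z] by (simp add: algebra_simps)
      finally have "P t y + x * Q t y = G t y * (- ((\<alpha> t * x + b)^2 / 4 + \<alpha> t / 2) + (dd 1 \<alpha> t * x^2 / 4 + (dd 1 \<beta> t * y + dd 1 \<gamma> t) * x / 2 + x * (\<beta> t * x / 2)))"
        by (simp add: \<xi>_def b_def algebra_simps)
      then show ?thesis
        by (simp add: \<nu>_def \<mu>_def b_def power2_eq_square field_simps)
    qed
    note 0 = quadratic_zero_on_ball[where ?x0.0=x0, OF \<delta> this]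
    have "dd 1 \<alpha> t / 4 + \<beta> t / 2 - (\<alpha> t)^2 / 4 = 0" using 0(3) G0[OF ty] by simp
    then have "dd 1 \<alpha> t + 2 * \<beta> t = (\<alpha> t)^2" by simp
    moreover have "P t y = G t y * (- (b^2) / 4 - \<alpha> t / 2)" using 0(1) by (simp add: algebra_simps)
    ultimately show ?thesis using 0(2) by (simp add: b_def)
  qed
  have dG': "((\<lambda>t. G t y) has_real_derivative G t y * (- ((\<beta> t * y + \<gamma> t)^2) / 4 - \<alpha> t / 2)) (at t)"
    "((\<lambda>y. G t y) has_real_derivative G t y * (\<nu> t * y / 2 + \<mu> t / 2)) (at y)"
    if "t \<in> I" "y \<in> ball y0 \<delta>" for t y
    using dG[OF that] coeff[OF that] by simp_all
  \<comment> \<open>An antiderivative in \<open>y\<close> of the logarithmic derivative of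
    \<open>G\<close> just found, so that \<open>H\<close> depends on \<open>t\<close> only.\<close>
  define F where "F t y = \<nu> t * y^2 / 4 + \<mu> t * y / 2" for t y
  define H where "H t = G t y0 * exp (- F t y0)" for t
  have H: "H t = G t y * exp (- F t y)" if ty: "t \<in> I" "y \<in> ball y0 \<delta>" for t y
    unfolding H_def
  proof (rule constant_on_convex[where f="\<lambda>y. G t y * exp (- F t y)" and N="ball y0 \<delta>"])
    fix s assume s: "s \<in> ball y0 \<delta>"
    show "((\<lambda>y. G t y * exp (- F t y)) has_real_derivative 0) (at s)"
      unfolding F_def by (auto intro!: derivative_eq_intros dG'(2)[OF ty(1) s] simp: field_simps)
  qed (use ty c0 in auto)
  have H0: "H t \<noteq> 0" if "t \<in> I" for t using G0[OF that c0(3)] by (simp add: H_def)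
  define h where "h t = - ((\<beta> t * y0 + \<gamma> t)^2) / 4 - \<alpha> t / 2 - (dd 1 \<nu> t * y0^2 / 4 + dd 1 \<mu> t * y0 / 2)" for t
  have dH: "(H has_real_derivative H t * (- ((\<beta> t * y + \<gamma> t)^2) / 4 - \<alpha> t / 2 - (dd 1 \<nu> t * y^2 / 4 + dd 1 \<mu> t * y / 2))) (at t)"
    if ty: "t \<in> I" "y \<in> ball y0 \<delta>" for t y
  proof -
    have "((\<lambda>t. G t y * exp (- F t y)) has_real_derivative
       G t y * exp (- F t y) * (- ((\<beta> t * y + \<gamma> t)^2) / 4 - \<alpha> t / 2 - (dd 1 \<nu> t * y^2 / 4 + dd 1 \<mu> t * y / 2))) (at t)"
      unfolding F_def by (auto intro!: derivative_eq_intros dG'(1)[OF ty] d\<nu>[OF ty(1)] d\<mu>[OF ty(1)] simp: field_simps)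
    then show ?thesis unfolding H[OF ty, symmetric]
      by (rule has_field_derivative_transform_within_open[OF _ op(1) ty(1)]) (use H ty in auto)
  qed
  \<comment> \<open>The logarithmic derivative of \<open>H\<close> is computed through
    \<open>y\<close> and through \<open>y0\<close>. The difference is a quadratic in
    \<open>y\<close> that vanishes identically; its linear coefficient is the second compatibility
    condition.\<close>
  have coeff2: "dd 1 \<mu> t = - \<beta> t * \<gamma> t \<and> h t = - ((\<gamma> t)^2) / 4 - \<alpha> t / 2" if t: "t \<in> I" for t
  proof -
    have "(- ((\<gamma> t)^2) / 4 - \<alpha> t / 2 - h t) + (- (\<beta> t * \<gamma> t + dd 1 \<mu> t) / 2) * y + (- ((\<beta> t)^2 + dd 1 \<nu> t) / 4) * y^2 = 0"
      if y: "y \<in> ball y0 \<delta>" for y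
    proof -
      have "H t * (- ((\<beta> t * y + \<gamma> t)^2) / 4 - \<alpha> t / 2 - (dd 1 \<nu> t * y^2 / 4 + dd 1 \<mu> t * y / 2)) = H t * h t"
        unfolding h_def by (rule DERIV_unique[OF dH[OF t y] dH[OF t c0(3)]])
      then have "- ((\<beta> t * y + \<gamma> t)^2) / 4 - \<alpha> t / 2 - (dd 1 \<nu> t * y^2 / 4 + dd 1 \<mu> t * y / 2) = h t" using H0[OF t] by simp
      then show ?thesis by (simp add: power2_eq_square field_simps)
    qed
    from quadratic_zero_on_ball[where ?x0.0=y0, OF \<delta> this] show ?thesis by auto
  qed
  show ?thesis
  proof (rule that)
    fix t assume t: "t \<in> I"
    show "dd 1 \<alpha> t + 2 * \<beta> t = (\<alpha> t)^2" using coeff[OF t c0(3)] by blast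
    show "dd 1 \<mu> t = - \<beta> t * \<gamma> t" using coeff2[OF t] by blast
    show "(H has_real_derivative H t * (- ((\<gamma> t)^2) / 4 - \<alpha> t / 2)) (at t)"
      using dH[OF t c0(3), folded h_def] coeff2[OF t] by simp
  next
    fix t x y assume z: "(t, x, y) \<in> D"
    then have "H t = A (t, x, y) * exp (E t x y) * exp (- F t y)" using H[of t y] G[OF z] by (simp add: mem)
    moreover have "exp (E t x y) * exp (- F t y) * exp (- E t x y + F t y) = 1" by (simp flip: exp_add)
    ultimately have "A (t, x, y) = H t * exp (- E t x y + F t y)" by (simp add: mult.assoc)
    then show "A (t, x, y) = H t * exp (- \<alpha> t * x^2 / 4 - (\<beta> t * y + \<gamma> t) * x / 2 + \<nu> t * y^2 / 4 + \<mu> t * y / 2)"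
      by (simp add: E_def F_def algebra_simps)
  qed
qed

section \<open>Dependence on t: a fractional linear map and a cubic shift\<close>

lemma affine_on_ball:
  fixes f :: "real \<Rightarrow> real"
  assumes "smooth_on (ball t0 \<delta>) f" "\<And>t. t \<in> ball t0 \<delta> \<Longrightarrow> dd 1 (dd 1 f) t = 0" "\<delta> > 0"
  obtains a b where "\<And>t. t \<in> ball t0 \<delta> \<Longrightarrow> f t = a * t + b" "\<And>t. t \<in> ball t0 \<delta> \<Longrightarrow> dd 1 f t = a"
proof -
  have t0: "t0 \<in> ball t0 \<delta>" using assms(3) by simp
  define a where "a = dd 1 f t0"
  have a: "dd 1 f t = a" if "t \<in> ball t0 \<delta>" for t
    unfolding a_def
    by (rule constant_on_convex[where f="dd 1 f" and N="ball t0 \<delta>", OF _ _ that t0])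
       (use smooth_real_deriv[OF smooth_on_dd[OF assms(1), of 1]] assms(2) in auto)
  have "f t - a * t = f t0 - a * t0" if "t \<in> ball t0 \<delta>" for t
  proof (rule constant_on_convex[where f="\<lambda>t. f t - a * t" and N="ball t0 \<delta>", OF _ _ that t0])
    fix s assume s: "s \<in> ball t0 \<delta>"
    show "((\<lambda>t. f t - a * t) has_real_derivative 0) (at s)"
      using DERIV_diff[OF smooth_real_deriv[OF assms(1) s] DERIV_cmult[OF DERIV_ident, of a]] a[OF s] by simp
  qed auto
  then have "f t = a * t + (f t0 - a * t0)" if "t \<in> ball t0 \<delta>" for t using that by (simp add: algebra_simps)
  then show ?thesis using that a by blast
qed

lemma dd_real_eqI:
  fixes f :: "real \<Rightarrow> real"
  assumes "(f has_real_derivative a) (at t)" shows "dd 1 f t = a"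
  using dd_eqI[OF assms[unfolded has_field_derivative_def]] by simp

lemma dd_real_cong:
  fixes f g :: "real \<Rightarrow> real"
  assumes "open I" "smooth_on I f" "t \<in> I" "\<And>t. t \<in> I \<Longrightarrow> f t = g t" "(g has_real_derivative a) (at t)"
  shows "dd 1 f t = a"
  by (rule deriv_eq_on_open[OF smooth_real_deriv[OF assms(2,3)] assms(5,1,3,4)])

text \<open>The part of the drift free of \<open>x\<close> and \<open>y\<close>, after inserting
  \<open>m = 1 / Q\<close> and \<open>k = K / Q^3\<close> with \<open>c\<close> the derivative of
  \<open>Q\<close>; \<open>K1\<close> and \<open>K2\<close> stand for the derivatives of
  \<open>K\<close>.\<close>

lemma gauge_coefficients:
  fixes Q c K K1 K2 K3 :: real
  assumes "Q \<noteq> 0"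
  shows "((K2 / Q^3 - 6 * c * K1 / Q^4 + 12 * c^2 * K / Q^5) * (1 / Q) - 2 * (K1 / Q^3 - 3 * c * K / Q^4) * (- c / Q^2)) / (1 / Q)^3 / (1 / Q)
    = K2 - 4 * c * K1 / Q + 6 * c^2 * K / Q^2"
  using assms by (simp add: field_simps eval_nat_numeral)

lemma symmetry_local_form:
  assumes sym: "point_transformation U \<Phi>" "maps_equation_to_itself U \<Phi>" and p0: "(t0, x0, y0, u0) \<in> U"
  obtains \<delta> where "\<delta> > 0" "box4 t0 x0 y0 u0 \<delta> \<subseteq> U"
    "has_symmetry_form (box4 t0 x0 y0 u0 \<delta>) \<Phi>"
proof -
  obtain \<delta> \<tau> m k A f where \<delta>: "\<delta> > 0" "box4 t0 x0 y0 u0 \<delta> \<subseteq> U"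
    and sm: "smooth_on (ball t0 \<delta>) \<tau>" "smooth_on (ball t0 \<delta>) m" "smooth_on (ball t0 \<delta>) k"
    and m0: "\<And>t. t \<in> ball t0 \<delta> \<Longrightarrow> m t \<noteq> 0" and \<tau>: "\<And>t. t \<in> ball t0 \<delta> \<Longrightarrow> dd 1 \<tau> t = (m t)^2"
    and A: "smooth_on (box3 t0 x0 y0 \<delta>) A" and f: "solution (box3 t0 x0 y0 \<delta>) f"
    and A0: "\<And>z. z \<in> box3 t0 x0 y0 \<delta> \<Longrightarrow> A z \<noteq> 0"
    and \<Phi>: "\<And>t x y u. (t, x, y, u) \<in> box4 t0 x0 y0 u0 \<delta> \<Longrightarrow>
       \<Phi> (t, x, y, u) = (\<tau> t, m t * x + 3 * dd 1 m t * y + dd 1 k t / (m t)^2, (m t)^3 * y + k t, A (t, x, y) * (u + f (t, x, y)))"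
    and eq: "\<And>t x y \<xi>. (t, x, y) \<in> box3 t0 x0 y0 \<delta> \<Longrightarrow>
       \<xi> = (4 * dd 1 m t * x + 3 * dd 1 (dd 1 m) t * y + (dd 1 (dd 1 k) t * m t - 2 * dd 1 k t * dd 1 m t) / (m t)^3) / m t \<Longrightarrow>
       gauge_factor \<xi> A t x y"
    by (rule symmetry_normal_form[OF sym p0]; (assumption | blast)?)
  define I where "I = ball t0 \<delta>"
  have oI: "open I" by (simp add: I_def)
  note smI = sm[folded I_def] and m0I = m0[folded I_def]
  define m1 m2 k1 k2 where "m1 = dd 1 m" and "m2 = dd 1 m1" and "k1 = dd 1 k" and "k2 = dd 1 k1"
  have sm2: "smooth_on I m1" "smooth_on I m2" "smooth_on I k1" "smooth_on I k2"
    unfolding m1_def m2_def k1_def k2_def by (intro smooth_on_dd smI)+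
  have dm: "(m has_real_derivative m1 t) (at t)" "(m1 has_real_derivative m2 t) (at t)"
    if "t \<in> I" for t
    using smooth_real_deriv[OF smI(2) that] smooth_real_deriv[OF sm2(1) that] by (simp_all add: m1_def m2_def)
  \<comment> \<open>Coefficients of the drift as an affine function of \<open>x\<close> and
    \<open>y\<close>.\<close>
  define \<alpha> where "\<alpha> t = 4 * m1 t / m t" for t
  define \<beta> where "\<beta> t = 3 * m2 t / m t" for t
  define \<gamma> where "\<gamma> t = (k2 t * m t - 2 * k1 t * m1 t) / (m t)^3 / m t" for t
  have abc: "smooth_on I \<alpha>" "smooth_on I \<beta>" "smooth_on I \<gamma>"
    unfolding \<alpha>_def[abs_def] \<beta>_def[abs_def] \<gamma>_def[abs_def] by (intro smooth_on_intros oI smI sm2; use m0I in auto)+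
  define \<nu> where "\<nu> = (\<lambda>t. dd 1 \<beta> t - \<alpha> t * \<beta> t)"
  define \<mu> where "\<mu> = (\<lambda>t. dd 1 \<gamma> t - \<alpha> t * \<gamma> t)"
  have eq': "gauge_factor \<xi> A t x y"
    if z: "(t, x, y) \<in> box3 t0 x0 y0 \<delta>" and "\<xi> = \<alpha> t * x + \<beta> t * y + \<gamma> t" for t x y \<xi>
    by (rule eq[OF z]) (simp add: that(2) \<alpha>_def \<beta>_def \<gamma>_def m1_def m2_def k1_def k2_def add_divide_distrib)
  obtain H where H: "\<And>t. t \<in> I \<Longrightarrow> dd 1 \<alpha> t + 2 * \<beta> t = (\<alpha> t)^2" "\<And>t. t \<in> I \<Longrightarrow> dd 1 \<mu> t = - \<beta> t * \<gamma> t"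
    "\<And>t. t \<in> I \<Longrightarrow> (H has_real_derivative H t * (- ((\<gamma> t)^2) / 4 - \<alpha> t / 2)) (at t)"
    "\<And>t x y. (t, x, y) \<in> I \<times> ball x0 \<delta> \<times> ball y0 \<delta> \<Longrightarrow>
       A (t, x, y) = H t * exp (- \<alpha> t * x^2 / 4 - (\<beta> t * y + \<gamma> t) * x / 2 + \<nu> t * y^2 / 4 + \<mu> t * y / 2)"
    unfolding \<nu>_def \<mu>_def
  proof (rule gauge_solution[OF \<delta>(1) A A0 abc[unfolded I_def] eq', folded I_def], goal_cases)
    case (4 H)
    show ?case by (rule 4(1)[OF 4(2-5)])
  qed assumption+
  have I0: "t0 \<in> I" using \<delta> by (simp add: I_def)
  text \<open>The first compatibility condition says that \<open>1 / m\<close> is affine.\<close>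
  have mm: "m2 t * m t = 2 * (m1 t)^2" if t: "t \<in> I" for t
  proof -
    have "dd 1 \<alpha> t = 4 * (m2 t * m t - m1 t * m1 t) / (m t)^2"
      unfolding \<alpha>_def[abs_def] by (rule dd_real_eqI) (auto intro!: derivative_eq_intros dm[OF t] m0I[OF t] simp: power2_eq_square)
    then have "4 * (m2 t * m t - m1 t * m1 t) / (m t)^2 + 2 * (3 * m2 t / m t) = (4 * m1 t / m t)^2"
      using H(1)[OF t] by (simp add: \<alpha>_def \<beta>_def)
    then have "4 * (m2 t * m t - m1 t * m1 t) + 6 * m2 t * m t = 16 * (m1 t)^2"
      using m0I[OF t] by (simp add: field_simps power2_eq_square)
    then show ?thesis by (simp add: power2_eq_square)
  qed
  define q where "q t = 1 / m t" for t
  have smq: "smooth_on I q" unfolding q_def[abs_def] by (intro smooth_on_intros oI smI m0I)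
  have "dd 1 q t = - m1 t / (m t)^2" if t: "t \<in> I" for t
    unfolding q_def[abs_def] by (rule dd_real_eqI) (auto intro!: derivative_eq_intros dm[OF t] m0I[OF t] simp: power2_eq_square)
  then have "dd 1 (dd 1 q) t = 0" if t: "t \<in> I" for t
  proof (rule dd_real_cong[OF oI smooth_on_dd[OF smq] t])
    show "((\<lambda>t. - m1 t / (m t)^2) has_real_derivative 0) (at t)"
    proof -
      have "((\<lambda>t. - m1 t / (m t)^2) has_real_derivative - (m2 t * m t - 2 * (m1 t)^2) / (m t)^3) (at t)"
        using m0I[OF t] by (auto intro!: derivative_eq_intros dm[OF t] simp: power2_eq_square power3_eq_cube field_simps)
      then show ?thesis using mm[OF t] by simp
    qed
  qed
  then obtain c d where q: "\<And>t. t \<in> I \<Longrightarrow> q t = c * t + d" and q1: "\<And>t. t \<in> I \<Longrightarrow> dd 1 q t = c"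
    using affine_on_ball[OF smq[unfolded I_def] _ \<delta>(1)] unfolding I_def by metis
  have q0: "q t \<noteq> 0" and m: "m t = 1 / q t" if "t \<in> I" for t
    using m0I[OF that] by (simp_all add: q_def)
  have dq: "(q has_real_derivative c) (at t)" if "t \<in> I" for t
    using smooth_real_deriv[OF smq that] q1[OF that] by simp
  have m1: "m1 t = - c / (q t)^2" if t: "t \<in> I" for t
    unfolding m1_def
    by (rule dd_real_cong[OF oI smI(2) t m]) (use q0[OF t] in \<open>auto intro!: derivative_eq_intros dq[OF t] simp: power2_eq_square\<close>)
  have m2: "m2 t = 2 * c^2 / (q t)^3" if t: "t \<in> I" for t
    unfolding m2_def
    by (rule dd_real_cong[OF oI sm2(1) t m1])
       (use q0[OF t] in \<open>auto intro!: derivative_eq_intros dq[OF t] simp: power2_eq_square power3_eq_cube field_simps\<close>)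
  \<comment> \<open>Since \<open>\<tau>' = m^2 = 1 / q^2\<close>, the derivative of
    \<open>\<tau> q\<close> is \<open>1 / q + c \<tau>\<close>, and differentiating once more
    cancels both terms. So \<open>\<tau> q\<close> is affine and \<open>\<tau>\<close> is fractional
    linear with denominator \<open>q\<close>.\<close>
  have d1\<tau>: "dd 1 (\<lambda>t. \<tau> t * q t) t = 1 / q t + c * \<tau> t" if t: "t \<in> I" for t
    by (rule dd_real_eqI)
       (use \<tau>[folded I_def, OF t] q0[OF t] m[OF t] in \<open>auto intro!: derivative_eq_intros dq[OF t] smooth_real_deriv[OF smI(1) t] simp: power2_eq_square field_simps\<close>)
  have sm\<tau>: "smooth_on I (\<lambda>t. \<tau> t * q t)" by (intro smooth_on_intros oI smI smq)
  have d2\<tau>: "dd 1 (dd 1 (\<lambda>t. \<tau> t * q t)) t = 0" if t: "t \<in> I" for t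
    by (rule dd_real_cong[OF oI smooth_on_dd[OF sm\<tau>] t d1\<tau>])
       (use t \<tau>[folded I_def, OF t] q0[OF t] m[OF t] in \<open>auto intro!: derivative_eq_intros dq[OF t] smooth_real_deriv[OF smI(1) t] simp: power2_eq_square field_simps\<close>)
  obtain a b where ab: "\<And>t. t \<in> I \<Longrightarrow> \<tau> t * q t = a * t + b"
    "\<And>t. t \<in> I \<Longrightarrow> dd 1 (\<lambda>t. \<tau> t * q t) t = a"
  proof (rule affine_on_ball[OF sm\<tau>[unfolded I_def] d2\<tau>[unfolded I_def] \<delta>(1), folded I_def], goal_cases)
    case (2 a b)
    show ?case by (rule 2(1)[OF 2(2,3)])
  qed
  \<comment> \<open>Multiplying \<open>a = 1 / q + c \<tau>\<close> by \<open>q\<close> and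
    inserting the affine expressions for \<open>q\<close> and \<open>\<tau> q\<close>, the terms
    with \<open>t0\<close> cancel.\<close>
  have det: "a * d - b * c = 1"
  proof -
    have "a = 1 / q t0 + c * \<tau> t0" using ab(2)[OF I0] d1\<tau>[OF I0] by simp
    then have "a * q t0 = 1 + c * (\<tau> t0 * q t0)" using q0[OF I0] by (simp add: field_simps)
    then show ?thesis unfolding ab(1)[OF I0] unfolding q[OF I0] by (simp add: algebra_simps)
  qed
  \<comment> \<open>With \<open>k = K / q^3\<close> the new \<open>y\<close> reads
    \<open>(y + K) / q^3\<close>, so \<open>K\<close> is the shift in \<open>y_hat\<close>, and its
    derivative turns out to be the shift in \<open>x_hat\<close>.\<close>
  define K where "K t = (q t)^3 * k t" for t
  have smK: "smooth_on I K" unfolding K_def[abs_def] by (intro smooth_on_intros oI smI smq)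
  define K1 K2 K3 where "K1 = dd 1 K" and "K2 = dd 1 K1" and "K3 = dd 1 K2"
  have smK': "smooth_on I K1" "smooth_on I K2" "smooth_on I K3"
    unfolding K1_def K2_def K3_def by (intro smooth_on_dd smK)+
  have dK: "(K has_real_derivative K1 t) (at t)" "(K1 has_real_derivative K2 t) (at t)" "(K2 has_real_derivative K3 t) (at t)"
    "(K3 has_real_derivative dd 1 K3 t) (at t)" if "t \<in> I" for t
    using smooth_real_deriv[OF smK that] smooth_real_deriv[OF smK'(1) that] smooth_real_deriv[OF smK'(2) that] smooth_real_deriv[OF smK'(3) that]
    by (simp_all add: K1_def K2_def K3_def)
  have k: "k t = K t / (q t)^3" if "t \<in> I" for t using q0[OF that] by (simp add: K_def)
  have k1: "k1 t = K1 t / (q t)^3 - 3 * c * K t / (q t)^4" if t: "t \<in> I" for t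
    unfolding k1_def
    by (rule dd_real_cong[OF oI smI(3) t k])
       (use q0[OF t] in \<open>auto intro!: derivative_eq_intros dq[OF t] dK[OF t] simp: eval_nat_numeral field_simps\<close>)
  have k2: "k2 t = K2 t / (q t)^3 - 6 * c * K1 t / (q t)^4 + 12 * c^2 * K t / (q t)^5" if t: "t \<in> I" for t
    unfolding k2_def
    by (rule dd_real_cong[OF oI sm2(3) t k1])
       (use q0[OF t] in \<open>auto intro!: derivative_eq_intros dq[OF t] dK[OF t] simp: eval_nat_numeral field_simps\<close>)
  have \<alpha>: "\<alpha> t = - 4 * c / q t" and \<beta>: "\<beta> t = 6 * c^2 / (q t)^2"
    and \<gamma>: "\<gamma> t = K2 t - 4 * c * K1 t / q t + 6 * c^2 * K t / (q t)^2" if t: "t \<in> I" for t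
  proof -
    show "\<alpha> t = - 4 * c / q t" "\<beta> t = 6 * c^2 / (q t)^2"
      using q0[OF t] by (simp_all add: \<alpha>_def \<beta>_def m[OF t] m1[OF t] m2[OF t] field_simps eval_nat_numeral)
    show "\<gamma> t = K2 t - 4 * c * K1 t / q t + 6 * c^2 * K t / (q t)^2"
      unfolding \<gamma>_def k1[OF t] k2[OF t] m[OF t] m1[OF t] by (rule gauge_coefficients[OF q0[OF t]])
  qed
  have \<nu>: "\<nu> t = 12 * c^3 / (q t)^3" if t: "t \<in> I" for t
  proof -
    have "dd 1 \<beta> t = - 12 * c^3 / (q t)^3"
      by (rule dd_real_cong[OF oI abc(2) t \<beta>])
         (use q0[OF t] in \<open>auto intro!: derivative_eq_intros dq[OF t] simp: eval_nat_numeral field_simps\<close>)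
    then show ?thesis using q0[OF t] by (simp add: \<nu>_def \<alpha>[OF t] \<beta>[OF t] eval_nat_numeral field_simps)
  qed
  have \<mu>: "\<mu> t = K3 t - 6 * c^2 * K1 t / (q t)^2 + 12 * c^3 * K t / (q t)^3" if t: "t \<in> I" for t
  proof -
    have "dd 1 \<gamma> t = K3 t - 4 * c * K2 t / q t + 10 * c^2 * K1 t / (q t)^2 - 12 * c^3 * K t / (q t)^3"
      by (rule dd_real_cong[OF oI abc(3) t \<gamma>])
         (use q0[OF t] in \<open>auto intro!: derivative_eq_intros dq[OF t] dK[OF t] simp: eval_nat_numeral field_simps\<close>)
    then have "\<mu> t = K3 t - 4 * c * K2 t / q t + 10 * c^2 * K1 t / (q t)^2 - 12 * c^3 * K t / (q t)^3 - \<alpha> t * \<gamma> t"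
      by (simp only: \<mu>_def)
    also have "\<dots> = K3 t - 6 * c^2 * K1 t / (q t)^2 + 12 * c^3 * K t / (q t)^3"
      unfolding \<alpha>[OF t] \<gamma>[OF t] using q0[OF t] by (simp add: eval_nat_numeral field_simps)
    finally show ?thesis .
  qed
  have "smooth_on I \<mu>" unfolding \<mu>_def by (intro smooth_on_intros smooth_on_dd abc oI)
  \<comment> \<open>All lower derivatives of \<open>K\<close> cancel in the condition
    \<open>\<mu>' = - \<beta> \<gamma>\<close>, leaving only the fourth; hence the cubic polynomial
    with its four constants.\<close>
  have K4: "dd 1 K3 t = 0" if t: "t \<in> I" for t
  proof -
    have "dd 1 \<mu> t = dd 1 K3 t - 6 * c^2 * K2 t / (q t)^2 + 24 * c^3 * K1 t / (q t)^3 - 36 * c^4 * K t / (q t)^4"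
      by (rule dd_real_cong[OF oI \<open>smooth_on I \<mu>\<close> t \<mu>])
         (use q0[OF t] in \<open>auto intro!: derivative_eq_intros dq[OF t] dK[OF t] simp: eval_nat_numeral field_simps\<close>)
    moreover have "- \<beta> t * \<gamma> t = - 6 * c^2 * K2 t / (q t)^2 + 24 * c^3 * K1 t / (q t)^3 - 36 * c^4 * K t / (q t)^4"
      unfolding \<beta>[OF t] \<gamma>[OF t] using q0[OF t] by (simp add: eval_nat_numeral field_simps)
    ultimately show ?thesis using H(2)[OF t] by simp
  qed
  obtain l3' l2' where K2': "\<And>t. t \<in> I \<Longrightarrow> K2 t = l3' * t + l2'" "\<And>t. t \<in> I \<Longrightarrow> K3 t = l3'"
  proof (rule affine_on_ball[OF smK'(2)[unfolded I_def] K4[unfolded I_def K3_def] \<delta>(1), folded I_def K3_def], goal_cases)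
    case (2 a b)
    show ?case by (rule 2(1)[OF 2(2,3)])
  qed
  \<comment> \<open>The divisors 6 and 2 come from the second derivative of
    \<open>l3 t^3 + l2 t^2\<close>.\<close>
  define l3 l2 where "l3 = l3' / 6" and "l2 = l2' / 2"
  have K2: "K2 t = 6 * l3 * t + 2 * l2" and K3: "K3 t = 6 * l3" if "t \<in> I" for t
    using K2'[OF that] by (simp_all add: l3_def l2_def)
  define l1 where "l1 = K1 t0 - 3 * l3 * t0^2 - 2 * l2 * t0"
  have K1: "K1 t = 3 * l3 * t^2 + 2 * l2 * t + l1" if t: "t \<in> I" for t
  proof -
    have "K1 t - 3 * l3 * t^2 - 2 * l2 * t = K1 t0 - 3 * l3 * t0^2 - 2 * l2 * t0"
      by (rule constant_on_convex[where f="\<lambda>t. K1 t - 3 * l3 * t^2 - 2 * l2 * t" and N=I, OF _ _ t I0])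
         (auto intro!: derivative_eq_intros dK simp: K2, simp add: I_def)
    then show ?thesis by (simp add: l1_def)
  qed
  define l0 where "l0 = K t0 - l3 * t0^3 - l2 * t0^2 - l1 * t0"
  have K: "K t = l3 * t^3 + l2 * t^2 + l1 * t + l0" if t: "t \<in> I" for t
  proof -
    have "K t - l3 * t^3 - l2 * t^2 - l1 * t = K t0 - l3 * t0^3 - l2 * t0^2 - l1 * t0"
      by (rule constant_on_convex[where f="\<lambda>t. K t - l3 * t^3 - l2 * t^2 - l1 * t" and N=I, OF _ _ t I0])
         (auto intro!: derivative_eq_intros dK simp: K1, simp add: I_def)
    then show ?thesis by (simp add: l0_def)
  qed
  \<comment> \<open>The first exponent of the final formula at \<open>x = y = 0\<close>;
    \<open>S\<close> below is the part of the second exponent depending on \<open>t\<close> alone.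
    Their derivatives differ by \<open>- \<gamma>^2 / 4\<close>, which is what the equation for
    \<open>H\<close> requires.\<close>
  define \<Theta> where "\<Theta> t = c * (K1 t)^2 / q t - 3 * c^2 * K1 t * K t / (q t)^2 + 3 * c^3 * (K t)^2 / (q t)^3" for t
  define S where "S t = 3 * l3^2 * t^3 + 3 * l3 * l2 * t^2 + l2^2 * t" for t
  have d\<Theta>: "(\<Theta> has_real_derivative (K2 t)^2 / 4 - (\<gamma> t)^2 / 4) (at t)" if t: "t \<in> I" for t
    unfolding \<Theta>_def[abs_def] \<gamma>[OF t]
    using q0[OF t] by (auto intro!: derivative_eq_intros dq[OF t] dK[OF t] simp: eval_nat_numeral field_simps)
  have dS: "(S has_real_derivative (K2 t)^2 / 4) (at t)" if t: "t \<in> I" for t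
    unfolding S_def[abs_def] K2[OF t]
    by (auto intro!: derivative_eq_intros dq[OF t] simp: eval_nat_numeral field_simps)
  \<comment> \<open>The logarithmic derivative of \<open>H\<close> is that of
    \<open>q^2 exp (\<Theta> - S)\<close>, because \<open>- \<alpha> / 2 = 2 c / q\<close>;
    \<open>\<sigma>\<close> is the constant quotient.\<close>
  define \<sigma> where "\<sigma> = H t0 * exp (S t0 - \<Theta> t0) / q t0^2"
  have H\<sigma>: "H t = \<sigma> * (q t)^2 * exp (\<Theta> t - S t)" if t: "t \<in> I" for t
  proof -
    have "H t * exp (S t - \<Theta> t) / (q t)^2 = \<sigma>" unfolding \<sigma>_def
    proof (rule constant_on_convex[where f="\<lambda>t. H t * exp (S t - \<Theta> t) / (q t)^2" and N=I, OF _ _ t I0])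
      fix t assume t: "t \<in> I"
      show "((\<lambda>t. H t * exp (S t - \<Theta> t) / (q t)^2) has_real_derivative 0) (at t)"
        using q0[OF t] by (auto intro!: derivative_eq_intros dq[OF t] d\<Theta>[OF t] dS[OF t] H(3)[OF t] simp: \<alpha>[OF t] eval_nat_numeral field_simps)
    qed (simp add: I_def)
    then have "H t * (exp (S t - \<Theta> t) * exp (\<Theta> t - S t)) = \<sigma> * (q t)^2 * exp (\<Theta> t - S t)"
      using q0[OF t] by (simp add: divide_eq_eq)
    then show ?thesis by (simp flip: exp_add)
  qed
  have \<sigma>0: "\<sigma> \<noteq> 0"
    using A0[of "(t0, x0, y0)"] H(4)[of t0 x0 y0] \<delta>(1) H\<sigma>[OF I0] by (auto simp: I_def)
  have "has_symmetry_form (box4 t0 x0 y0 u0 \<delta>) \<Phi>"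
    unfolding has_symmetry_form_def
  proof (intro exI conjI)
    show "a * d - b * c = 1" by (rule det)
    show "\<sigma> \<noteq> 0" by (rule \<sigma>0)
    have "base_projection (box4 t0 x0 y0 u0 \<delta>) = box3 t0 x0 y0 \<delta>"
      unfolding base_projection_def using \<delta>(1) by (force intro!: image_eqI[where x="(_, _, _, u0)"])
    then show "solution (base_projection (box4 t0 x0 y0 u0 \<delta>)) f" using f by simp
    show "\<forall>(t, x, y, u)\<in>box4 t0 x0 y0 u0 \<delta>. c * t + d \<noteq> 0 \<and>
      \<Phi> (t, x, y, u) = symmetry_formula a b c d l0 l1 l2 l3 \<sigma> f (t, x, y, u)"
    proof (clarify)
      fix t x y u assume B: "t \<in> ball t0 \<delta>" "x \<in> ball x0 \<delta>" "y \<in> ball y0 \<delta>" "u \<in> ball u0 \<delta>"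
      then have t: "t \<in> I" by (simp add: I_def)
      note Q = q0[OF t]
      have h: "x_hat l1 l2 l3 t x = x + K1 t" "y_hat l0 l1 l2 l3 t y = y + K t"
        by (simp_all add: x_hat_def y_hat_def K1[OF t] K[OF t])
      define X Y r where "X = x + K1 t" and "Y = y + K t" and "r = inverse (q t)"
      have T: "\<tau> t = (a * t + b) / q t" using ab(1)[OF t] Q by (simp add: eq_divide_eq)
      have X: "m t * x + 3 * m1 t * y + k1 t / (m t)^2 = X / q t - 3 * c * Y / (q t)^2"
        unfolding m[OF t] m1[OF t] k1[OF t] X_def Y_def using Q by (simp add: field_simps eval_nat_numeral)
      have Y: "(m t)^3 * y + k t = Y / (q t)^3"
        unfolding m[OF t] k[OF t] Y_def using Q by (simp add: field_simps)
      have "A (t, x, y) = H t * exp (- \<alpha> t * x^2 / 4 - (\<beta> t * y + \<gamma> t) * x / 2 + \<nu> t * y^2 / 4 + \<mu> t * y / 2)"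
        using H(4)[of t x y] B t by simp
      also have "\<dots> = \<sigma> * (q t)^2 * exp (\<Theta> t - S t + (- \<alpha> t * x^2 / 4 - (\<beta> t * y + \<gamma> t) * x / 2 + \<nu> t * y^2 / 4 + \<mu> t * y / 2))"
        unfolding H\<sigma>[OF t] by (simp only: exp_add mult.assoc)
      \<comment> \<open>The left-hand side is the Taylor expansion of the right-hand side in
        \<open>x\<close> and \<open>y\<close> about the origin.\<close>
      also have "\<Theta> t - S t + (- \<alpha> t * x^2 / 4 - (\<beta> t * y + \<gamma> t) * x / 2 + \<nu> t * y^2 / 4 + \<mu> t * y / 2)
        = (c * X^2 / q t - 3 * c^2 * X * Y / (q t)^2 + 3 * c^3 * Y^2 / (q t)^3)
          + (3 * l3 * (y - t * x) - l2 * x - (3 * l3^2 * t^3 + 3 * l3 * l2 * t^2 + l2^2 * t))"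
        unfolding \<Theta>_def S_def \<alpha>[OF t] \<beta>[OF t] \<gamma>[OF t] \<nu>[OF t] \<mu>[OF t] X_def Y_def K2[OF t] K3[OF t]
          divide_inverse power_inverse[symmetric] r_def[symmetric]
        by (simp add: power2_eq_square algebra_simps)
      finally have W: "A (t, x, y) = \<sigma> * (q t)^2
        * exp (c * X^2 / q t - 3 * c^2 * X * Y / (q t)^2 + 3 * c^3 * Y^2 / (q t)^3)
        * exp (3 * l3 * (y - t * x) - l2 * x - (3 * l3^2 * t^3 + 3 * l3 * l2 * t^2 + l2^2 * t))"
        by (simp only: exp_add mult.assoc)
      have "\<Phi> (t, x, y, u) = (\<tau> t, m t * x + 3 * m1 t * y + k1 t / (m t)^2, (m t)^3 * y + k t, A (t, x, y) * (u + f (t, x, y)))"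
        using \<Phi>[of t x y u] B by (simp add: m1_def k1_def)
      then show "c * t + d \<noteq> 0 \<and> \<Phi> (t, x, y, u) = symmetry_formula a b c d l0 l1 l2 l3 \<sigma> f (t, x, y, u)"
        unfolding symmetry_formula_def Let_def prod.case h X_def[symmetric] Y_def[symmetric] q[OF t, symmetric] T X Y W using Q by simp
    qed
  qed
  then show ?thesis using that \<delta> by blast
qed

section \<open>The transformations of the given form are symmetries\<close>

definition sym_base :: "real \<Rightarrow> real \<Rightarrow> real \<Rightarrow> real \<Rightarrow> real \<Rightarrow> real \<Rightarrow> real \<Rightarrow> real \<Rightarrow> base \<Rightarrow> base" where
  "sym_base a b c d l0 l1 l2 l3 = (\<lambda>(t, x, y).
     let X = x_hat l1 l2 l3 t x; Y = y_hat l0 l1 l2 l3 t y; q = c * t + d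
     in ((a * t + b) / q, X / q - 3 * c * Y / q^2, Y / q^3))"

definition sym_factor :: "real \<Rightarrow> real \<Rightarrow> real \<Rightarrow> real \<Rightarrow> real \<Rightarrow> real \<Rightarrow> real \<Rightarrow> base \<Rightarrow> real" where
  "sym_factor c d l0 l1 l2 l3 s = (\<lambda>(t, x, y).
     let X = x_hat l1 l2 l3 t x; Y = y_hat l0 l1 l2 l3 t y; q = c * t + d
     in s * q^2 * exp (c * X^2 / q - 3 * c^2 * X * Y / q^2 + 3 * c^3 * Y^2 / q^3)
          * exp (3 * l3 * (y - t * x) - l2 * x - (3 * l3^2 * t^3 + 3 * l3 * l2 * t^2 + l2^2 * t)))"

lemma symmetry_formula_eq:
  "symmetry_formula a b c d l0 l1 l2 l3 s f (t, x, y, u)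
    = lift (sym_base a b c d l0 l1 l2 l3 (t, x, y)) (sym_factor c d l0 l1 l2 l3 s (t, x, y) * (u + f (t, x, y)))"
  by (simp add: symmetry_formula_def sym_base_def sym_factor_def Let_def)

lemma smooth_on_sym_factor:
  assumes "open D" "\<And>z. z \<in> D \<Longrightarrow> c * fst z + d \<noteq> 0"
  shows "smooth_on D (sym_factor c d l0 l1 l2 l3 s)"
  unfolding sym_factor_def Let_def x_hat_def y_hat_def case_prod_beta
  by (intro smooth_on_intros assms(1)) (use assms(2) in auto)

lemma sym_factor_nonzero: "s \<noteq> 0 \<Longrightarrow> c * t + d \<noteq> 0 \<Longrightarrow> sym_factor c d l0 l1 l2 l3 s (t, x, y) \<noteq> 0"
  by (simp add: sym_factor_def Let_def)

text \<open>The explicit factor satisfies the gauge conditions for the drift that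
  \<open>sym_base\<close> produces. Here \<open>x_hat = x + K1\<close> and
  \<open>y_hat = y + K\<close> with \<open>K1\<close> the derivative of the cubic \<open>K\<close>,
  and both exponents are merged into one function \<open>E\<close>, so that each derivative of the
  factor is a multiple of the factor.\<close>

lemma sym_factor_equations:
  fixes c d l0 l1 l2 l3 s t x y :: real
  defines "A \<equiv> sym_factor c d l0 l1 l2 l3 s"
  assumes D: "open D" "\<And>z. z \<in> D \<Longrightarrow> c * fst z + d \<noteq> 0" and z: "(t, x, y) \<in> D"
    and \<xi>: "\<xi> = 6 * l3 * t + 2 * l2 - 4 * c * x_hat l1 l2 l3 t x / (c * t + d) + 6 * c^2 * y_hat l0 l1 l2 l3 t y / (c * t + d)^2"
  shows "2 * Dx A (t, x, y) = - \<xi> * A (t, x, y)"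
    "Dt A (t, x, y) + x * Dy A (t, x, y) - \<xi> * Dx A (t, x, y) = Dx (Dx A) (t, x, y)"
proof -
  define q where "q t = c * t + d" for t
  define K where "K t = l3 * t^3 + l2 * t^2 + l1 * t + l0" for t
  define K1 where "K1 t = 3 * l3 * t^2 + 2 * l2 * t + l1" for t
  define K2 where "K2 t = 6 * l3 * t + 2 * l2" for t
  have dq: "(q has_real_derivative c) (at t)" for t unfolding q_def[abs_def] by (auto intro!: derivative_eq_intros)
  have dK: "(K has_real_derivative K1 t) (at t)" "(K1 has_real_derivative K2 t) (at t)" "(K2 has_real_derivative 6 * l3) (at t)" for t
    unfolding K_def[abs_def] K1_def[abs_def] K2_def[abs_def] by (auto intro!: derivative_eq_intros)
  define S where "S t = 3 * l3^2 * t^3 + 3 * l3 * l2 * t^2 + l2^2 * t" for t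
  have dS: "(S has_real_derivative (K2 t)^2 / 4) (at t)" for t
    unfolding S_def[abs_def] K2_def by (auto intro!: derivative_eq_intros simp: eval_nat_numeral field_simps)
  define E where "E t x y = c * (x + K1 t)^2 / q t - 3 * c^2 * (x + K1 t) * (y + K t) / (q t)^2 + 3 * c^3 * (y + K t)^2 / (q t)^3
     + (3 * l3 * y - K2 t * x / 2 - S t)" for t x y
  define \<eta> where "\<eta> t x y = K2 t - 4 * c * (x + K1 t) / q t + 6 * c^2 * (y + K t) / (q t)^2" for t x y
  have A: "A (t, x, y) = s * (q t)^2 * exp (E t x y)" for t x y
  proof -
    have "A (t, x, y) = s * (q t)^2 * exp (c * (x + K1 t)^2 / q t - 3 * c^2 * (x + K1 t) * (y + K t) / (q t)^2 + 3 * c^3 * (y + K t)^2 / (q t)^3)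
      * exp (3 * l3 * y - K2 t * x / 2 - S t)"
      unfolding A_def sym_factor_def Let_def prod.case q_def K1_def K2_def K_def S_def x_hat_def y_hat_def
      by (simp add: algebra_simps)
    then show ?thesis unfolding E_def by (simp only: exp_add mult.assoc)
  qed
  have \<xi>': "\<xi> = \<eta> t x y" unfolding \<xi> \<eta>_def x_hat_def y_hat_def K_def K1_def K2_def q_def by (simp add: algebra_simps)
  have smA: "smooth_on D A" unfolding A_def by (rule smooth_on_sym_factor[OF D])
  have q0: "q t \<noteq> 0" using D(2)[OF z] by (simp add: q_def)
  have Ax: "Dx A (t, x, y) = - \<eta> t x y / 2 * A (t, x, y)" if z: "(t, x, y) \<in> D" for t x y
  proof (rule deriv_eq_on_open[OF deriv_x[OF smA z] _ open_UNIV UNIV_I, where g="\<lambda>x. s * (q t)^2 * exp (E t x y)"])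
    have "q t \<noteq> 0" using D(2)[OF z] by (simp add: q_def)
    then have "((\<lambda>x. E t x y) has_real_derivative - \<eta> t x y / 2) (at x)"
      unfolding E_def \<eta>_def by (auto intro!: derivative_eq_intros simp: eval_nat_numeral field_simps)
    then show "((\<lambda>x. s * (q t)^2 * exp (E t x y)) has_real_derivative - \<eta> t x y / 2 * A (t, x, y)) (at x)"
      unfolding A by (auto intro!: derivative_eq_intros)
  qed (rule A)
  then show 1: "2 * Dx A (t, x, y) = - \<xi> * A (t, x, y)" using z by (simp add: \<xi>')
  have Axx: "Dx (Dx A) (t, x, y) = ((\<eta> t x y)^2 / 4 + 2 * c / q t) * A (t, x, y)"
  proof (rule deriv_eq_on_open[OF deriv_x[OF smooth_on_dd[OF smA, of "(0,1,0)"] z]])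
    show "((\<lambda>x. - \<eta> t x y / 2 * A (t, x, y)) has_real_derivative ((\<eta> t x y)^2 / 4 + 2 * c / q t) * A (t, x, y)) (at x)"
    proof -
      have "((\<lambda>x. \<eta> t x y) has_real_derivative - 4 * c / q t) (at x)"
        unfolding \<eta>_def using q0 by (auto intro!: derivative_eq_intros simp: eval_nat_numeral field_simps)
      then show ?thesis
        by (auto intro!: derivative_eq_intros deriv_x[OF smA z] simp: Ax[OF z] power2_eq_square field_simps)
    qed
    show "open ((\<lambda>x. (t, x, y)) -` D)" by (intro open_vimage D(1) continuous_intros)
  qed (use z Ax in auto)
  \<comment> \<open>The \<open>t\<close>-derivative of the exponent \<open>E\<close>; the square of
    \<open>q\<close> in the factor adds \<open>2 c / q\<close> to it.\<close>
  define e where "e = 2 * c * (x + K1 t) * K2 t / q t - c^2 * (x + K1 t)^2 / (q t)^2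
      - 3 * c^2 * (K2 t * (y + K t) + (x + K1 t) * K1 t) / (q t)^2 + 6 * c^3 * (x + K1 t) * (y + K t) / (q t)^3
      + 6 * c^3 * (y + K t) * K1 t / (q t)^3 - 9 * c^4 * (y + K t)^2 / (q t)^4 - 3 * l3 * x - (K2 t)^2 / 4"
  have At: "Dt A (t, x, y) = (2 * c / q t + e) * A (t, x, y)"
  proof (rule deriv_eq_on_open[OF deriv_t[OF smA z] _ open_UNIV UNIV_I, where g="\<lambda>t. s * (q t)^2 * exp (E t x y)"])
    have "((\<lambda>t. E t x y) has_real_derivative e) (at t)"
      unfolding E_def e_def using q0 by (auto intro!: derivative_eq_intros dq dK dS simp: eval_nat_numeral field_simps)
    then show "((\<lambda>t. s * (q t)^2 * exp (E t x y)) has_real_derivative (2 * c / q t + e) * A (t, x, y)) (at t)"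
      unfolding A using q0 by (auto intro!: derivative_eq_intros dq simp: power2_eq_square field_simps)
  qed (rule A)
  have Ay: "Dy A (t, x, y) = (- 3 * c^2 * (x + K1 t) / (q t)^2 + 6 * c^3 * (y + K t) / (q t)^3 + 3 * l3) * A (t, x, y)"
  proof (rule deriv_eq_on_open[OF deriv_y[OF smA z] _ open_UNIV UNIV_I, where g="\<lambda>y. s * (q t)^2 * exp (E t x y)"])
    have "((\<lambda>y. E t x y) has_real_derivative (- 3 * c^2 * (x + K1 t) / (q t)^2 + 6 * c^3 * (y + K t) / (q t)^3 + 3 * l3)) (at y)"
      unfolding E_def using q0 by (auto intro!: derivative_eq_intros simp: eval_nat_numeral field_simps)
    then show "((\<lambda>y. s * (q t)^2 * exp (E t x y)) has_real_derivative (- 3 * c^2 * (x + K1 t) / (q t)^2 + 6 * c^3 * (y + K t) / (q t)^3 + 3 * l3) * A (t, x, y)) (at y)"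
      unfolding A by (auto intro!: derivative_eq_intros)
  qed (rule A)
  show "Dt A (t, x, y) + x * Dy A (t, x, y) - \<xi> * Dx A (t, x, y) = Dx (Dx A) (t, x, y)"
    unfolding Axx Ax[OF z] At Ay e_def \<xi>' \<eta>_def divide_inverse power_inverse[symmetric]
    by (simp add: algebra_simps eval_nat_numeral)
qed

text \<open>Pull-back of the operator. With \<open>T\<close>, \<open>X\<close>, \<open>Y\<close> the
  components of \<open>sym_base\<close> and \<open>q = c t + d\<close>, the field
  \<open>\<partial>_t + x \<partial>_y\<close> takes \<open>T\<close> to \<open>1 / q^2\<close>,
  \<open>Y\<close> to \<open>X / q^2\<close> and \<open>X\<close> to \<open>\<xi> / q\<close>, while
  \<open>\<partial>_x\<close> acts as \<open>1 / q\<close> times the new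
  \<open>x\<close>-derivative. The drift removes the terms with the first
  \<open>x\<close>-derivative of \<open>w\<close>, and \<open>1 / q^2\<close> is common to the
  rest.\<close>

lemma kolmogorov_sym_base:
  fixes a b c d l0 l1 l2 l3 t x y :: real
  defines "\<Psi> \<equiv> sym_base a b c d l0 l1 l2 l3"
  assumes det: "a * d - b * c = 1" and D: "open D" "\<And>z. z \<in> D \<Longrightarrow> c * fst z + d \<noteq> 0" and z: "(t, x, y) \<in> D"
    and w: "open D'" "smooth_on D' w" "\<And>z. z \<in> D \<Longrightarrow> \<Psi> z \<in> D'"
    and h: "smooth_on D h" "\<And>z. z \<in> D \<Longrightarrow> w (\<Psi> z) = h z"
    and \<xi>: "\<xi> = 6 * l3 * t + 2 * l2 - 4 * c * x_hat l1 l2 l3 t x / (c * t + d) + 6 * c^2 * y_hat l0 l1 l2 l3 t y / (c * t + d)^2"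
  shows "Dt h (t, x, y) + x * Dy h (t, x, y) - \<xi> * Dx h (t, x, y) - Dx (Dx h) (t, x, y)
    = kolmogorov w (\<Psi> (t, x, y)) / (c * t + d)^2"
proof -
  define q where "q t = c * t + d" for t
  define K where "K t = l3 * t^3 + l2 * t^2 + l1 * t + l0" for t
  define K1 where "K1 t = 3 * l3 * t^2 + 2 * l2 * t + l1" for t
  define K2 where "K2 t = 6 * l3 * t + 2 * l2" for t
  have dq: "(q has_real_derivative c) (at t)" for t unfolding q_def[abs_def] by (auto intro!: derivative_eq_intros)
  have dK: "(K has_real_derivative K1 t) (at t)" "(K1 has_real_derivative K2 t) (at t)" for t
    unfolding K_def[abs_def] K1_def[abs_def] K2_def[abs_def] by (auto intro!: derivative_eq_intros)
  have \<Psi>: "\<Psi> (t, x, y) = ((a * t + b) / q t, (x + K1 t) / q t - 3 * c * (y + K t) / (q t)^2, (y + K t) / (q t)^3)" for t x y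
    by (simp add: \<Psi>_def sym_base_def Let_def x_hat_def y_hat_def q_def K_def K1_def algebra_simps)
  have \<xi>': "\<xi> = K2 t - 4 * c * (x + K1 t) / q t + 6 * c^2 * (y + K t) / (q t)^2"
    unfolding \<xi> x_hat_def y_hat_def K_def K1_def K2_def q_def by (simp add: algebra_simps)
  have q0: "q t \<noteq> 0" if "(t, x, y) \<in> D" for t x y using D(2)[OF that] by (simp add: q_def)
  note q0z = q0[OF z]
  have wd: "dd (\<alpha>, \<beta>, \<gamma>) v p = Dt v p * \<alpha> + Dx v p * \<beta> + Dy v p * \<gamma>" if "smooth_on D' v" "p \<in> D'" for \<alpha> \<beta> \<gamma> p v
    by (rule linear_base[OF linear_dd[OF smooth_on_differentiable[OF that]]])
  have pair: "((\<lambda>s. (f s, g s, k s)) has_vector_derivative (f', g', k')) (at r)"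
    if "(f has_real_derivative f') (at r)" "(g has_real_derivative g') (at r)" "(k has_real_derivative k') (at r)" for f g k :: "real \<Rightarrow> real" and f' g' k' r
    using that by (intro has_vector_derivative_Pair) (simp_all add: has_real_derivative_iff_has_vector_derivative)
  define P where "P = \<Psi> (t, x, y)"
  have P: "P \<in> D'" using w(3)[OF z] by (simp add: P_def)
  have op: "open ((\<lambda>t. (t, x, y)) -` D)" "open ((\<lambda>y. (t, x, y)) -` D)" "open ((\<lambda>x. (t, x, y)) -` D)" for t x y
    by (intro open_vimage D(1) continuous_intros)+
  define pX pY where "pX = K2 t / q t - c * (x + K1 t) / (q t)^2 - 3 * c * K1 t / (q t)^2 + 6 * c^2 * (y + K t) / (q t)^3"
    and "pY = K1 t / (q t)^3 - 3 * c * (y + K t) / (q t)^4"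
  have ht: "Dt h (t, x, y) = Dt w P * (1 / (q t)^2)
     + Dx w P * pX
     + Dy w P * pY"
  proof (rule deriv_eq_on_open[OF deriv_t[OF h(1) z] _ op(1)])
    have "((\<lambda>t. \<Psi> (t, x, y)) has_vector_derivative
      (1 / (q t)^2, pX, pY)) (at t)"
      unfolding \<Psi>
    proof (rule pair)
      have "a * q t - (a * t + b) * c = 1" using det by (simp add: q_def algebra_simps)
      then show "((\<lambda>t. (a * t + b) / q t) has_real_derivative 1 / (q t)^2) (at t)"
        using q0z by (auto intro!: derivative_eq_intros dq simp: power2_eq_square)
      show "((\<lambda>t. (x + K1 t) / q t - 3 * c * (y + K t) / (q t)^2) has_real_derivative pX) (at t)"
        unfolding pX_def using q0z by (auto intro!: derivative_eq_intros dq dK simp: eval_nat_numeral field_simps)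
      show "((\<lambda>t. (y + K t) / (q t)^3) has_real_derivative pY) (at t)"
        unfolding pY_def using q0z by (auto intro!: derivative_eq_intros dq dK simp: eval_nat_numeral field_simps)
    qed
    from dd_chain[OF w(2) w(3)[OF z] this]
    show "((\<lambda>t. w (\<Psi> (t, x, y))) has_real_derivative Dt w P * (1 / (q t)^2)
     + Dx w P * pX
     + Dy w P * pY) (at t)"
      unfolding has_real_derivative_iff_has_vector_derivative wd[OF w(2) P, symmetric] unfolding P_def .
  qed (use z h(2) in auto)
  have hy: "Dy h (t, x, y) = Dt w P * 0 + Dx w P * (- 3 * c / (q t)^2) + Dy w P * (1 / (q t)^3)"
  proof (rule deriv_eq_on_open[OF deriv_y[OF h(1) z] _ op(2)])
    have "((\<lambda>y. \<Psi> (t, x, y)) has_vector_derivative (0, - 3 * c / (q t)^2, 1 / (q t)^3)) (at y)"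
      unfolding \<Psi> by (rule pair) (use q0z in \<open>auto intro!: derivative_eq_intros simp: eval_nat_numeral field_simps\<close>)
    from dd_chain[OF w(2) w(3)[OF z] this]
    show "((\<lambda>y. w (\<Psi> (t, x, y))) has_real_derivative
       Dt w P * 0 + Dx w P * (- 3 * c / (q t)^2) + Dy w P * (1 / (q t)^3)) (at y)"
      unfolding has_real_derivative_iff_has_vector_derivative wd[OF w(2) P, symmetric] unfolding P_def .
  qed (use z h(2) in auto)
  have dx: "((\<lambda>x. v (\<Psi> (t, x, y))) has_real_derivative Dx v (\<Psi> (t, x, y)) / q t) (at x)"
    if z: "(t, x, y) \<in> D" and v: "smooth_on D' v" for t x y v
  proof -
    have d: "((\<lambda>x. \<Psi> (t, x, y)) has_vector_derivative (0, 1 / q t, 0)) (at x)"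
      unfolding \<Psi> by (rule pair) (use q0[OF z] in \<open>auto intro!: derivative_eq_intros\<close>)
    have "dd (0, 1 / q t, 0) v (\<Psi> (t, x, y)) = Dx v (\<Psi> (t, x, y)) / q t"
      by (rule trans[OF wd[OF v w(3)[OF z]]]) simp
    then show ?thesis
      using dd_chain[OF v w(3)[OF z] d] by (simp add: has_real_derivative_iff_has_vector_derivative)
  qed
  have hx: "Dx h (t, x, y) = Dx w (\<Psi> (t, x, y)) / q t" if z: "(t, x, y) \<in> D" for t x y
    by (rule deriv_eq_on_open[OF deriv_x[OF h(1) z] dx[OF z w(2)] op(3)]) (use z h(2) in auto)
  have hxx: "Dx (Dx h) (t, x, y) = Dx (Dx w) P / q t / q t"
    unfolding P_def
    by (rule deriv_eq_on_open[OF deriv_x[OF smooth_on_dd[OF h(1)] z] DERIV_cdivide[OF dx[OF z smooth_on_dd[OF w(2)]]] op(3)])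
       (use z hx in auto)
  have sP: "fst (snd P) = (x + K1 t) / q t - 3 * c * (y + K t) / (q t)^2" by (simp add: P_def \<Psi>)
  show ?thesis
    unfolding ht pX_def pY_def hy hx[OF z] hxx kolmogorov_def P_def[symmetric] sP \<xi>' q_def[symmetric] divide_inverse power_inverse[symmetric]
    by (simp add: algebra_simps eval_nat_numeral)
qed

text \<open>A pointwise statement, so that different parts of a graph may use different formulas.
  Near \<open>z\<close> the image function composed with the base map is \<open>A (v + f)\<close>.
  The pull-back and the gauge identity show that the operator applied to \<open>w\<close> at the
  image point is \<open>q^2 A\<close> times the operator applied to \<open>v\<close>, because
  \<open>f\<close> contributes nothing.\<close>

lemma symmetry_form_kolmogorov:
  assumes W: "open W" "has_symmetry_form W \<Phi>"
    and v: "open D" "smooth_on D v" and w: "open D'" "smooth_on D' w"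
    and graph: "\<Phi> ` graph_on D v \<subseteq> graph_on D' w" and z: "z \<in> D" "lift z (v z) \<in> W"
  shows "kolmogorov v z = 0 \<longleftrightarrow> kolmogorov w (base_part (\<Phi> (lift z (v z)))) = 0"
proof -
  obtain a b c d l0 l1 l2 l3 s f where det: "a * d - b * c = 1" and s: "s \<noteq> 0" and f: "solution (base_projection W) f"
    and form: "\<And>t x y u. (t, x, y, u) \<in> W \<Longrightarrow> c * t + d \<noteq> 0 \<and> \<Phi> (t, x, y, u) = symmetry_formula a b c d l0 l1 l2 l3 s f (t, x, y, u)"
    using W(2) unfolding has_symmetry_form_def by blast
  define \<Psi> where "\<Psi> = sym_base a b c d l0 l1 l2 l3"
  define A where "A = sym_factor c d l0 l1 l2 l3 s"
  \<comment> \<open>The part of the domain whose graph lies in \<open>W\<close>; it is open by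
    continuity of \<open>v\<close>, which is all that derivatives at \<open>z\<close> need.\<close>
  define N where "N = {z \<in> D. lift z (v z) \<in> W}"
  have "continuous_on D (\<lambda>z. lift z (v z))"
    by (intro smooth_on_continuous_on smooth_on_lift smooth_on_ident v)
  then have N: "open N" unfolding N_def using continuous_open_preimage[OF _ v(1) W(1)] by (simp add: vimage_def Int_def conj_commute)
  have NW: "N \<subseteq> base_projection W" unfolding N_def base_projection_eq by (force intro: image_eqI[where x="lift _ _"])
  have N0: "c * fst z + d \<noteq> 0" and F: "\<Phi> (lift z (v z)) = lift (\<Psi> z) (A z * (v z + f z))" if "z \<in> N" for z
    using form[of "fst z" "fst (snd z)" "snd (snd z)" "v z"] that
    by (cases z; simp add: N_def symmetry_formula_eq \<Psi>_def A_def)+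
  have w': "\<Psi> z \<in> D'" "w (\<Psi> z) = A z * (v z + f z)" if "z \<in> N" for z
  proof -
    have "lift (\<Psi> z) (A z * (v z + f z)) \<in> graph_on D' w"
      using graph that unfolding F[OF that, symmetric] by (auto simp: N_def graph_on_eq)
    then obtain z' where "z' \<in> D'" "lift (\<Psi> z) (A z * (v z + f z)) = lift z' (w z')" unfolding graph_on_eq by auto
    then show "\<Psi> z \<in> D'" "w (\<Psi> z) = A z * (v z + f z)" by (metis lift_simps(4), metis lift_simps(4,5))
  qed
  have smf: "smooth_on N f" "kolmogorov f z = 0" if "z \<in> N" for z
    using f NW that smooth_on_subset unfolding solution_iff by blast+
  have zN: "z \<in> N" using z by (simp add: N_def)
  have smv: "smooth_on N v" by (rule smooth_on_subset[OF v(2)]) (auto simp: N_def)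
  have smg: "smooth_on N (\<lambda>z. v z + f z)" by (intro smooth_on_add N smv smf(1)[OF zN])
  have smA: "smooth_on N A" unfolding A_def by (rule smooth_on_sym_factor[OF N N0])
  have smh: "smooth_on N (\<lambda>z. A z * (v z + f z))" by (intro smooth_on_mult N smA smg)
  obtain t x y where z_eq: "z = (t, x, y)" by (cases z)
  define \<xi> where "\<xi> = 6 * l3 * t + 2 * l2 - 4 * c * x_hat l1 l2 l3 t x / (c * t + d) + 6 * c^2 * y_hat l0 l1 l2 l3 t y / (c * t + d)^2"
  note zN' = zN[unfolded z_eq]
  have "kolmogorov w (\<Psi> z) / (c * t + d)^2 = A z * kolmogorov (\<lambda>z. v z + f z) z"
    using kolmogorov_sym_base[OF det N N0 zN' w(1,2) w'(1)[unfolded \<Psi>_def] smh w'(2)[unfolded \<Psi>_def] \<xi>_def, folded \<Psi>_def]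
      gauge_identity[OF N smA smg zN, of \<xi> "\<lambda>z. A z * (v z + f z)"] sym_factor_equations[OF N N0 zN' \<xi>_def, of s]
    by (simp add: z_eq A_def)
  moreover have "kolmogorov (\<lambda>z. v z + f z) z = kolmogorov v z" using kolmogorov_add[OF N smv smf(1)[OF zN] zN] smf(2)[OF zN] by simp
  moreover have "A z \<noteq> 0" "c * t + d \<noteq> 0"
    using N0[OF zN] s sym_factor_nonzero by (auto simp: A_def z_eq)
  ultimately have "kolmogorov v z = 0 \<longleftrightarrow> kolmogorov w (\<Psi> z) = 0" by auto
  then show ?thesis unfolding F[OF zN] by simp
qed

text \<open>Being a solution is a condition at each point, and the base parts of the image graph
  exhaust \<open>D'\<close>, so the pointwise equivalence is enough in both directions.\<close>

lemma maps_equation_if_local_form: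
  assumes "\<And>p. p \<in> U \<Longrightarrow> \<exists>W. open W \<and> p \<in> W \<and> W \<subseteq> U \<and> has_symmetry_form W \<Phi>"
  shows "maps_equation_to_itself U \<Phi>"
  unfolding maps_equation_to_itself_def
proof (intro allI impI, elim conjE)
  fix D v D' w
  assume *: "open D" "smooth_on D v" "open D'" "smooth_on D' w" "graph_on D v \<subseteq> U" "\<Phi> ` graph_on D v = graph_on D' w"
  have eq: "kolmogorov v z = 0 \<longleftrightarrow> kolmogorov w (base_part (\<Phi> (lift z (v z)))) = 0" if "z \<in> D" for z
  proof -
    have "lift z (v z) \<in> U" using that *(5) by (auto simp: graph_on_eq)
    from assms[OF this] obtain W where "open W" "lift z (v z) \<in> W" "has_symmetry_form W \<Phi>" by blast
    then show ?thesis using symmetry_form_kolmogorov[OF _ _ *(1-4)] *(6) that by blast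
  qed
  have "(\<lambda>z. base_part (\<Phi> (lift z (v z)))) ` D = base_part ` (\<Phi> ` graph_on D v)" by (auto simp: graph_on_eq image_image)
  also have "\<dots> = D'" unfolding *(6) by (auto simp: graph_on_eq image_image)
  finally have "(\<forall>z\<in>D. kolmogorov v z = 0) \<longleftrightarrow> (\<forall>z\<in>D'. kolmogorov w z = 0)" using eq by blast
  then show "solution D v \<longleftrightarrow> solution D' w" using *(1-4) by (simp add: solution_iff)
qed

section \<open>Local and global descriptions of symmetries\<close>

lemma open_base_projection:
  assumes "open U" shows "open (base_projection U)"
proof (subst open_subopen, intro ballI)
  fix z assume "z \<in> base_projection U"
  then obtain t x y u where z: "z = (t, x, y)" "(t, x, y, u) \<in> U" by (auto simp: base_projection_def)
  obtain \<delta> where \<delta>: "\<delta> > 0" "box4 t x y u \<delta> \<subseteq> U"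
    using open_total_box[OF assms z(2)] by blast
  have "box3 t x y \<delta> \<subseteq> base_projection U"
  proof
    fix w assume "w \<in> box3 t x y \<delta>"
    then have "lift w u \<in> U" using \<delta> by (cases w) auto
    then show "w \<in> base_projection U" unfolding base_projection_eq by (metis image_eqI lift_simps(4))
  qed
  moreover have "open (box3 t x y \<delta>)" by (intro open_Times open_ball)
  ultimately show "\<exists>T. open T \<and> z \<in> T \<and> T \<subseteq> base_projection U" using z(1) \<delta>(1) by (metis centre_in_ball mem_Times_iff fst_conv snd_conv)
qed

section \<open>Transformations of the given form are local diffeomorphisms\<close>

text \<open>By the determinant condition \<open>a - c T = 1 / (c t + d)\<close> for the new time
  \<open>T\<close>. The inverse fractional linear map therefore has the denominator
  \<open>a - c T\<close>, and the formulas for the new \<open>x\<close> and \<open>y\<close> can be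
  solved for \<open>x_hat\<close> and \<open>y_hat\<close>.\<close>

lemma sym_base_inverse:
  fixes a b c d l0 l1 l2 l3 :: real
  assumes det: "a * d - b * c = 1"
  defines "\<Psi> \<equiv> sym_base a b c d l0 l1 l2 l3"
  obtains g where "smooth_on {Z. a - c * fst Z \<noteq> 0} g"
    "\<And>z. c * fst z + d \<noteq> 0 \<Longrightarrow> a - c * fst (\<Psi> z) \<noteq> 0 \<and> g (\<Psi> z) = z"
    "\<And>Z. a - c * fst Z \<noteq> 0 \<Longrightarrow> c * fst (g Z) + d \<noteq> 0 \<and> \<Psi> (g Z) = Z"
proof -
  define \<tau> where "\<tau> Z = (d * fst Z - b) / (a - c * fst Z)" for Z :: base
  define g where "g Z = (\<tau> Z,
     fst (snd Z) / (a - c * fst Z) + 3 * c * snd (snd Z) / (a - c * fst Z)^2 - (3 * l3 * (\<tau> Z)^2 + 2 * l2 * \<tau> Z + l1),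
     snd (snd Z) / (a - c * fst Z)^3 - (l3 * (\<tau> Z)^3 + l2 * (\<tau> Z)^2 + l1 * \<tau> Z + l0))" for Z :: base
  have o: "open {Z :: base. a - c * fst Z \<noteq> 0}"
    by (intro open_Collect_neq continuous_intros)
  have 1: "smooth_on {Z. a - c * fst Z \<noteq> 0} g"
    unfolding g_def[abs_def] \<tau>_def by (intro smooth_on_intros o) auto
  have 2: "a - c * fst (\<Psi> z) \<noteq> 0 \<and> g (\<Psi> z) = z" if q: "c * fst z + d \<noteq> 0" for z
  proof (cases z)
    case (fields t x y)
    define q where "q = c * t + d"
    have q0: "q \<noteq> 0" using q by (simp add: q_def fields)
    have f: "fst (\<Psi> z) = (a * t + b) / q" by (simp add: \<Psi>_def sym_base_def fields Let_def q_def)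
    have n: "a * q - c * (a * t + b) = 1" "d * (a * t + b) - b * q = t" using det unfolding q_def by algebra+
    have p: "a - c * ((a * t + b) / q) = 1 / q" using n(1) q0 by (simp add: field_simps)
    have "(d * ((a * t + b) / q) - b) * q = t" using n(2) q0 by (simp add: field_simps)
    then have \<tau>: "\<tau> (\<Psi> z) = t" unfolding \<tau>_def f p by simp
    define X Y where "X = x_hat l1 l2 l3 t x" and "Y = y_hat l0 l1 l2 l3 t y"
    have \<Psi>z: "fst (snd (\<Psi> z)) = X / q - 3 * c * Y / q^2" "snd (snd (\<Psi> z)) = Y / q^3"
      by (simp_all add: \<Psi>_def sym_base_def fields Let_def q_def X_def Y_def)
    have "(X / q - 3 * c * Y / q^2) / (1 / q) + 3 * c * (Y / q^3) / (1 / q)^2 = X" "Y / q^3 / (1 / q)^3 = Y"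
      using q0 by (simp_all add: field_simps power2_eq_square power3_eq_cube)
    then show ?thesis
      using q0 unfolding g_def \<tau> \<Psi>z f p by (simp add: fields X_def Y_def x_hat_def y_hat_def)
  qed
  have 3: "c * fst (g Z) + d \<noteq> 0 \<and> \<Psi> (g Z) = Z" if p: "a - c * fst Z \<noteq> 0" for Z
  proof (cases Z)
    case (fields T X Y)
    define p where "p = a - c * T"
    have p0: "p \<noteq> 0" using p by (simp add: p_def fields)
    define t where "t = (d * T - b) / p"
    have \<tau>: "\<tau> Z = t" by (simp add: \<tau>_def fields t_def p_def)
    have n: "c * (d * T - b) + d * p = 1" "a * (d * T - b) + b * p = T" using det unfolding p_def by algebra+
    have q: "c * t + d = 1 / p" using n(1) p0 by (simp add: t_def field_simps)
    have "(a * t + b) * p = T" using n(2) p0 by (simp add: t_def field_simps)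
    then have T: "(a * t + b) / (c * t + d) = T" unfolding q by simp
    obtain x y where gZ: "g Z = (t, x, y)" by (simp add: g_def \<tau>)
    have h: "x_hat l1 l2 l3 t x = X / p + 3 * c * Y / p^2" "y_hat l0 l1 l2 l3 t y = Y / p^3"
      using gZ unfolding g_def \<tau> by (auto simp: fields p_def x_hat_def y_hat_def)
    have "(X / p + 3 * c * Y / p^2) / (1 / p) - 3 * c * (Y / p^3) / (1 / p)^2 = X" "Y / p^3 / (1 / p)^3 = Y"
      using p0 by (simp_all add: field_simps power2_eq_square power3_eq_cube)
    then show ?thesis
      using p0 T unfolding \<Psi>_def sym_base_def gZ Let_def prod.case h fst_conv q by (simp add: fields)
  qed
  show ?thesis using that 1 2 3 by blast
qed

text \<open>One formula on the whole of \<open>U\<close> yields injectivity through an explicit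
  inverse. The care goes into domains: \<open>f\<close> is controlled only on the projection of
  \<open>U\<close>, so the image has to be described as an open set on which the candidate inverse
  is smooth.\<close>

lemma point_transformation_if_form:
  assumes U: "open U" and form: "has_symmetry_form U \<Phi>"
  shows "point_transformation U \<Phi>"
proof -
  obtain a b c d l0 l1 l2 l3 s f where det: "a * d - b * c = 1" and s: "s \<noteq> 0" and f: "solution (base_projection U) f"
    and form: "\<And>t x y u. (t, x, y, u) \<in> U \<Longrightarrow> c * t + d \<noteq> 0 \<and> \<Phi> (t, x, y, u) = symmetry_formula a b c d l0 l1 l2 l3 s f (t, x, y, u)"
    using form unfolding has_symmetry_form_def by blast
  define \<Psi> where "\<Psi> = sym_base a b c d l0 l1 l2 l3"
  define A where "A = sym_factor c d l0 l1 l2 l3 s"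
  define B where "B = base_projection U"
  have B: "open B" unfolding B_def by (rule open_base_projection[OF U])
  have smf: "smooth_on B f" using f by (simp add: B_def solution_iff)
  have BU: "base_part p \<in> B" if "p \<in> U" for p using that by (auto simp: B_def base_projection_eq)
  obtain g where g: "smooth_on {Z. a - c * fst Z \<noteq> 0} g"
    "\<And>z. c * fst z + d \<noteq> 0 \<Longrightarrow> a - c * fst (\<Psi> z) \<noteq> 0 \<and> g (\<Psi> z) = z"
    "\<And>Z. a - c * fst Z \<noteq> 0 \<Longrightarrow> c * fst (g Z) + d \<noteq> 0 \<and> \<Psi> (g Z) = Z"
    using sym_base_inverse[OF det] unfolding \<Psi>_def by blast
  have q0: "c * fst (base_part p) + d \<noteq> 0"
    and \<Phi>: "\<Phi> p = lift (\<Psi> (base_part p)) (A (base_part p) * (fibre_part p + f (base_part p)))" if "p \<in> U" for p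
    using form that by (cases p; simp add: symmetry_formula_eq \<Psi>_def A_def)+
  have qB: "c * fst z + d \<noteq> 0" if "z \<in> B" for z using that q0 by (auto simp: B_def base_projection_eq)
  have A0: "A z \<noteq> 0" if "c * fst z + d \<noteq> 0" for z
    using that sym_factor_nonzero[OF s] by (cases z) (simp add: A_def)
  have smA: "smooth_on B A" unfolding A_def by (rule smooth_on_sym_factor[OF B qB])
  have sm\<Psi>: "smooth_on B \<Psi>"
    unfolding \<Psi>_def sym_base_def Let_def x_hat_def y_hat_def case_prod_beta
    by (intro smooth_on_intros B) (use qB in auto)
  have smbp: "smooth_on S base_part" "smooth_on S fibre_part" if "open S" for S
    using smooth_on_bounded_linear[OF bounded_linear_base_part that smooth_on_ident[OF that]]
      smooth_on_bounded_linear[OF bounded_linear_fibre_part that smooth_on_ident[OF that]] by simp_all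
  have comp: "smooth_on U (\<lambda>p. h (base_part p))" if "smooth_on B h" for h :: "base \<Rightarrow> 'c::real_normed_vector"
    by (rule smooth_on_compose[OF U B that smbp(1)[OF U] BU])
  have "smooth_on U (\<lambda>p. lift (\<Psi> (base_part p)) (A (base_part p) * (fibre_part p + f (base_part p))))"
    by (intro smooth_on_lift smooth_on_mult smooth_on_add U comp smA smf sm\<Psi> smbp)
  then have sm\<Phi>: "smooth_on U \<Phi>" by (rule iffD2[OF smooth_on_cong[OF U \<Phi>], rotated]) simp
  \<comment> \<open>\<open>V0\<close>, \<open>V1\<close>, \<open>V\<close> and \<open>V2\<close>
    restrict the target until \<open>g\<close> is smooth, \<open>g\<close> lands in the domain of
    \<open>f\<close>, and the candidate preimage lies in \<open>U\<close>. Each set is an open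
    preimage under a map smooth on the previous one, and the last is the image of
    \<open>U\<close>.\<close>
  define V0 where "V0 = {Z :: base. a - c * fst Z \<noteq> 0}"
  have V0: "open V0" unfolding V0_def by (intro open_Collect_neq continuous_intros)
  have gV0: "smooth_on V0 g" using g(1) by (simp add: V0_def)
  define V1 where "V1 = V0 \<inter> g -` B"
  have V1: "open V1" unfolding V1_def by (rule continuous_open_preimage[OF smooth_on_continuous_on[OF gV0] V0 B])
  define V where "V = base_part -` V1"
  have V: "open V" unfolding V_def
    by (rule open_vimage[OF V1]) (rule smooth_on_continuous_on[OF smbp(1)[OF open_UNIV]])
  define G where "G P = lift (g (base_part P)) (fibre_part P / A (g (base_part P)) - f (g (base_part P)))" for P
  have gV: "smooth_on V (\<lambda>P. g (base_part P))"
    by (rule smooth_on_compose[OF V V0 gV0 smbp(1)[OF V]]) (simp add: V_def V1_def)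
  have compV: "smooth_on V (\<lambda>P. h (g (base_part P)))" if "smooth_on B h" for h :: "base \<Rightarrow> real"
    by (rule smooth_on_compose[OF V B that gV]) (simp add: V_def V1_def)
  have smG: "smooth_on V G" unfolding G_def[abs_def]
    by (intro smooth_on_lift smooth_on_divide smooth_on_diff V gV compV smA smf smbp)
       (use A0 qB in \<open>auto simp: V_def V1_def\<close>)
  define V2 where "V2 = V \<inter> G -` U"
  have V2: "open V2" unfolding V2_def by (rule continuous_open_preimage[OF smooth_on_continuous_on[OF smG] V U])
  have G\<Phi>: "G (\<Phi> p) = p" "\<Phi> p \<in> V2" if p: "p \<in> U" for p
  proof -
    have 1: "g (base_part (\<Phi> p)) = base_part p" "a - c * fst (base_part (\<Phi> p)) \<noteq> 0"
      using g(2)[OF q0[OF p]] by (simp_all add: \<Phi>[OF p])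
    show 2: "G (\<Phi> p) = p" unfolding G_def 1 using A0[OF q0[OF p]] by (simp add: \<Phi>[OF p])
    show "\<Phi> p \<in> V2" using 1 2 BU[OF p] p by (simp add: V2_def V_def V1_def V0_def)
  qed
  have \<Phi>G: "\<Phi> (G P) = P" "G P \<in> U" if P: "P \<in> V2" for P
  proof -
    show 1: "G P \<in> U" using P by (simp add: V2_def)
    have 2: "a - c * fst (base_part P) \<noteq> 0" using P by (simp add: V2_def V_def V1_def V0_def)
    have "base_part (G P) = g (base_part P)" by (simp add: G_def)
    then show "\<Phi> (G P) = P" unfolding \<Phi>[OF 1] using g(3)[OF 2] A0[of "g (base_part P)"] by (simp add: G_def)
  qed
  have inj: "inj_on \<Phi> U" using G\<Phi>(1) by (rule inj_on_inverseI)
  have im: "\<Phi> ` U = V2"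
  proof (intro equalityI subsetI)
    fix P assume P: "P \<in> V2"
    show "P \<in> \<Phi> ` U" using imageI[OF \<Phi>G(2)[OF P], of \<Phi>] \<Phi>G(1)[OF P] by simp
  qed (use G\<Phi>(2) in auto)
  have inv: "inv_into U \<Phi> P = G P" if "P \<in> V2" for P
    using inv_into_f_f[OF inj \<Phi>G(2)[OF that]] \<Phi>G(1)[OF that] by simp
  have "smooth_on V2 G" by (rule smooth_on_subset[OF smG]) (simp add: V2_def)
  then have "smooth_on V2 (inv_into U \<Phi>)" using smooth_on_cong[OF V2, of "inv_into U \<Phi>" G] inv by simp
  then show ?thesis unfolding point_transformation_def im using U sm\<Phi> inj V2 by blast
qed

section \<open>Uniqueness of the constants and gluing\<close>

lemma cubic_zero_on_ball:
  fixes a b c e x0 \<delta> :: real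
  assumes "\<delta> > 0" "\<And>x. x \<in> ball x0 \<delta> \<Longrightarrow> a + b * x + c * x^2 + e * x^3 = 0"
  shows "a = 0" "b = 0" "c = 0" "e = 0"
proof -
  define h where "h = \<delta> / 4"
  have h: "h > 0" "2 * h < \<delta>" using assms(1) by (auto simp: h_def)
  have "a + b * (x0 + 2*h) + c * (x0 + 2*h)^2 + e * (x0 + 2*h)^3 = 0" "a + b * (x0 - 2*h) + c * (x0 - 2*h)^2 + e * (x0 - 2*h)^3 = 0"
    "a + b * (x0 + h) + c * (x0 + h)^2 + e * (x0 + h)^3 = 0" "a + b * (x0 - h) + c * (x0 - h)^2 + e * (x0 - h)^3 = 0"
    using assms(2)[of "x0 + 2*h"] assms(2)[of "x0 - 2*h"] assms(2)[of "x0 + h"] assms(2)[of "x0 - h"] h by (auto simp: dist_real_def)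
  \<comment> \<open>The difference of the values at \<open>x0 + 2 h\<close> and
    \<open>x0 - 2 h\<close>, minus twice the difference at \<open>x0 + h\<close> and
    \<open>x0 - h\<close>, removes every term but the cubic one.\<close>
  then have "12 * e * h^3 = 0" by algebra
  then show e: "e = 0" using h by simp
  show "a = 0" "b = 0" "c = 0"
    using quadratic_zero_on_ball[where ?x0.0=x0, OF assms(1), of a b c] assms(2) by (auto simp: e)
qed

text \<open>The new \<open>x\<close> increases in \<open>x\<close> at the rate \<open>1 / q\<close>,
  which determines \<open>q\<close> with its sign, so that \<open>(a, b, c, d)\<close> is not
  confused with its negative. The new \<open>t\<close> then gives \<open>a\<close> and
  \<open>b\<close>, the new \<open>y\<close> the coefficients of the cubic, and the rate of growth
  in \<open>u\<close> gives \<open>s\<close>. The values of \<open>f\<close> and \<open>f'\<close>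
  drop out of that rate.\<close>

lemma symmetry_formula_unique:
  assumes \<delta>: "\<delta> > 0" and s: "s \<noteq> 0"
    and eq: "\<And>t x y u. (t, x, y, u) \<in> box4 t0 x0 y0 u0 \<delta> \<Longrightarrow> c * t + d \<noteq> 0 \<and> c' * t + d' \<noteq> 0 \<and>
       symmetry_formula a b c d l0 l1 l2 l3 s f (t, x, y, u) = symmetry_formula a' b' c' d' l0' l1' l2' l3' s' f' (t, x, y, u)"
  shows "(a, b, c, d, l0, l1, l2, l3, s) = (a', b', c', d', l0', l1', l2', l3', s')"
proof -
  define \<eta> where "\<eta> = \<delta> / 2"
  have \<eta>: "\<eta> > 0" "x0 + \<eta> \<in> ball x0 \<delta>" "u0 + \<eta> \<in> ball u0 \<delta>" "x0 \<in> ball x0 \<delta>" "y0 \<in> ball y0 \<delta>" "u0 \<in> ball u0 \<delta>"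
    "t0 \<in> ball t0 \<delta>" using \<delta> by (auto simp: \<eta>_def dist_real_def)
  have q: "c * t + d \<noteq> 0" "c' * t + d' \<noteq> 0" if "t \<in> ball t0 \<delta>" for t
    using eq[of t x0 y0 u0] that \<eta> by auto
  have qq: "c * t + d = c' * t + d'" if t: "t \<in> ball t0 \<delta>" for t
  proof -
    have *: "x_hat l1 l2 l3 t x / (c * t + d) - 3 * c * y_hat l0 l1 l2 l3 t y0 / (c * t + d)^2
      = x_hat l1' l2' l3' t x / (c' * t + d') - 3 * c' * y_hat l0' l1' l2' l3' t y0 / (c' * t + d')^2" if "x \<in> ball x0 \<delta>" for x
      using eq[of t x y0 u0] t that \<eta> by (simp add: symmetry_formula_def Let_def)
    have "x_hat l1 l2 l3 t (x0 + \<eta>) / (c * t + d) - x_hat l1 l2 l3 t x0 / (c * t + d)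
      = x_hat l1' l2' l3' t (x0 + \<eta>) / (c' * t + d') - x_hat l1' l2' l3' t x0 / (c' * t + d')"
      using *[OF \<eta>(2)] *[OF \<eta>(4)] by linarith
    then have "\<eta> / (c * t + d) = \<eta> / (c' * t + d')" unfolding diff_divide_distrib[symmetric] by (simp add: x_hat_def)
    then show ?thesis using \<eta>(1) q[OF t] by (simp add: field_simps)
  qed
  have "(d - d') + (c - c') * t + 0 * t^2 = 0" if "t \<in> ball t0 \<delta>" for t
    using qq[OF that] by (simp add: algebra_simps)
  from quadratic_zero_on_ball[where ?x0.0=t0, OF \<delta> this] have cd: "c' = c" "d' = d" by auto
  have "(b - b') + (a - a') * t + 0 * t^2 = 0" if t: "t \<in> ball t0 \<delta>" for t
    using eq[of t x0 y0 u0] t \<eta> q[OF t] by (simp add: symmetry_formula_def Let_def cd algebra_simps)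
  from quadratic_zero_on_ball[where ?x0.0=t0, OF \<delta> this] have ab: "a' = a" "b' = b" by auto
  have "(l0 - l0') + (l1 - l1') * t + (l2 - l2') * t^2 + (l3 - l3') * t^3 = 0" if t: "t \<in> ball t0 \<delta>" for t
  proof -
    have "y_hat l0 l1 l2 l3 t y0 / (c * t + d)^3 = y_hat l0' l1' l2' l3' t y0 / (c * t + d)^3"
      using eq[of t x0 y0 u0] t \<eta> by (auto simp: symmetry_formula_def Let_def cd)
    then show ?thesis using q[OF t] by (simp add: y_hat_def algebra_simps)
  qed
  from cubic_zero_on_ball[where ?x0.0=t0, OF \<delta> this] have l: "l0' = l0" "l1' = l1" "l2' = l2" "l3' = l3" by auto
  define z where "z = (t0, x0, y0)"
  have *: "sym_factor c d l0 l1 l2 l3 s z * (u + f z) = sym_factor c d l0 l1 l2 l3 s' z * (u + f' z)" if "u \<in> ball u0 \<delta>" for u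
    using eq[of t0 x0 y0 u] that \<eta> unfolding cd ab l symmetry_formula_eq z_def by (metis lift_simps(5) mem_Sigma_iff)
  have "sym_factor c d l0 l1 l2 l3 s z * \<eta> = sym_factor c d l0 l1 l2 l3 s' z * \<eta>"
    using *[OF \<eta>(3)] *[OF \<eta>(6)] by (simp add: algebra_simps)
  then have "sym_factor c d l0 l1 l2 l3 s z = sym_factor c d l0 l1 l2 l3 s' z" using \<eta>(1) by simp
  then have "s' = s" using q[OF \<eta>(7)] by (simp add: sym_factor_def z_def Let_def)
  then show ?thesis using ab cd l by simp
qed

text \<open>Neighbouring local formulas overlap in a box and therefore share their constants, which
  are thus constant on the connected \<open>U\<close>. The local functions \<open>f\<close> are all
  read off from \<open>\<Phi>\<close>, so they agree on overlaps; along a connected fibre the value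
  is constant, and \<open>f\<close> descends to the projection.\<close>

lemma global_form:
  assumes U: "open U" "connected U" "\<And>t x y. connected {u. (t, x, y, u) \<in> U}"
    and loc: "\<And>p. p \<in> U \<Longrightarrow> \<exists>W. open W \<and> p \<in> W \<and> W \<subseteq> U \<and> has_symmetry_form W \<Phi>"
  shows "has_symmetry_form U \<Phi>"
proof (cases "U = {}")
  case True
  \<comment> \<open>On the empty domain any admissible parameters serve; those of the identity are
    taken.\<close>
  have *: "solution {} (\<lambda>z. 0)" by (simp add: solution_iff smooth_on_const)
  show ?thesis unfolding True has_symmetry_form_def
    by (rule exI[of _ 1], rule exI[of _ 0], rule exI[of _ 0], rule exI[of _ 1], rule exI[of _ 0], rule exI[of _ 0],
        rule exI[of _ 0], rule exI[of _ 0], rule exI[of _ 1], rule exI[of _ "\<lambda>z. 0"]) (simp add: base_projection_def *)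
next
  case False
  define formed where "formed = (\<lambda>(a, b, c, d, l0, l1, l2, l3, s) f W. a * d - b * c = 1 \<and> s \<noteq> 0 \<and> solution (base_projection W) f \<and>
     (\<forall>(t, x, y, u)\<in>W. c * t + d \<noteq> 0 \<and> \<Phi> (t, x, y, u) = symmetry_formula a b c d l0 l1 l2 l3 s f (t, x, y, u)))"
  have "\<exists>\<pi> f W. open W \<and> p \<in> W \<and> W \<subseteq> U \<and> formed \<pi> f W" if "p \<in> U" for p
  proof -
    note p = that
    obtain W where W: "open W" "p \<in> W" "W \<subseteq> U" "has_symmetry_form W \<Phi>" using loc[OF p] by blast
    obtain a b c d l0 l1 l2 l3 s f where "formed (a, b, c, d, l0, l1, l2, l3, s) f W"
      using W(4) unfolding has_symmetry_form_def formed_def prod.case by blast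
    then show ?thesis using W(1-3) by blast
  qed
  then obtain \<pi> F W where W: "open (W p)" "p \<in> W p" "W p \<subseteq> U" "formed (\<pi> p) (F p) (W p)" if "p \<in> U" for p by metis
  \<comment> \<open>The point \<open>p'\<close> lies in its own neighbourhood as well as in that of
    \<open>p\<close>, so both formulas hold on a box around it.\<close>
  have uniq: "\<pi> p = \<pi> p'" if p: "p \<in> U" "p' \<in> W p" for p p'
  proof -
    have p': "p' \<in> U" using W(3) p by blast
    obtain t x y u where p'_eq: "p' = (t, x, y, u)" by (cases p')
    have "open (W p \<inter> W p')" "(t, x, y, u) \<in> W p \<inter> W p'" using W(1,2)[OF p(1)] W(1,2)[OF p'] p(2) p'_eq by auto
    from open_total_box[OF this] obtain \<delta> where \<delta>: "\<delta> > 0" "box4 t x y u \<delta> \<subseteq> W p \<inter> W p'" by blast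
    obtain a b c d l0 l1 l2 l3 s where 1: "\<pi> p = (a, b, c, d, l0, l1, l2, l3, s)" by (metis prod.exhaust)
    obtain a' b' c' d' l0' l1' l2' l3' s' where 2: "\<pi> p' = (a', b', c', d', l0', l1', l2', l3', s')" by (metis prod.exhaust)
    show ?thesis unfolding 1 2
    proof (rule symmetry_formula_unique[OF \<delta>(1)])
      show "s \<noteq> 0" using W(4)[OF p(1)] by (simp add: formed_def 1)
      fix t' x' y' u' assume "(t', x', y', u') \<in> box4 t x y u \<delta>"
      then have m: "(t', x', y', u') \<in> W p" "(t', x', y', u') \<in> W p'" using \<delta>(2) by auto
      show "c * t' + d \<noteq> 0 \<and> c' * t' + d' \<noteq> 0 \<and> symmetry_formula a b c d l0 l1 l2 l3 s (F p) (t', x', y', u')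
         = symmetry_formula a' b' c' d' l0' l1' l2' l3' s' (F p') (t', x', y', u')"
        using W(4)[OF p(1)] W(4)[OF p'] m unfolding formed_def 1 2 prod.case by (metis (mono_tags, lifting) case_prodD)
    qed
  qed
  obtain p0 where p0: "p0 \<in> U" using False by blast
  have const: "\<pi> p = \<pi> p0" if "p \<in> U" for p
  proof (rule connected_local_const[OF U(2) that p0, where f=\<pi>], intro ballI)
    fix q assume q: "q \<in> U"
    show "\<forall>\<^sub>F r in at q within U. \<pi> q = \<pi> r"
      unfolding eventually_at_topological
      by (intro exI[of _ "W q"] conjI W(1,2)[OF q] ballI impI) (rule uniq[OF q])
  qed
  obtain a b c d l0 l1 l2 l3 s where \<pi>: "\<pi> p0 = (a, b, c, d, l0, l1, l2, l3, s)" by (metis prod.exhaust)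
  have form: "a * d - b * c = 1" "s \<noteq> 0" "solution (base_projection (W p)) (F p)"
    "\<And>t x y u. (t, x, y, u) \<in> W p \<Longrightarrow> c * t + d \<noteq> 0 \<and> \<Phi> (t, x, y, u) = symmetry_formula a b c d l0 l1 l2 l3 s (F p) (t, x, y, u)"
    if "p \<in> U" for p
    using W(4)[OF that] unfolding const[OF that] \<pi> formed_def by auto
  define A where "A = sym_factor c d l0 l1 l2 l3 s"
  \<comment> \<open>The formula solved for \<open>f\<close>, as a function on the total space. Its
    values off \<open>U\<close> are irrelevant.\<close>
  define \<phi> where "\<phi> p = fibre_part (\<Phi> p) / A (base_part p) - fibre_part p" for p
  have \<phi>: "\<phi> p' = F p (base_part p')" if "p \<in> U" "p' \<in> W p" for p p'
    using form(4)[OF that(1)] that(2) sym_factor_nonzero[OF form(2)[OF that(1)]]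
    by (cases p') (simp add: \<phi>_def A_def symmetry_formula_eq)
  have \<phi>_fibre: "\<phi> (lift z u) = \<phi> (lift z u')" if u: "lift z u \<in> U" "lift z u' \<in> U" for z u u'
  proof -
    obtain t x y where z: "z = (t, x, y)" by (cases z)
    show ?thesis
    proof (rule connected_local_const[OF U(3)[of t x y], where f="\<lambda>u. \<phi> (lift z u)"])
      show "\<forall>r\<in>{u. (t, x, y, u) \<in> U}. \<forall>\<^sub>F v in at r within {u. (t, x, y, u) \<in> U}. \<phi> (lift z r) = \<phi> (lift z v)"
      proof
        fix r assume r: "r \<in> {u. (t, x, y, u) \<in> U}"
        then have rU: "lift z r \<in> U" by (simp add: z)
        have "open ((\<lambda>v. lift z v) -` W (lift z r))"
          unfolding lift_def by (intro open_vimage continuous_intros W(1)[OF rU, unfolded lift_def])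
        moreover have "r \<in> (\<lambda>v. lift z v) -` W (lift z r)" using W(2)[OF rU] by simp
        moreover have "\<phi> (lift z r) = \<phi> (lift z v)" if "v \<in> (\<lambda>v. lift z v) -` W (lift z r)" for v
          using \<phi>[OF rU W(2)[OF rU]] \<phi>[OF rU, of "lift z v"] that by simp
        ultimately show "\<forall>\<^sub>F v in at r within {u. (t, x, y, u) \<in> U}. \<phi> (lift z r) = \<phi> (lift z v)"
          unfolding eventually_at_topological by blast
      qed
    qed (use u z in auto)
  qed
  \<comment> \<open>Any height over \<open>z\<close> inside \<open>U\<close> gives the same value,
    since the fibre is connected.\<close>
  define f where "f z = \<phi> (lift z (SOME u. lift z u \<in> U))" for z
  have f: "f (base_part p) = \<phi> p" if "p \<in> U" for p
  proof -
    have "lift (base_part p) (fibre_part p) \<in> U" using that by simp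
    then show ?thesis unfolding f_def using \<phi>_fibre[of "base_part p" "SOME u. lift (base_part p) u \<in> U" "fibre_part p"] someI[of "\<lambda>u. lift (base_part p) u \<in> U" "fibre_part p"]
      by simp
  qed
  have floc: "f z = F p z" if "p \<in> U" "z \<in> base_projection (W p)" for p z
  proof -
    note p = that
    obtain p' where p': "p' \<in> W p" "z = base_part p'" using p(2) by (auto simp: base_projection_eq)
    then have "p' \<in> U" using W(3)[OF p(1)] by blast
    then show ?thesis using f \<phi>[OF p(1) p'(1)] p'(2) by simp
  qed
  have fsol: "open (base_projection (W p)) \<and> base_part p \<in> base_projection (W p) \<and> smooth_on (base_projection (W p)) f \<and> kolmogorov f (base_part p) = 0"
    if p: "p \<in> U" for p
  proof -
    have o: "open (base_projection (W p))" by (rule open_base_projection[OF W(1)[OF p]])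
    have m: "base_part p \<in> base_projection (W p)" using W(2)[OF p] by (auto simp: base_projection_eq)
    have sF: "smooth_on (base_projection (W p)) (F p)" "kolmogorov (F p) (base_part p) = 0" using form(3)[OF p] m by (auto simp: solution_iff)
    have "kolmogorov f (base_part p) = 0"
      using kolmogorov_cong[OF o sF(1) m, of f] floc[OF p] sF(2) by simp
    moreover have "smooth_on (base_projection (W p)) f" using smooth_on_cong[OF o, of f "F p"] floc[OF p] sF(1) by simp
    ultimately show ?thesis using o m by blast
  qed
  have "solution (base_projection U) f"
    unfolding solution_iff
  proof (intro conjI ballI)
    show "open (base_projection U)" by (rule open_base_projection[OF U(1)])
    show "smooth_on (base_projection U) f"
    proof (rule smooth_on_local)
      fix z assume "z \<in> base_projection U"
      then obtain p where "p \<in> U" "z = base_part p" by (auto simp: base_projection_eq)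
      then show "\<exists>N. open N \<and> z \<in> N \<and> smooth_on N f" using fsol[of p] by blast
    qed
    show "kolmogorov f z = 0" if z: "z \<in> base_projection U" for z
      using z fsol unfolding base_projection_eq[of U] by blast
  qed
  moreover have "c * t + d \<noteq> 0 \<and> \<Phi> (t, x, y, u) = symmetry_formula a b c d l0 l1 l2 l3 s f (t, x, y, u)" if p: "(t, x, y, u) \<in> U" for t x y u
  proof -
    have "f (t, x, y) = F (t, x, y, u) (t, x, y)" using f[OF p] \<phi>[OF p W(2)[OF p]] by simp
    then show ?thesis using form(4)[OF p W(2)[OF p]] by (simp add: symmetry_formula_eq)
  qed
  ultimately show ?thesis unfolding has_symmetry_form_def using form(1,2)[OF p0] by blast
qed

text \<open>Domains of a pseudogroup are arbitrary open sets, so the constants may vary between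
  components of \<open>U\<close>, and \<open>f\<close> between components of a fibre; hence the
  local description. Local formulas do not make a map injective, so there the point transformation
  is a separate requirement. A single formula is sufficient on any open set, and connectedness of
  \<open>U\<close> and of its fibres makes it necessary.\<close>

theorem theorem2:
  shows "(\<forall>U \<Phi>. (U, \<Phi>) \<in> point_symmetry_pseudogroup \<longleftrightarrow>
            point_transformation U \<Phi> \<and>
            (\<forall>p\<in>U. \<exists>W. open W \<and> p \<in> W \<and> W \<subseteq> U \<and> has_symmetry_form W \<Phi>))
       \<and> (\<forall>U \<Phi>. open U \<and> has_symmetry_form U \<Phi> \<longrightarrow> (U, \<Phi>) \<in> point_symmetry_pseudogroup)
       \<and> (\<forall>U \<Phi>. (U, \<Phi>) \<in> point_symmetry_pseudogroup \<and> connected U \<and>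
            (\<forall>t x y. connected {u. (t, x, y, u) \<in> U}) \<longrightarrow> has_symmetry_form U \<Phi>)"
proof (intro conjI allI impI)
  have loc: "\<exists>W. open W \<and> p \<in> W \<and> W \<subseteq> U \<and> has_symmetry_form W \<Phi>"
    if sym: "(U, \<Phi>) \<in> point_symmetry_pseudogroup" and p: "p \<in> U" for U \<Phi> p
  proof (cases p)
    case (fields t0 x0 y0 u0)
    obtain \<delta> where "\<delta> > 0" "box4 t0 x0 y0 u0 \<delta> \<subseteq> U"
      "has_symmetry_form (box4 t0 x0 y0 u0 \<delta>) \<Phi>"
      using symmetry_local_form[of U \<Phi> t0 x0 y0 u0] sym p fields by (auto simp: point_symmetry_pseudogroup_def)
    then show ?thesis
      by (intro exI[of _ "box4 t0 x0 y0 u0 \<delta>"]) (simp add: fields open_Times)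
  qed
  show "(U, \<Phi>) \<in> point_symmetry_pseudogroup \<longleftrightarrow>
            point_transformation U \<Phi> \<and>
            (\<forall>p\<in>U. \<exists>W. open W \<and> p \<in> W \<and> W \<subseteq> U \<and> has_symmetry_form W \<Phi>)" for U \<Phi>
    using loc maps_equation_if_local_form[of U \<Phi>] by (auto simp: point_symmetry_pseudogroup_def)
  show "(U, \<Phi>) \<in> point_symmetry_pseudogroup" if "open U \<and> has_symmetry_form U \<Phi>" for U \<Phi>
    using that point_transformation_if_form[of U \<Phi>] maps_equation_if_local_form[of U \<Phi>]
    by (auto simp: point_symmetry_pseudogroup_def)
  show "has_symmetry_form U \<Phi>" if "(U, \<Phi>) \<in> point_symmetry_pseudogroup \<and> connected U \<and> (\<forall>t x y. connected {u. (t, x, y, u) \<in> U})" for U \<Phi>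
    by (rule global_form) (use that loc in \<open>auto simp: point_symmetry_pseudogroup_def point_transformation_def\<close>)
qed

end
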